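(* Let $S$ be a locally compact Hausdorff space with countable base and let $x,x^1,x^2,\ldots\in\mathbb{D}_{\mathrm{loc}}(S)$. Then $x^k$ converges to $x$ in $\mathbb{D}_{\mathrm{loc}}(S)$ (local Skorokhod topology) as $k\to\infty$ if and only if there exists $g\in\mathrm{C}(S,\mathbb{R}_+^* )$ such that $g\cdot x,g\cdot x^1,g\cdot x^2,\ldots\in\mathbb{D}(S^\Delta)$ and $g\cdot x^k$ converges to $g\cdot x$ in $\mathbb{D}(S^\Delta)$ (global Skorokhod topology) as $k\to\infty$.
   Context: $\mathbb{R}_+^*=(0,\infty)$. $\Delta\notin S$ is a point and $S^\Delta=S\cup\{\Delta\}$ is the one-point compactification of $S$ if $S$ is not compact, and the topological sum $S\sqcup\{\Delta\}$ ($\Delta$ isolated) if $S$ is compact. $C\Subset A$ means that $C\subset A$ is contained in a compact subset of $A$. $\mathbb{D}_{\mathrm{exp}}(S)$ is the set of maps $x:[0,T_{\max})\to S$, $0\le T_{\max}\le\infty$, that are right-continuous on $[0,T_{\max})$ and have left limits $x_{t-}\in S$ at each $t\in(0,T_{\max})$; write $\xi(x):=T_{\max}$ and set $x_t:=\Delta$ for $t\ge\xi(x)$, so paths are elements of $(S^\Delta)^{\mathbb{R}_+}$. $\mathbb{D}_{\mathrm{loc}}(S)$ is the set of $x\in\mathbb{D}_{\mathrm{exp}}(S)$ such that if $\xi(x)\in(0,\infty)$ and $\{x_s\}_{s<\xi(x)}\Subset S$ then $x_{\xi(x)-}$ exists (in $S$). Local Skorokhod topology ($d$ any metric for the topology of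 $S$; the topology does not depend on $d$): the unique Polish topology on $\mathbb{D}_{\mathrm{loc}}(S)$ for which $x^k\to x$ if and only if there are $\lambda^k\in\Lambda$ such that: if $\xi(x)<\infty$ and $\{x_s\}_{s<\xi(x)}\Subset S$, then $\lambda^k_{\xi(x)}\le\xi(x^k)$ for $k$ large, $\sup_{s<\xi(x)}d(x_s,x^k_{\lambda^k_s})\to0$, $x^k_{\lambda^k_{\xi(x)}}\to\Delta$ and $\|\log\dot\lambda^k\|_{\xi(x)}\to0$; otherwise, for all $t<\xi(x)$, $\lambda^k_t<\xi(x^k)$ for $k$ large, $\sup_{s\le t}d(x_s,x^k_{\lambda^k_s})\to0$ and $\|\log\dot\lambda^k\|_t\to0$. Here $\Lambda$ is the set of increasing bijections $\lambda$ of $\mathbb{R}_+$ with $\lambda,\lambda^{-1}$ locally Lipschitz and $\|\log\dot\lambda\|_t:=\operatorname{ess\,sup}_{0\le s\le t}|\log\dot\lambda_s|$. $\mathbb{D}(S^\Delta)$ is the set of cadlag paths $\mathbb{R}_+\to S^\Delta$ (right-continuous on $\mathbb{R}_+$, with left limits in $S^\Delta$ at every $t>0$) with the global Skorokhod topology: $x^k\to x$ iff there are increasing homeomorphisms $\lambda^k$ of $\mathbb{R}_+$ with $\sup_{s\le t}\widetilde d(x_s,x^k_{\lambda^k_s})\to0$ and $\sup_{s\le t}|\lambda^k_s-s|\to0$ for all $t\ge0$, where $\widetilde d$ is any metric for $S^\Delta$. Time change by $g\in\mathrm{C}(S,\mathbb{R}_+^* )$: for $x\in\mathbb{D}_{\mathrm{exp}}(S)$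 and $t\in\mathbb{R}_+$, let $A^g_s(x):=\int_0^s\frac{\mathrm{d}u}{g(x_u)}$ for $s\in[0,\xi(x)]$ and $A^g_s(x):=\infty$ for $s>\xi(x)$, $\tau^g_t(x):=\inf\{s\ge0:A^g_s(x)\ge t\}$ ($\inf\emptyset=\infty$), and $(g\cdot x)_t:=x_{\tau^g_t(x)}$, with $x_\infty:=\Delta$. This is an element of $\mathbb{D}_{\mathrm{exp}}(S)$ with explosion time $A^g_{\xi(x)}(x)$. *)

theory Defs
  imports "HOL-Analysis.Analysis" "HOL-Probability.Essential_Supremum"
begin

text \<open>
  A path is a function on \<^typ>\<open>real\<close> of which only the values at nonnegative times matter. The
  cemetery point is \<^const>\<open>None\<close>, and the space with the cemetery adjoined is the library's
  \<^const>\<open>Alexandroff_compactification\<close>, in which \<^const>\<open>None\<close> is isolated iff the original space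
  is compact.
\<close>

type_synonym 'a trajectory = "real \<Rightarrow> 'a option"

definition explosion_time :: "'a trajectory \<Rightarrow> ereal" where
  "explosion_time x = Inf {ereal t |t. 0 \<le> t \<and> x t = None}"

text \<open>
  Before the explosion time \<^term>\<open>the (x t)\<close> is the point of the space visited at time \<open>t\<close>, so the
  limits below are limits in \<open>S\<close> itself, not in its compactification.
\<close>

definition D_exp :: "'a topology \<Rightarrow> 'a trajectory set" where
  "D_exp S = {x.
     (\<forall>t\<ge>0. if ereal t < explosion_time x then x t \<in> Some ` topspace S else x t = None) \<and>
     (\<forall>t\<ge>0. ereal t < explosion_time x \<longrightarrow> limitin S (\<lambda>s. the (x s)) (the (x t)) (at_right t)) \<and>
     (\<forall>t>0. ereal t < explosion_time x \<longrightarrow> (\<exists>l. limitin S (\<lambda>s. the (x s)) l (at_left t)))}"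

definition relatively_compact_in :: "'a topology \<Rightarrow> 'a set \<Rightarrow> bool" where
  "relatively_compact_in S C \<longleftrightarrow> (\<exists>K. compactin S K \<and> C \<subseteq> K)"

definition visited :: "'a trajectory \<Rightarrow> 'a set" where
  "visited x = {the (x s) |s. 0 \<le> s \<and> ereal s < explosion_time x}"

definition D_loc :: "'a topology \<Rightarrow> 'a trajectory set" where
  "D_loc S = {x \<in> D_exp S.
     0 < explosion_time x \<and> explosion_time x < \<infinity> \<and> relatively_compact_in S (visited x) \<longrightarrow>
       (\<exists>l. limitin S (\<lambda>s. the (x s)) l (at_left (real_of_ereal (explosion_time x))))}"

definition D_cadlag :: "'b topology \<Rightarrow> (real \<Rightarrow> 'b) set" where
  "D_cadlag Y = {y.
     (\<forall>t\<ge>0. y t \<in> topspace Y \<and> limitin Y y (y t) (at_right t)) \<and>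
     (\<forall>t>0. \<exists>l. limitin Y y l (at_left t))}"

text \<open>Increasing bijections of the half-line which are locally Lipschitz together with their inverse.\<close>

definition bilipschitz_changes :: "(real \<Rightarrow> real) set" where
  "bilipschitz_changes = {l.
     bij_betw l {0..} {0..} \<and> strict_mono_on {0..} l \<and>
     (\<forall>t\<ge>0. \<exists>C. C-lipschitz_on {0..t} l) \<and>
     (\<forall>t\<ge>0. \<exists>C. C-lipschitz_on {0..t} (inv_into {0..} l))}"

text \<open>
  A locally Lipschitz function is differentiable almost everywhere, so the value \<open>\<infinity>\<close> at the points
  of non-differentiability does not affect the essential supremum. Where the derivative of an
  element of \<^const>\<open>bilipschitz_changes\<close> exists at a positive time, it is positive, so the
  convention \<^prop>\<open>ln (0::real) = 0\<close> plays no role. Being \<^typ>\<open>ennreal\<close>-valued, the norm is \<open>0\<close>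
  for \<^prop>\<open>t = (0::real)\<close>.
\<close>

definition log_slope_norm :: "(real \<Rightarrow> real) \<Rightarrow> real \<Rightarrow> ennreal" where
  "log_slope_norm l t =
     esssup (lebesgue_on {0..t})
       (\<lambda>s. if l field_differentiable at s then ennreal \<bar>ln (deriv l s)\<bar> else \<infinity>)"

text \<open>
  Both Skorokhod topologies are specified by their convergent sequences, and only convergence of
  sequences is needed here. The suprema are taken in \<^typ>\<open>ennreal\<close>, so a supremum over the empty
  set is \<open>0\<close>. For the finitely many indices \<open>k\<close> at which the time-changed path may already have
  exploded, the values of \<^const>\<open>the\<close> are irrelevant to the limits. The metric \<open>d\<close> is meant to
  range over the metrics inducing the topology \<open>S\<close>.
\<close>

definition local_skorokhod_converges ::
  "'a topology \<Rightarrow> 'a metric \<Rightarrow> (nat \<Rightarrow> 'a trajectory) \<Rightarrow> 'a trajectory \<Rightarrow> bool" where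
  "local_skorokhod_converges S d xs x \<longleftrightarrow>
    (\<exists>l. (\<forall>k. l k \<in> bilipschitz_changes) \<and>
      (if explosion_time x < \<infinity> \<and> relatively_compact_in S (visited x)
       then
         let T = real_of_ereal (explosion_time x) in
         (\<forall>\<^sub>F k in sequentially. ereal (l k T) \<le> explosion_time (xs k)) \<and>
         (\<lambda>k. SUP s\<in>{0..<T}. ennreal (mdist d (the (x s)) (the (xs k (l k s))))) \<longlonglongrightarrow> 0 \<and>
         limitin (Alexandroff_compactification S) (\<lambda>k. xs k (l k T)) None sequentially \<and>
         (\<lambda>k. log_slope_norm (l k) T) \<longlonglongrightarrow> 0
       else
         \<forall>t\<ge>0. ereal t < explosion_time x \<longrightarrow>
           (\<forall>\<^sub>F k in sequentially. ereal (l k t) < explosion_time (xs k)) \<and>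
           (\<lambda>k. SUP s\<in>{0..t}. ennreal (mdist d (the (x s)) (the (xs k (l k s))))) \<longlonglongrightarrow> 0 \<and>
           (\<lambda>k. log_slope_norm (l k) t) \<longlonglongrightarrow> 0))"

definition increasing_homeomorphisms :: "(real \<Rightarrow> real) set" where
  "increasing_homeomorphisms =
     {l. strict_mono_on {0..} l \<and> (\<exists>l'. homeomorphism {0..} {0..} l l')}"

definition global_skorokhod_converges ::
  "'b metric \<Rightarrow> (nat \<Rightarrow> real \<Rightarrow> 'b) \<Rightarrow> (real \<Rightarrow> 'b) \<Rightarrow> bool" where
  "global_skorokhod_converges d ys y \<longleftrightarrow>
    (\<exists>l. (\<forall>k. l k \<in> increasing_homeomorphisms) \<and>
      (\<forall>t\<ge>0.
        (\<lambda>k. SUP s\<in>{0..t}. ennreal (mdist d (y s) (ys k (l k s)))) \<longlonglongrightarrow> 0 \<and>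
        (\<lambda>k. SUP s\<in>{0..t}. ennreal \<bar>l k s - s\<bar>) \<longlonglongrightarrow> 0))"

text \<open>
  The additive functional is needed at finite times only: its value at time \<open>\<infinity>\<close> cannot change the
  infimum in \<open>inverse_clock\<close>.
\<close>

definition clock :: "('a \<Rightarrow> real) \<Rightarrow> 'a trajectory \<Rightarrow> real \<Rightarrow> ennreal" where
  "clock g x s =
     (if ereal s \<le> explosion_time x
      then \<integral>\<^sup>+u\<in>{0..<s}. ennreal (1 / g (the (x u))) \<partial>lborel
      else \<infinity>)"

definition inverse_clock :: "('a \<Rightarrow> real) \<Rightarrow> 'a trajectory \<Rightarrow> real \<Rightarrow> ereal" where
  "inverse_clock g x t = Inf {ereal s |s. 0 \<le> s \<and> ennreal t \<le> clock g x s}"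

definition time_change :: "('a \<Rightarrow> real) \<Rightarrow> 'a trajectory \<Rightarrow> 'a trajectory" where
  "time_change g x t =
     (if inverse_clock g x t = \<infinity> then None else x (real_of_ereal (inverse_clock g x t)))"

end

theory Submission
  imports Defs
begin

text \<open>
  Put \<open>A\<close> for the clock of \<open>x\<close> and \<open>A\<^sup>k\<close> for that of \<open>x\<^sup>k\<close>. If \<open>\<lambda>\<^sup>k\<close> are the time changes
  of a local convergence, then \<open>A\<^sup>k \<circ> \<lambda>\<^sup>k \<circ> A\<^sup>-\<^sup>1\<close> match the time-changed paths and are close to the
  identity, because their local growth rates compare multiplicatively at every time by right
  continuity. The speed \<open>g\<close> is a function of the distance to the cemetery which vanishes so fast that
  a path leaving every compact set never explodes after the time change, and that, when \<open>x\<close> explodes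
  inside a compact set, the paths \<open>x\<^sup>k\<close>, which are then already close to the cemetery, stay there for
  longer and longer times. Both requirements bound \<open>g\<close> on countably many neighbourhoods of the
  cemetery, only finitely many of which contain a given point of \<open>S\<close>.

  Conversely, given homeomorphisms \<open>\<mu>\<^sup>k\<close> of a global convergence, \<open>\<nu>\<^sup>k = (A\<^sup>k)\<^sup>-\<^sup>1 \<circ> \<mu>\<^sup>k \<circ> A\<close> need not
  be bilipschitz, but it has slopes close to 1 between the points of a finite partition on whose
  intervals \<open>x\<close> oscillates little. Its piecewise linear interpolation is the required time change.
\<close>

section \<open>Bilipschitz time changes of the half-line\<close>

text \<open>Both directions treat one window \<open>{0..T}\<close> at one precision at a time; a
  diagonal choice over windows and precisions then gives the single sequence of time changes that
  convergence asks for. The window may end at a finite explosion time: if \<open>x\<close> stays in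
  a compact set, the speed along it is bounded below, so its clock is finite and continuous up to
  and including \<open>T\<close>. This is why many hypotheses read
  \<open>ereal T \<le> explosion_time x\<close> and not \<open><\<close>. Errors are factors
  \<open>q > 1\<close>. Relative to a reference speed, the rate of \<open>x\<close> costs one
  factor, that of an approximating path two, and the time change between them one; hence
  \<open>q ^ 4\<close> in both directions. In the converse, uniform closeness to the identity
  controls the increments of a homeomorphism only over intervals of fixed length, so the partition
  has to be chosen before the index tends to infinity.\<close>

lemma locally_decreasing_imp_le:
  fixes h :: "real \<Rightarrow> real"
  assumes "a \<le> b" and cont: "continuous_on {a..b} h"
    and loc: "\<And>s. a \<le> s \<Longrightarrow> s < b \<Longrightarrow> \<exists>\<delta>>0. \<forall>r. s < r \<and> r < s + \<delta> \<and> r \<le> b \<longrightarrow> h r \<le> h s"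
  shows "h b \<le> h a"
proof -
  \<comment> \<open>If the last point of \<open>A\<close> lay before \<open>b\<close>, further
    points of \<open>A\<close> would follow it. Only increments to the right enter, which suits
    clocks whose rates are merely right-continuous.\<close>
  define A where "A = {s\<in>{a..b}. h s \<le> h a}"
  have "closed A"
    unfolding A_def using continuous_on_closed_Collect_le[OF cont continuous_on_const] by simp
  moreover have "bounded A"
    by (rule bounded_subset[of "{a..b}"]) (auto simp: A_def)
  ultimately have "compact A"
    by (simp add: compact_eq_bounded_closed)
  moreover have "a \<in> A"
    using \<open>a \<le> b\<close> by (simp add: A_def)
  ultimately obtain c where c: "c \<in> A" "\<And>s. s \<in> A \<Longrightarrow> s \<le> c"
    by (metis compact_attains_sup empty_iff)
  have "c = b"
  proof (rule ccontr)
    assume "c \<noteq> b"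
    then have "a \<le> c" "c < b" "h c \<le> h a"
      using c(1) by (auto simp: A_def)
    then obtain \<delta> where \<delta>: "\<delta> > 0" "\<And>r. c < r \<Longrightarrow> r < c + \<delta> \<Longrightarrow> r \<le> b \<Longrightarrow> h r \<le> h c"
      using loc[of c] by blast
    define r where "r = min b (c + \<delta> / 2)"
    have "c < r" "r < c + \<delta>" "r \<le> b"
      using \<open>c < b\<close> \<delta>(1) by (auto simp: r_def min_def)
    then have "r \<in> A"
      using \<delta>(2)[of r] \<open>a \<le> c\<close> \<open>h c \<le> h a\<close> by (auto simp: A_def)
    then show False
      using c(2) \<open>c < r\<close> by fastforce
  qed
  then show ?thesis
    using c(1) by (simp add: A_def)
qed

lemma eventually_at_right_realE:
  fixes s :: real
  assumes "\<forall>\<^sub>F r in at_right s. P r"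
  obtains c where "s < c" "\<And>r. s < r \<Longrightarrow> r < c \<Longrightarrow> P r"
  using assms unfolding eventually_at_right_field by auto

lemma eventually_at_left_realE:
  fixes s :: real
  assumes "\<forall>\<^sub>F r in at_left s. P r"
  obtains c where "c < s" "\<And>r. c < r \<Longrightarrow> r < s \<Longrightarrow> P r"
  using assms unfolding eventually_at_left_field by auto

text \<open>The exceptional null set is covered by an open set \<open>U\<close> of measure below
  \<open>\<eta>\<close>. The Lipschitz constant bounds the growth on \<open>U\<close>, the
  derivative bounds it elsewhere, and the contribution of \<open>U\<close> is at most
  \<open>(C + \<bar>M\<bar>) * \<eta>\<close>.\<close>

lemma lipschitz_deriv_le_imp_slope_le:
  fixes f :: "real \<Rightarrow> real"
  assumes "a \<le> b" and lip: "C-lipschitz_on {a..b} f" and N: "negligible N"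
    and deriv: "\<And>s. a < s \<Longrightarrow> s < b \<Longrightarrow> s \<notin> N \<Longrightarrow> \<exists>D\<le>M. (f has_real_derivative D) (at s)"
  shows "f b - f a \<le> M * (b - a)"
proof -
  have "C \<ge> 0"
    using lip by (rule lipschitz_on_nonneg)
  have bound: "f b - f a \<le> (M + \<eta>) * (b - a) + (C + \<bar>M\<bar>) * \<eta>" if "\<eta> > 0" for \<eta>
  proof -
    \<comment> \<open>The derivative is assumed only inside the interval, so the left endpoint joins
      the exceptional set.\<close>
    have "negligible (insert a N)"
      using N by simp
    then have "insert a N \<in> sets lebesgue"
      by (rule negligible_imp_sets)
    from sets_lebesgue_outer_open[OF this \<open>\<eta> > 0\<close>]
    obtain U where U: "open U" "insert a N \<subseteq> U" "U - insert a N \<in> lmeasurable"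
      "emeasure lebesgue (U - insert a N) < ennreal \<eta>"
      by metis
    have Um: "U \<in> lmeasurable" "measure lebesgue U < \<eta>"
    proof -
      have eq: "U = (U - insert a N) \<union> insert a N"
        using U(2) by auto
      show "U \<in> lmeasurable"
        by (subst eq) (intro fmeasurable.Un U(3) negligible_imp_measurable \<open>negligible (insert a N)\<close>)
      have "measure lebesgue U \<le> measure lebesgue (U - insert a N) + measure lebesgue (insert a N)"
        by (subst eq, rule measure_Un_le) (use U(3) \<open>insert a N \<in> sets lebesgue\<close> in auto)
      also have "measure lebesgue (insert a N) = 0"
        using \<open>negligible (insert a N)\<close> by (rule negligible_imp_measure0)
      also have "measure lebesgue (U - insert a N) < \<eta>"
        using U(3,4) \<open>\<eta> > 0\<close> by (simp add: emeasure_eq_measure2 ennreal_less_iff)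
      finally show "measure lebesgue U < \<eta>"
        by simp
    qed
    define u where "u s = measure lebesgue (U \<inter> {a..s})" for s
    have Uint: "U \<inter> {p..q} \<in> lmeasurable" for p q
      using Um(1) by (simp add: fmeasurable_Int_fmeasurable)
    have split: "u r = u s + measure lebesgue (U \<inter> {s<..r})" if "a \<le> s" "s \<le> r" for s r
    proof -
      have "U \<inter> {a..r} = (U \<inter> {a..s}) \<union> (U \<inter> {s<..r})"
        using that by auto
      moreover have "measure lebesgue ((U \<inter> {a..s}) \<union> (U \<inter> {s<..r})) = u s + measure lebesgue (U \<inter> {s<..r})"
        unfolding u_def
        by (rule measure_Un_AE) (use Uint[of a s] Um(1) in \<open>auto simp: fmeasurable_Int_fmeasurable\<close>)
      ultimately show ?thesis
        by (simp add: u_def)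
    qed
    have ulip: "1-lipschitz_on {a..b} u"
    proof (rule lipschitz_onI)
      have *: "dist (u s) (u r) \<le> 1 * dist s r" if "a \<le> s" "s \<le> r" for s r
      proof -
        have "measure lebesgue (U \<inter> {s<..r}) \<le> measure lebesgue {s<..r}"
          by (rule measure_mono_fmeasurable) (use Um(1) in \<open>auto intro: bounded_set_imp_lmeasurable\<close>)
        also have "\<dots> = r - s"
          using \<open>s \<le> r\<close> by simp
        finally show ?thesis
          using split[OF that] by (simp add: dist_real_def that)
      qed
      show "dist (u s) (u r) \<le> 1 * dist s r" if "s \<in> {a..b}" "r \<in> {a..b}" for s r
        using that *[of s r] *[of r s] by (cases "s \<le> r") (simp_all add: dist_commute)
    qed simp
    \<comment> \<open>On \<open>U\<close>, where nothing is known about the derivative, \<open>u\<close> has slope 1 and dominates the growth of \<open>f\<close>.\<close>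
    define h where "h s = f s - (M + \<eta>) * (s - a) - (C + \<bar>M\<bar>) * u s" for s
    have "h b \<le> h a"
    proof (rule locally_decreasing_imp_le[OF \<open>a \<le> b\<close>])
      show "continuous_on {a..b} h"
        unfolding h_def
        by (intro continuous_intros lipschitz_on_continuous_on[OF lip] lipschitz_on_continuous_on[OF ulip])
    next
      fix s assume s: "a \<le> s" "s < b"
      show "\<exists>\<delta>>0. \<forall>r. s < r \<and> r < s + \<delta> \<and> r \<le> b \<longrightarrow> h r \<le> h s"
      proof (cases "s \<in> U")
        case True
        then obtain e where e: "e > 0" "ball s e \<subseteq> U"
          using U(1) openE by blast
        have "h r \<le> h s" if r: "s < r" "r < s + min e 1" "r \<le> b" for r
        proof -
          have fr: "\<bar>f r - f s\<bar> \<le> C * (r - s)"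
            using lipschitz_onD[OF lip, of r s] s r by (simp add: dist_real_def)
          have "U \<inter> {s<..r} = {s<..r}"
            using e(2) r by (auto simp: dist_real_def subset_iff)
          then have ur: "u r = u s + (r - s)"
            using split[of s r] s r by simp
          \<comment> \<open>The subtracted terms grow at rate
            \<open>M + \<eta> + C + \<bar>M\<bar>\<close> on \<open>U\<close>, which is at least
            \<open>C\<close> whatever the sign of \<open>M\<close>.\<close>
          have "f r - f s \<le> C * (r - s)" "0 \<le> (M + \<bar>M\<bar>) * (r - s)" "0 \<le> \<eta> * (r - s)"
            using fr r \<open>\<eta> > 0\<close> by auto
          then show "h r \<le> h s"
            unfolding h_def ur by (simp add: algebra_simps)
        qed
        then show ?thesis
          using e(1) by (intro exI[of _ "min e 1"]) auto
      next
        case False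
        then have "s \<notin> N" "s \<noteq> a"
          using U(2) by auto
        then have "a < s"
          using s by simp
        obtain D where D: "D \<le> M" "(f has_real_derivative D) (at s)"
          using deriv[OF \<open>a < s\<close> s(2) \<open>s \<notin> N\<close>] by blast
        from D(2) have "((\<lambda>r. (f r - f s) / (r - s)) \<longlongrightarrow> D) (at_right s)"
          unfolding has_field_derivative_iff by (rule tendsto_mono[OF at_le[OF subset_UNIV]])
        then have "\<forall>\<^sub>F r in at_right s. (f r - f s) / (r - s) < M + \<eta>"
          by (rule order_tendstoD) (use D \<open>\<eta> > 0\<close> in auto)
        then obtain c where c: "c > s" "\<And>r. s < r \<Longrightarrow> r < c \<Longrightarrow> (f r - f s) / (r - s) < M + \<eta>"
          by (rule eventually_at_right_realE) (rule that)
        have "h r \<le> h s" if r: "s < r" "r < s + (c - s)" "r \<le> b" for r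
        proof -
          have "f r - f s \<le> (M + \<eta>) * (r - s)"
            using c(2)[of r] r by (simp add: divide_less_eq)
          moreover have "(C + \<bar>M\<bar>) * u s \<le> (C + \<bar>M\<bar>) * u r"
            using split[of s r] s r \<open>C \<ge> 0\<close> by (intro mult_left_mono) auto
          ultimately show ?thesis
            by (simp add: h_def algebra_simps)
        qed
        then show ?thesis
          using c(1) by (intro exI[of _ "c - s"]) auto
      qed
    qed
    moreover have "(C + \<bar>M\<bar>) * u b \<le> (C + \<bar>M\<bar>) * \<eta>"
    proof (rule mult_left_mono)
      have "u b \<le> measure lebesgue U"
        unfolding u_def by (rule measure_mono_fmeasurable) (use Um Uint in auto)
      then show "u b \<le> \<eta>"
        using Um(2) by simp
    qed (use \<open>C \<ge> 0\<close> in auto)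
    moreover have "(C + \<bar>M\<bar>) * u a \<ge> 0"
      using \<open>C \<ge> 0\<close> by (simp add: u_def)
    ultimately show ?thesis
      unfolding h_def by (simp add: algebra_simps)
  qed
  have "((\<lambda>\<eta>. (M + \<eta>) * (b - a) + (C + \<bar>M\<bar>) * \<eta>) \<longlongrightarrow> (M + 0) * (b - a) + (C + \<bar>M\<bar>) * 0) (at_right 0)"
    by (intro tendsto_intros)
  moreover have "\<forall>\<^sub>F \<eta> in at_right 0. f b - f a \<le> (M + \<eta>) * (b - a) + (C + \<bar>M\<bar>) * \<eta>"
    using eventually_at_right_less[of "0::real"] by (rule eventually_mono) (rule bound)
  ultimately have "f b - f a \<le> (M + 0) * (b - a) + (C + \<bar>M\<bar>) * 0"
    by (rule tendsto_lowerbound) simp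
  then show ?thesis
    by simp
qed

section \<open>Criteria for homeomorphisms and bilipschitz changes of the half-line\<close>

lemma image_half_line_eq:
  fixes f :: "real \<Rightarrow> real"
  assumes mono: "strict_mono_on {0..} f" and cont: "continuous_on {0..} f" and "f 0 = 0"
    and unbounded: "\<And>y. \<exists>s\<ge>0. y \<le> f s"
  shows "f ` {0..} = {0..}"
proof
  show "f ` {0..} \<subseteq> {0..}"
    using strict_mono_on_leD[OF mono, of 0] \<open>f 0 = 0\<close> by auto
  show "{0..} \<subseteq> f ` {0..}"
  proof
    fix y :: real assume y: "y \<in> {0..}"
    obtain s where s: "s \<ge> 0" "y \<le> f s"
      using unbounded by blast
    have "continuous_on {0..s} f"
      using cont by (rule continuous_on_subset) auto
    then obtain u where "0 \<le> u" "u \<le> s" "f u = y"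
      using IVT'[of f 0 y s] s y \<open>f 0 = 0\<close> by auto
    then show "y \<in> f ` {0..}"
      by auto
  qed
qed

lemma increasing_homeomorphismsI:
  assumes mono: "strict_mono_on {0..} f" and cont: "continuous_on {0..} f" and "f 0 = 0"
    and unbounded: "\<And>y. \<exists>s\<ge>0. y \<le> f s"
  shows "f \<in> increasing_homeomorphisms"
proof -
  have "path_connected {0::real..}"
    by (intro convex_imp_path_connected convex_real_interval)
  then have "\<exists>g. homeomorphism {0..} {0..} f g"
    using homeomorphism_into_1d[OF _ cont image_half_line_eq[OF assms] strict_mono_on_imp_inj_on[OF mono]]
    by blast
  then show ?thesis
    using mono by (simp add: increasing_homeomorphisms_def)
qed

lemma bilipschitz_changesI:
  assumes "q \<ge> 1" "l 0 = 0"
    and bounds: "\<And>r s. 0 \<le> r \<Longrightarrow> r \<le> s \<Longrightarrow> (s - r) / q \<le> l s - l r \<and> l s - l r \<le> q * (s - r)"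
  shows "l \<in> bilipschitz_changes"
proof -
  have mono: "strict_mono_on {0..} l"
  proof (rule strict_mono_onI)
    fix r s :: real assume "r \<in> {0..}" "s \<in> {0..}" "r < s"
    moreover from this have "0 < (s - r) / q"
      using \<open>q \<ge> 1\<close> by simp
    ultimately show "l r < l s"
      using bounds[of r s] by auto
  qed
  have dist: "dist (l r) (l s) \<le> q * dist r s \<and> dist r s \<le> q * dist (l r) (l s)"
    if "r \<ge> 0" "s \<ge> 0" for r s
  proof -
    have *: "dist (l r) (l s) \<le> q * dist r s \<and> dist r s \<le> q * dist (l r) (l s)" if "0 \<le> r" "r \<le> s" for r s
    proof -
      have "l r \<le> l s"
        using mono that by (simp add: strict_mono_on_leD)
      then show ?thesis
        using bounds[OF that] that \<open>q \<ge> 1\<close> by (auto simp: dist_real_def field_simps)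
    qed
    show ?thesis
      using *[of r s] *[of s r] that by (cases "r \<le> s") (auto simp: dist_commute)
  qed
  have lip: "q-lipschitz_on {0..} l"
    by (rule lipschitz_onI) (use dist \<open>q \<ge> 1\<close> in auto)
  have image: "l ` {0..} = {0..}"
  proof (rule image_half_line_eq[OF mono lipschitz_on_continuous_on[OF lip] \<open>l 0 = 0\<close>])
    show "\<exists>s\<ge>0. y \<le> l s" for y
      using bounds[of 0 "q * \<bar>y\<bar>"] \<open>q \<ge> 1\<close> \<open>l 0 = 0\<close> by (intro exI[of _ "q * \<bar>y\<bar>"]) auto
  qed
  have "q-lipschitz_on {0..t} (inv_into {0..} l)" for t
  proof (rule lipschitz_onI)
    fix r s assume "r \<in> {0..t}" "s \<in> {0..t}"
    then have *: "r \<in> l ` {0..}" "s \<in> l ` {0..}"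
      using image by auto
    then show "dist (inv_into {0..} l r) (inv_into {0..} l s) \<le> q * dist r s"
      using dist[of "inv_into {0..} l r" "inv_into {0..} l s"] inv_into_into[OF *(1)] inv_into_into[OF *(2)]
      by (simp add: f_inv_into_f)
  qed (use \<open>q \<ge> 1\<close> in auto)
  moreover have "q-lipschitz_on {0..t} l" for t
    using lip by (rule lipschitz_on_subset) auto
  ultimately show ?thesis
    using mono image by (auto simp: bilipschitz_changes_def bij_betw_def strict_mono_on_imp_inj_on)
qed

text \<open>A bound on the derivative almost everywhere integrates to one on increments because
  \<open>l\<close> is Lipschitz. The lower bound is the upper one for \<open>- l\<close>.\<close>

lemma log_slope_norm_less_imp_bilipschitz:
  assumes l: "l \<in> bilipschitz_changes" and norm: "log_slope_norm l t < ennreal \<eta>"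
    and rs: "0 \<le> r" "r \<le> s" "s \<le> t"
  shows "exp (- \<eta>) * (s - r) \<le> l s - l r" "l s - l r \<le> exp \<eta> * (s - r)"
proof -
  have \<eta>: "\<eta> > 0"
  proof (rule ccontr)
    assume "\<not> \<eta> > 0"
    then have "ennreal \<eta> = 0"
      by (simp add: ennreal_neg)
    then show False
      using norm by simp
  qed
  define f where "f s = (if l field_differentiable at s then ennreal \<bar>ln (deriv l s)\<bar> else \<infinity>)" for s
  have mono: "strict_mono_on {0..} l" and bij: "bij_betw l {0..} {0..}"
    using l by (auto simp: bilipschitz_changes_def)
  have "t \<ge> 0"
    using rs by simp
  then obtain C where C: "C-lipschitz_on {0..t} l"
    using l by (auto simp: bilipschitz_changes_def)
  have "l t \<ge> 0"
    using bij \<open>t \<ge> 0\<close> by (auto simp: bij_betw_def)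
  then obtain C' where C': "C'-lipschitz_on {0..l t} (inv_into {0..} l)"
    using l by (auto simp: bilipschitz_changes_def)
  have "AE u in lebesgue_on {0..t}. f u < ennreal \<eta>"
    using esssup_AE[where M = "lebesgue_on {0..t}" and f = f] norm
    unfolding log_slope_norm_def f_def[symmetric] by (auto elim!: eventually_mono)
  then have "AE u in lebesgue. u \<in> {0..t} \<longrightarrow> f u < ennreal \<eta>"
    by (subst (asm) AE_restrict_space_iff) auto
  then obtain N where N: "{u. \<not> (u \<in> {0..t} \<longrightarrow> f u < ennreal \<eta>)} \<subseteq> N" "negligible N"
    by (auto simp: eventually_ae_filter negligible_iff_null_sets)
  have deriv: "\<exists>D. (l has_real_derivative D) (at u) \<and> exp (- \<eta>) \<le> D \<and> D \<le> exp \<eta>"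
    if u: "r < u" "u < s" "u \<notin> N" for u
  proof -
    have "u \<in> {0..t}"
      using u rs by simp
    then have fu: "f u < ennreal \<eta>"
      using u(3) N(1) by auto
    then have "l field_differentiable at u"
      by (auto simp: f_def split: if_splits)
    then have D: "(l has_real_derivative deriv l u) (at u)"
      using DERIV_deriv_iff_field_differentiable by blast
    have "f u = ennreal \<bar>ln (deriv l u)\<bar>"
      using \<open>l field_differentiable at u\<close> by (simp add: f_def)
    then have ln: "\<bar>ln (deriv l u)\<bar> < \<eta>"
      using fu by (simp add: ennreal_less_iff)
    have "C' \<ge> 0"
      using C' by (rule lipschitz_on_nonneg)
    \<comment> \<open>A bound on \<open>\<bar>ln (deriv l u)\<bar>\<close> says nothing at
      derivative 0, where \<open>ln\<close> is 0 by convention. The Lipschitz constant of the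
      inverse keeps the derivative away from 0; the summand 1 covers \<open>C' = 0\<close>.\<close>
    have "1 / (C' + 1) \<le> deriv l u"
    proof (rule tendsto_lowerbound)
      show "((\<lambda>v. (l v - l u) / (v - u)) \<longlongrightarrow> deriv l u) (at_right u)"
        using D unfolding has_field_derivative_iff by (rule tendsto_mono[OF at_le[OF subset_UNIV]])
      have "1 / (C' + 1) \<le> (l v - l u) / (v - u)" if v: "u < v" "v < t" for v
      proof -
        have lt: "l u < l v" "l v \<le> l t" "0 \<le> l u"
          using strict_mono_onD[OF mono, of u v] strict_mono_on_leD[OF mono, of v t] bij_betwE[OF bij] v u rs
          by auto
        then have "dist (inv_into {0..} l (l v)) (inv_into {0..} l (l u)) \<le> C' * dist (l v) (l u)"
          by (intro lipschitz_onD[OF C']) auto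
        then have "v - u \<le> C' * (l v - l u)"
          using u v rs lt bij_betw_inv_into_left[OF bij, of u] bij_betw_inv_into_left[OF bij, of v]
          by (simp add: dist_real_def)
        also have "\<dots> \<le> (C' + 1) * (l v - l u)"
          using lt by (intro mult_right_mono) auto
        finally show ?thesis
          using v \<open>C' \<ge> 0\<close> by (simp add: field_simps)
      qed
      then show "\<forall>\<^sub>F v in at_right u. 1 / (C' + 1) \<le> (l v - l u) / (v - u)"
        using u rs by (auto simp: eventually_at_right_field intro!: exI[of _ t])
    qed simp
    then have "deriv l u > 0"
      using \<open>C' \<ge> 0\<close> by (smt (verit) divide_pos_pos)
    then have "exp (ln (deriv l u)) = deriv l u"
      by simp
    moreover have "exp (- \<eta>) \<le> exp (ln (deriv l u))" "exp (ln (deriv l u)) \<le> exp \<eta>"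
      using ln by auto
    ultimately have "exp (- \<eta>) \<le> deriv l u" "deriv l u \<le> exp \<eta>"
      by simp_all
    then show ?thesis
      using D by blast
  qed
  have lip: "C-lipschitz_on {r..s} l"
    using C by (rule lipschitz_on_subset) (use rs in auto)
  show "l s - l r \<le> exp \<eta> * (s - r)"
    by (rule lipschitz_deriv_le_imp_slope_le[OF rs(2) lip N(2)]) (use deriv in blast)
  have "- l s - - l r \<le> - exp (- \<eta>) * (s - r)"
  proof (rule lipschitz_deriv_le_imp_slope_le[OF rs(2) _ N(2)])
    show "C-lipschitz_on {r..s} (\<lambda>u. - l u)"
      using lip by (simp add: lipschitz_on_def dist_minus)
    fix u assume "r < u" "u < s" "u \<notin> N"
    then obtain D where "(l has_real_derivative D) (at u)" "exp (- \<eta>) \<le> D"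
      using deriv by blast
    then show "\<exists>D\<le>- exp (- \<eta>). ((\<lambda>u. - l u) has_real_derivative D) (at u)"
      by (intro exI[of _ "- D"]) (auto intro: DERIV_minus)
  qed
  then show "exp (- \<eta>) * (s - r) \<le> l s - l r"
    by simp
qed

text \<open>
  The Borel function \<open>h\<close> makes the integrand of \<^const>\<open>log_slope_norm\<close> measurable; a non-measurable
  integrand would have essential supremum \<open>\<infinity>\<close>.
\<close>

definition slopes_within :: "real \<Rightarrow> real \<Rightarrow> real \<Rightarrow> (real \<Rightarrow> real) \<Rightarrow> bool" where
  "slopes_within q a b l \<longleftrightarrow>
     (\<forall>r s. a \<le> r \<longrightarrow> r \<le> s \<longrightarrow> s \<le> b \<longrightarrow> (s - r) / q \<le> l s - l r \<and> l s - l r \<le> q * (s - r)) \<and>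
     (\<exists>F h. finite F \<and> h \<in> borel_measurable borel \<and>
        (\<forall>s. a < s \<longrightarrow> s < b \<longrightarrow> s \<notin> F \<longrightarrow>
          (l has_real_derivative h s) (at s) \<and> 1 / q \<le> h s \<and> h s \<le> q))"

section \<open>Piecewise linear time changes\<close>

lemma slopes_within_linear:
  assumes "1 / q \<le> m" "m \<le> q"
  shows "slopes_within q a b (\<lambda>s. c + m * (s - a))"
  unfolding slopes_within_def
proof (intro conjI allI impI)
  fix r s :: real assume "r \<le> s"
  then have "1 / q * (s - r) \<le> m * (s - r)" "m * (s - r) \<le> q * (s - r)"
    using assms by (intro mult_right_mono; simp)+
  then show "(s - r) / q \<le> c + m * (s - a) - (c + m * (r - a))"
    "c + m * (s - a) - (c + m * (r - a)) \<le> q * (s - r)"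
    by (simp_all add: algebra_simps diff_divide_distrib)
next
  show "\<exists>F h. finite F \<and> h \<in> borel_measurable borel \<and>
        (\<forall>s. a < s \<longrightarrow> s < b \<longrightarrow> s \<notin> F \<longrightarrow>
          ((\<lambda>s. c + m * (s - a)) has_real_derivative h s) (at s) \<and> 1 / q \<le> h s \<and> h s \<le> q)"
    using assms by (intro exI[of _ "{}"] exI[of _ "\<lambda>_. m"]) (auto intro!: derivative_eq_intros)
qed

text \<open>The one-sided derivatives at the seam may differ, so \<open>b\<close> joins the finite
  exceptional set. Increments across the seam add up because the two maps agree there.\<close>

lemma slopes_within_glue:
  assumes "slopes_within q a b l1" "slopes_within q b c l2" "l1 b = l2 b"
  shows "slopes_within q a c (\<lambda>s. if s \<le> b then l1 s else l2 s)"
proof -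
  let ?l = "\<lambda>s. if s \<le> b then l1 s else l2 s"
  obtain F1 h1 where 1: "finite F1" "h1 \<in> borel_measurable borel"
    "\<And>s. a < s \<Longrightarrow> s < b \<Longrightarrow> s \<notin> F1 \<Longrightarrow> (l1 has_real_derivative h1 s) (at s) \<and> 1 / q \<le> h1 s \<and> h1 s \<le> q"
    using assms(1) unfolding slopes_within_def by blast
  obtain F2 h2 where 2: "finite F2" "h2 \<in> borel_measurable borel"
    "\<And>s. b < s \<Longrightarrow> s < c \<Longrightarrow> s \<notin> F2 \<Longrightarrow> (l2 has_real_derivative h2 s) (at s) \<and> 1 / q \<le> h2 s \<and> h2 s \<le> q"
    using assms(2) unfolding slopes_within_def by blast
  let ?h = "\<lambda>s. if s \<le> b then h1 s else h2 s"
  have "(?l has_real_derivative ?h s) (at s) \<and> 1 / q \<le> ?h s \<and> ?h s \<le> q"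
    if s: "a < s" "s < c" "s \<notin> insert b (F1 \<union> F2)" for s
  proof (cases "s < b")
    case True
    have "(?l has_real_derivative h1 s) (at s)"
      by (rule has_field_derivative_transform_within_open[of l1 _ _ "{..<b}"]) (use 1(3)[of s] s True in auto)
    then show ?thesis
      using 1(3)[of s] s True by simp
  next
    case False
    then have "b < s"
      using s by auto
    have "(?l has_real_derivative h2 s) (at s)"
      by (rule has_field_derivative_transform_within_open[of l2 _ _ "{b<..}"]) (use 2(3)[of s] s \<open>b < s\<close> in auto)
    then show ?thesis
      using 2(3)[of s] s \<open>b < s\<close> by simp
  qed
  moreover have "?h \<in> borel_measurable borel"
    using 1(2) 2(2) by measurable
  moreover have "finite (insert b (F1 \<union> F2))"
    using 1(1) 2(1) by simp
  moreover have "(s - r) / q \<le> ?l s - ?l r \<and> ?l s - ?l r \<le> q * (s - r)" if "a \<le> r" "r \<le> s" "s \<le> c" for r s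
  proof -
    have b1: "(s - r) / q \<le> l1 s - l1 r \<and> l1 s - l1 r \<le> q * (s - r)" if "a \<le> r" "r \<le> s" "s \<le> b" for r s
      using assms(1) that by (auto simp: slopes_within_def)
    have b2: "(s - r) / q \<le> l2 s - l2 r \<and> l2 s - l2 r \<le> q * (s - r)" if "b \<le> r" "r \<le> s" "s \<le> c" for r s
      using assms(2) that by (auto simp: slopes_within_def)
    consider "s \<le> b" | "b < r" | "r \<le> b" "b < s"
      by linarith
    then show ?thesis
    proof cases
      case 3
      then show ?thesis
        using b1[of r b] b2[of b s] that \<open>l1 b = l2 b\<close> by (auto simp: diff_divide_distrib algebra_simps)
    qed (use b1[of r s] b2[of r s] that in auto)
  qed
  ultimately show ?thesis
    unfolding slopes_within_def by blast
qed

lemma slopes_within_extend: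
  assumes l: "slopes_within q 0 T l" and "l 0 = 0" "q \<ge> 1" "T \<ge> 0"
  obtains l' where "l' \<in> bilipschitz_changes" "\<And>s. 0 \<le> s \<Longrightarrow> s \<le> T \<Longrightarrow> l' s = l s"
    "log_slope_norm l' T \<le> ennreal (ln q)"
proof -
  \<comment> \<open>Slope 1 lies between \<open>1 / q\<close> and \<open>q\<close>, so the increment
    bounds persist past \<open>T\<close>.\<close>
  define l' where "l' s = (if s \<le> T then l s else l T + 1 * (s - T))" for s
  have "slopes_within q 0 b l'" for b
    unfolding l'_def
    by (rule slopes_within_glue[OF l slopes_within_linear]) (use \<open>q \<ge> 1\<close> in auto)
  then have "(s - r) / q \<le> l' s - l' r \<and> l' s - l' r \<le> q * (s - r)" if "0 \<le> r" "r \<le> s" for r s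
    using that unfolding slopes_within_def by blast
  then have "l' \<in> bilipschitz_changes"
    by (intro bilipschitz_changesI[OF \<open>q \<ge> 1\<close>]) (use assms in \<open>auto simp: l'_def\<close>)
  moreover have "log_slope_norm l' T \<le> ennreal (ln q)"
  proof -
    obtain F h where h: "finite F" "h \<in> borel_measurable borel"
      "\<And>s. 0 < s \<Longrightarrow> s < T \<Longrightarrow> s \<notin> F \<Longrightarrow> (l has_real_derivative h s) (at s) \<and> 1 / q \<le> h s \<and> h s \<le> q"
      using l unfolding slopes_within_def by blast
    let ?f = "\<lambda>s. if l' field_differentiable at s then ennreal \<bar>ln (deriv l' s)\<bar> else \<infinity>"
    have D: "?f s = ennreal \<bar>ln (h s)\<bar>" "ennreal \<bar>ln (h s)\<bar> \<le> ennreal (ln q)"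
      if s: "0 < s" "s < T" "s \<notin> F" for s
    proof -
      have "(l' has_real_derivative h s) (at s)"
        by (rule has_field_derivative_transform_within_open[of l _ _ "{..<T}"])
          (use h(3)[of s] s in \<open>auto simp: l'_def\<close>)
      then show "?f s = ennreal \<bar>ln (h s)\<bar>"
        by (auto simp: DERIV_imp_deriv field_differentiable_def)
      have "1 / q \<le> h s" "h s \<le> q"
        using h(3)[of s] s by auto
      moreover have "0 < 1 / q"
        using \<open>q \<ge> 1\<close> by simp
      ultimately have "ln (1 / q) \<le> ln (h s)" "ln (h s) \<le> ln q"
        using \<open>q \<ge> 1\<close> by (subst ln_le_cancel_iff; linarith)+
      then show "ennreal \<bar>ln (h s)\<bar> \<le> ennreal (ln q)"
        using \<open>q \<ge> 1\<close> by (intro ennreal_leI) (simp add: ln_div)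
    qed
    have "insert 0 (insert T F) \<in> null_sets lebesgue"
      using h(1) by (simp add: finite_imp_null_set_lborel null_sets_completionI)
    then have ae: "AE s in lebesgue. s \<notin> insert 0 (insert T F)"
      by (rule AE_not_in)
    have "(\<lambda>s. ennreal \<bar>ln (h s)\<bar>) \<in> borel_measurable lebesgue"
      using h(2) by (auto intro!: measurable_completion)
    then have "(\<lambda>s. ennreal \<bar>ln (h s)\<bar>) \<in> borel_measurable (lebesgue_on {0..T})"
      by (rule measurable_restrict_space1)
    then have "?f \<in> borel_measurable (lebesgue_on {0..T})"
    proof (rule measurable_discrete_difference[where X = "insert 0 (insert T F) \<inter> {0..T}"])
      fix s assume s: "s \<in> space (lebesgue_on {0..T})" "s \<notin> insert 0 (insert T F) \<inter> {0..T}"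
      then have "0 < s" "s < T" "s \<notin> F"
        by auto
      from D(1)[OF this] show "ennreal \<bar>ln (h s)\<bar> = ?f s"
        by (rule sym)
    qed (use h(1) in \<open>auto simp: sets_restrict_space_iff intro: countable_finite\<close>)
    moreover have "AE s in lebesgue_on {0..T}. ?f s \<le> ennreal (ln q)"
    proof (subst AE_restrict_space_iff)
      show "AE s in lebesgue. s \<in> {0..T} \<longrightarrow> ?f s \<le> ennreal (ln q)"
        using ae
      proof (rule eventually_mono, intro impI)
        fix s assume s: "s \<notin> insert 0 (insert T F)" "s \<in> {0..T}"
        then have "0 < s" "s < T" "s \<notin> F"
          by auto
        from D[OF this] show "?f s \<le> ennreal (ln q)"
          by (rule ord_eq_le_trans)
      qed
    qed simp
    ultimately show ?thesis
      unfolding log_slope_norm_def by (rule esssup_I)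
  qed
  ultimately show ?thesis
    using that by (auto simp: l'_def)
qed

section \<open>The clock of a path\<close>

text \<open>The approximants sample \<open>f\<close> at grid points strictly to the right of
  \<open>s\<close>, so right continuity makes them converge, and each of them factors through an
  integer-valued map.\<close>

lemma right_continuous_borel_measurable:
  fixes f :: "real \<Rightarrow> real"
  assumes f: "\<And>s. (f \<longlongrightarrow> f s) (at_right s)"
  shows "f \<in> borel_measurable borel"
proof (rule borel_measurable_LIMSEQ_real)
  let ?t = "\<lambda>n s. (real_of_int \<lfloor>real (Suc n) * s\<rfloor> + 1) / real (Suc n)"
  show "(\<lambda>n. f (?t n s)) \<longlonglongrightarrow> f s" for s
  proof (rule filterlim_compose[OF f])
    have bounds: "s < ?t n s" "?t n s \<le> s + 1 / real (Suc n)" for n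
    proof -
      define i where "i = real_of_int \<lfloor>real (Suc n) * s\<rfloor>"
      have "real (Suc n) * s < i + 1" "i \<le> real (Suc n) * s"
        unfolding i_def by linarith+
      then have "s < (i + 1) / real (Suc n)" "(i + 1) / real (Suc n) \<le> s + 1 / real (Suc n)"
        by (simp_all add: field_simps del: of_nat_Suc)
      then show "s < ?t n s" "?t n s \<le> s + 1 / real (Suc n)"
        by (simp_all add: i_def)
    qed
    have "(\<lambda>n. ?t n s) \<longlonglongrightarrow> s"
    proof (rule tendsto_sandwich[where f = "\<lambda>_. s" and h = "\<lambda>n. s + 1 / real (Suc n)"])
      have "(\<lambda>n. s + 1 / real (Suc n)) \<longlonglongrightarrow> s + 0"
        by (intro tendsto_add tendsto_const LIMSEQ_Suc lim_1_over_n)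
      then show "(\<lambda>n. s + 1 / real (Suc n)) \<longlonglongrightarrow> s"
        by simp
    qed (use bounds in \<open>auto intro!: always_eventually less_imp_le simp del: of_nat_Suc\<close>)
    then show "filterlim (\<lambda>n. ?t n s) (at_right s) sequentially"
      using bounds(1) by (intro tendsto_imp_filterlim_at_right) (auto simp del: of_nat_Suc)
  qed
  show "(\<lambda>s. f (?t n s)) \<in> borel_measurable borel" for n
  proof -
    have 1: "(\<lambda>s::real. \<lfloor>real (Suc n) * s\<rfloor>) \<in> measurable borel (count_space UNIV)"
      by (rule measurable_compose[OF _ measurable_real_floor]) simp
    have 2: "(\<lambda>i. f ((real_of_int i + 1) / real (Suc n))) \<in> measurable (count_space UNIV) borel"
      by simp
    show ?thesis
      using measurable_compose[OF 1 2] .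
  qed
qed

locale path_clock =
  fixes S :: "'a topology" and g :: "'a \<Rightarrow> real" and x :: "'a trajectory"
  assumes path: "x \<in> D_exp S" and speed: "continuous_map S (top_of_set {0<..}) g"
    and locally_compact: "locally_compact_space S"
begin

abbreviation g_at :: "real \<Rightarrow> real" where
  "g_at u \<equiv> g (the (x u))"

abbreviation real_clock :: "real \<Rightarrow> real" where
  "real_clock s \<equiv> enn2real (clock g x s)"

lemma speed_pos: "p \<in> topspace S \<Longrightarrow> 0 < g p"
  using speed by (auto simp: continuous_map_in_subtopology)

lemma path_at:
  "0 \<le> s \<Longrightarrow> if ereal s < explosion_time x then x s \<in> Some ` topspace S else x s = None"
  using path by (simp add: D_exp_def)

lemma alive:
  assumes "0 \<le> s" "ereal s < explosion_time x"
  shows "the (x s) \<in> topspace S" "x s = Some (the (x s))"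
  using path_at[OF assms(1)] assms(2) by auto

lemma dead: "0 \<le> s \<Longrightarrow> explosion_time x \<le> ereal s \<Longrightarrow> x s = None"
  using path_at[of s] by (auto split: if_splits)

lemma alive_iff: "0 \<le> s \<Longrightarrow> ereal s < explosion_time x \<longleftrightarrow> x s \<noteq> None"
  using path_at[of s] by (auto split: if_splits)

lemma explosion_time_nonneg: "0 \<le> explosion_time x"
  unfolding explosion_time_def by (rule Inf_greatest) auto

lemma right_limit: "0 \<le> s \<Longrightarrow> ereal s < explosion_time x \<Longrightarrow> limitin S (\<lambda>s. the (x s)) (the (x s)) (at_right s)"
  using path by (simp add: D_exp_def)

lemma left_limit:
  "0 < s \<Longrightarrow> ereal s < explosion_time x \<Longrightarrow> \<exists>l. limitin S (\<lambda>s. the (x s)) l (at_left s)"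
  using path by (simp add: D_exp_def)

lemma right_nbhd:
  assumes s: "0 \<le> s" "ereal s < explosion_time x" and U: "openin S U" "the (x s) \<in> U"
  obtains c where "s < c" "ereal c < explosion_time x" "\<And>r. s \<le> r \<Longrightarrow> r < c \<Longrightarrow> the (x r) \<in> U"
proof -
  have "\<forall>\<^sub>F r in at_right s. the (x r) \<in> U"
    using right_limit[OF s] U by (simp add: limitin_def)
  then obtain c where c: "s < c" "\<And>r. s < r \<Longrightarrow> r < c \<Longrightarrow> the (x r) \<in> U"
    by (rule eventually_at_right_realE) (rule that)
  obtain z where z: "ereal s < ereal z" "ereal z < explosion_time x"
    using ereal_dense2[OF s(2)] by blast
  show thesis
  proof (rule that[of "min c z"])
    show "s < min c z" "ereal (min c z) < explosion_time x"
      using c(1) z by (auto simp: min_def intro: le_less_trans[of _ "ereal z"])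
    show "the (x r) \<in> U" if "s \<le> r" "r < min c z" for r
      using c(2)[of r] U(2) that by (cases "r = s") auto
  qed
qed

lemma g_at_pos: "0 \<le> s \<Longrightarrow> ereal s < explosion_time x \<Longrightarrow> 0 < g_at s"
  using alive(1) speed_pos by blast

lemma g_at_right_continuous:
  assumes "0 \<le> s" "ereal s < explosion_time x"
  shows "(g_at \<longlongrightarrow> g_at s) (at_right s)"
proof -
  have "limitin euclideanreal (g \<circ> (\<lambda>s. the (x s))) (g_at s) (at_right s)"
    using right_limit[OF assms] speed
    by (intro continuous_map_limit[of S]) (auto simp: continuous_map_in_subtopology)
  then show ?thesis
    by (simp add: o_def)
qed

lemma clock_integrand_measurable:
  assumes "ereal s \<le> explosion_time x"
  shows "(\<lambda>u. ennreal (1 / g_at u) * indicator {0..<s} u) \<in> borel_measurable lborel"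
proof -
  \<comment> \<open>Because the integration interval is half-open, the truncated rate is
    right-continuous everywhere, also at \<open>s\<close>, where it drops to 0.\<close>
  define w where "w u = (if 0 \<le> u \<and> u < s then 1 / g_at u else 0)" for u
  have "(w \<longlongrightarrow> w u) (at_right u)" for u
  proof -
    consider "u < 0" | "0 \<le> u" "u < s" | "s \<le> u" "0 \<le> u"
      by linarith
    then show ?thesis
    proof cases
      case 1
      then have "\<forall>\<^sub>F v in at_right u. w v = w u"
        unfolding eventually_at_right_field by (intro exI[of _ 0]) (auto simp: w_def)
      then show ?thesis
        by (simp add: tendsto_eventually)
    next
      case 2
      then have u: "ereal u < explosion_time x"
        using assms by (meson less_ereal.simps(1) order_less_le_trans)
      have "((\<lambda>v. 1 / g_at v) \<longlongrightarrow> 1 / g_at u) (at_right u)"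
        using g_at_pos[OF 2(1) u] by (intro tendsto_intros g_at_right_continuous 2 u) auto
      moreover have "\<forall>\<^sub>F v in at_right u. 1 / g_at v = w v"
        unfolding eventually_at_right_field using 2 by (intro exI[of _ s]) (auto simp: w_def)
      ultimately have "(w \<longlongrightarrow> 1 / g_at u) (at_right u)"
        by (rule Lim_transform_eventually)
      then show ?thesis
        using 2 by (simp add: w_def)
    next
      case 3
      then have "\<forall>\<^sub>F v in at_right u. w v = w u"
        unfolding eventually_at_right_field by (intro exI[of _ "u + 1"]) (auto simp: w_def)
      then show ?thesis
        by (simp add: tendsto_eventually)
    qed
  qed
  then have "w \<in> borel_measurable borel"
    by (rule right_continuous_borel_measurable)
  then have "(\<lambda>u. ennreal (w u)) \<in> borel_measurable lborel"
    by simp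
  moreover have "(\<lambda>u. ennreal (1 / g_at u) * indicator {0..<s} u) = (\<lambda>u. ennreal (w u))"
    by (auto simp: w_def indicator_def)
  ultimately show ?thesis
    by simp
qed

section \<open>Bounds and strict growth of the clock\<close>

lemma clock_0 [simp]: "clock g x 0 = 0"
  using explosion_time_nonneg by (simp add: clock_def zero_ereal_def)

lemma clock_split:
  assumes "0 \<le> r" "r \<le> s" "ereal s \<le> explosion_time x"
  shows "clock g x s = clock g x r + (\<integral>\<^sup>+u\<in>{r..<s}. ennreal (1 / g_at u) \<partial>lborel)"
proof -
  let ?f = "\<lambda>u. ennreal (1 / g_at u)"
  have r: "ereal r \<le> explosion_time x"
    using assms by (meson ereal_less_eq(3) order_trans)
  have "(\<lambda>u. (?f u * indicator {0..<s} u) * indicator {r..<s} u) \<in> borel_measurable lborel"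
    using clock_integrand_measurable[OF assms(3)] by measurable
  moreover have "(\<lambda>u. (?f u * indicator {0..<s} u) * indicator {r..<s} u) = (\<lambda>u. ?f u * indicator {r..<s} u)"
    using assms by (auto simp: indicator_def)
  ultimately have m: "(\<lambda>u. ?f u * indicator {r..<s} u) \<in> borel_measurable lborel"
    by simp
  have "(\<integral>\<^sup>+u\<in>{0..<s}. ?f u \<partial>lborel)
      = (\<integral>\<^sup>+u. ?f u * indicator {0..<r} u + ?f u * indicator {r..<s} u \<partial>lborel)"
    using assms by (intro nn_integral_cong) (auto simp: indicator_def)
  also have "\<dots> = (\<integral>\<^sup>+u\<in>{0..<r}. ?f u \<partial>lborel) + (\<integral>\<^sup>+u\<in>{r..<s}. ?f u \<partial>lborel)"
    by (rule nn_integral_add[OF clock_integrand_measurable[OF r] m])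
  finally show ?thesis
    using assms(3) r by (simp add: clock_def)
qed

text \<open>The additive form remains meaningful when the clock is infinite, where differences in
  \<open>ennreal\<close> carry no information.\<close>

lemma clock_lower:
  assumes "0 \<le> r" "r \<le> s" "ereal s \<le> explosion_time x" "0 < M"
    and M: "\<And>u. r \<le> u \<Longrightarrow> u < s \<Longrightarrow> g_at u \<le> M"
  shows "clock g x r + ennreal ((s - r) / M) \<le> clock g x s"
proof -
  have "ennreal ((s - r) / M) = ennreal (1 / M) * ennreal (s - r)"
    using assms by (simp flip: ennreal_mult)
  also have "\<dots> = (\<integral>\<^sup>+u. ennreal (1 / M) * indicator {r..<s} u \<partial>lborel)"
    using assms by (simp add: nn_integral_cmult_indicator)
  also have "\<dots> \<le> (\<integral>\<^sup>+u\<in>{r..<s}. ennreal (1 / g_at u) \<partial>lborel)"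
  proof (rule nn_integral_mono)
    fix u
    show "ennreal (1 / M) * indicator {r..<s} u \<le> ennreal (1 / g_at u) * indicator {r..<s} u"
    proof (cases "u \<in> {r..<s}")
      case True
      then have "ereal u < explosion_time x"
        using assms(3) by (meson atLeastLessThan_iff less_ereal.simps(1) order_less_le_trans)
      then have "0 < g_at u"
        using g_at_pos True assms(1) by simp
      then show ?thesis
        using M[of u] True by (auto intro!: ennreal_leI frac_le)
    qed simp
  qed
  finally show ?thesis
    using clock_split[OF assms(1-3)] by (simp add: add_left_mono)
qed

lemma clock_upper:
  assumes "0 \<le> r" "r \<le> s" "ereal s \<le> explosion_time x" "0 < m"
    and m: "\<And>u. r \<le> u \<Longrightarrow> u < s \<Longrightarrow> m \<le> g_at u"
  shows "clock g x s \<le> clock g x r + ennreal ((s - r) / m)"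
proof -
  have "(\<integral>\<^sup>+u\<in>{r..<s}. ennreal (1 / g_at u) \<partial>lborel) \<le> (\<integral>\<^sup>+u. ennreal (1 / m) * indicator {r..<s} u \<partial>lborel)"
  proof (rule nn_integral_mono)
    fix u
    show "ennreal (1 / g_at u) * indicator {r..<s} u \<le> ennreal (1 / m) * indicator {r..<s} u"
      using m[of u] \<open>0 < m\<close> by (cases "u \<in> {r..<s}") (auto intro!: ennreal_leI frac_le)
  qed
  also have "\<dots> = ennreal (1 / m) * ennreal (s - r)"
    using assms by (simp add: nn_integral_cmult_indicator)
  also have "\<dots> = ennreal ((s - r) / m)"
    using assms by (simp flip: ennreal_mult)
  finally show ?thesis
    using clock_split[OF assms(1-3)] by (simp add: add_left_mono)
qed

lemma clock_mono:
  assumes "0 \<le> r" "r \<le> s" "ereal s \<le> explosion_time x"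
  shows "clock g x r \<le> clock g x s"
  using clock_split[OF assms] by simp

text \<open>Right continuity bounds the speed from above just after \<open>r\<close>, so the clock
  gains a positive amount there. Finiteness at \<open>r\<close> excludes a step from infinity to
  infinity.\<close>

lemma clock_strict_mono:
  assumes rs: "0 \<le> r" "r < s" "ereal s \<le> explosion_time x" and fin: "clock g x r < \<infinity>"
  shows "clock g x r < clock g x s"
proof -
  have r: "ereal r < explosion_time x"
    using rs by (meson less_ereal.simps(1) order_less_le_trans)
  have "\<forall>\<^sub>F u in at_right r. g_at u < g_at r + 1"
    using g_at_right_continuous[OF rs(1) r] by (rule order_tendstoD) simp
  then obtain c where c: "r < c" "\<And>u. r < u \<Longrightarrow> u < c \<Longrightarrow> g_at u < g_at r + 1"
    by (rule eventually_at_right_realE) (rule that)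
  define z where "z = min c s"
  have z: "r < z" "z \<le> s" "z \<le> c"
    using c(1) rs by (auto simp: z_def)
  have z': "ereal z \<le> explosion_time x"
    using z(2) rs(3) by (meson ereal_less_eq(3) order_trans)
  have M: "0 < g_at r + 1"
    using g_at_pos[OF rs(1) r] by simp
  have "clock g x r < clock g x r + ennreal ((z - r) / (g_at r + 1))"
    using fin z(1) M ennreal_add_left_cancel_less[of "clock g x r" 0 "ennreal ((z - r) / (g_at r + 1))"]
    by (auto simp: less_top)
  also have "\<dots> \<le> clock g x z"
  proof (rule clock_lower[OF rs(1) _ z' M])
    show "g_at u \<le> g_at r + 1" if "r \<le> u" "u < z" for u
      using c(2)[of u] that z by (cases "u = r") auto
  qed (use z in auto)
  also have "\<dots> \<le> clock g x s"
    using rs z by (intro clock_mono) auto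
  finally show ?thesis .
qed

section \<open>The clock as a real function where the speed is bounded below\<close>

context
  fixes T m :: real
  assumes T: "ereal T \<le> explosion_time x" and m_pos: "0 < m"
    and m: "\<And>u. 0 \<le> u \<Longrightarrow> u < T \<Longrightarrow> m \<le> g_at u"
begin

lemma clock_finite: "0 \<le> s \<Longrightarrow> s \<le> T \<Longrightarrow> clock g x s < \<infinity>"
proof -
  assume s: "0 \<le> s" "s \<le> T"
  have "clock g x s \<le> clock g x 0 + ennreal ((s - 0) / m)"
    using T m m_pos s by (intro clock_upper) (auto intro: order_trans[OF _ T])
  then show ?thesis
    by (simp add: le_less_trans[OF _ ennreal_less_top])
qed

lemma clock_eq: "0 \<le> s \<Longrightarrow> s \<le> T \<Longrightarrow> clock g x s = ennreal (real_clock s)"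
  using clock_finite[of s] by (simp add: less_top)

lemma real_clock_upper:
  assumes "0 \<le> r" "r \<le> s" "s \<le> T" "0 < n" "\<And>u. r \<le> u \<Longrightarrow> u < s \<Longrightarrow> n \<le> g_at u"
  shows "real_clock s - real_clock r \<le> (s - r) / n"
proof -
  have s: "ereal s \<le> explosion_time x"
    using assms(3) T by (meson ereal_less_eq(3) order_trans)
  have "ennreal (real_clock s) \<le> ennreal (real_clock r) + ennreal ((s - r) / n)"
    using clock_upper[OF assms(1,2) s assms(4,5)] assms by (simp flip: clock_eq)
  also have "\<dots> = ennreal (real_clock r + (s - r) / n)"
    using assms by (simp add: ennreal_plus)
  finally have "real_clock s \<le> real_clock r + (s - r) / n"
    using assms by (subst (asm) ennreal_le_iff) auto
  then show ?thesis
    by simp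
qed

lemma real_clock_lower:
  assumes "0 \<le> r" "r \<le> s" "s \<le> T" "0 < M" "\<And>u. r \<le> u \<Longrightarrow> u < s \<Longrightarrow> g_at u \<le> M"
  shows "(s - r) / M \<le> real_clock s - real_clock r"
proof -
  have s: "ereal s \<le> explosion_time x"
    using assms(3) T by (meson ereal_less_eq(3) order_trans)
  have "ennreal (real_clock r + (s - r) / M) = ennreal (real_clock r) + ennreal ((s - r) / M)"
    using assms by (simp add: ennreal_plus)
  also have "\<dots> \<le> ennreal (real_clock s)"
    using clock_lower[OF assms(1,2) s assms(4,5)] assms by (simp flip: clock_eq)
  finally have "real_clock r + (s - r) / M \<le> real_clock s"
    by (subst (asm) ennreal_le_iff) auto
  then show ?thesis
    by simp
qed

lemma real_clock_strict_mono: "strict_mono_on {0..T} real_clock"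
proof (rule strict_mono_onI)
  fix r s assume rs: "r \<in> {0..T}" "s \<in> {0..T}" "r < s"
  then have "clock g x r < clock g x s"
    using T by (intro clock_strict_mono clock_finite) (auto intro: order_trans[OF _ T])
  then have "ennreal (real_clock r) < ennreal (real_clock s)"
    using rs by (simp flip: clock_eq)
  then show "real_clock r < real_clock s"
    by (simp add: ennreal_less_iff)
qed

lemma real_clock_continuous: "continuous_on {0..T} real_clock"
proof (rule lipschitz_on_continuous_on, rule lipschitz_onI)
  have *: "dist (real_clock s) (real_clock r) \<le> 1 / m * dist s r" if "0 \<le> r" "r \<le> s" "s \<le> T" for r s
  proof -
    have "real_clock s - real_clock r \<le> (s - r) / m"
      using that m m_pos by (intro real_clock_upper) auto
    moreover have "real_clock r \<le> real_clock s"
      using that by (intro strict_mono_on_leD[OF real_clock_strict_mono]) auto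
    ultimately show ?thesis
      using that by (simp add: dist_real_def)
  qed
  show "dist (real_clock s) (real_clock r) \<le> 1 / m * dist s r" if "s \<in> {0..T}" "r \<in> {0..T}" for r s
    using that *[of s r] *[of r s] by (cases "s \<le> r") (simp_all add: dist_commute)
qed (use m_pos in simp)

lemma real_clock_surj:
  assumes "0 \<le> T" "0 \<le> t" "t \<le> real_clock T"
  obtains s where "0 \<le> s" "s \<le> T" "real_clock s = t"
  using IVT'[of real_clock 0 t T, OF _ assms(3,1) real_clock_continuous] assms(2) that by auto

end

text \<open>Strict growth means that the clock reaches \<open>t\<close> at \<open>s\<close> and not
  before, so the infimum is attained. The time \<open>s\<close> may be the explosion time, and the
  value is then the cemetery.\<close>

lemma time_change_at_clock:
  assumes s: "0 \<le> s" "ereal s \<le> explosion_time x" and t: "clock g x s = ennreal t"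
  shows "time_change g x t = x s"
proof -
  have "inverse_clock g x t = ereal s"
    unfolding inverse_clock_def
  proof (rule antisym)
    show "Inf {ereal s |s. 0 \<le> s \<and> ennreal t \<le> clock g x s} \<le> ereal s"
      using s t by (intro Inf_lower) auto
    show "ereal s \<le> Inf {ereal s |s. 0 \<le> s \<and> ennreal t \<le> clock g x s}"
    proof (rule Inf_greatest)
      fix z assume "z \<in> {ereal s |s. 0 \<le> s \<and> ennreal t \<le> clock g x s}"
      then obtain r where r: "z = ereal r" "0 \<le> r" "ennreal t \<le> clock g x r"
        by auto
      have "\<not> r < s"
      proof
        assume "r < s"
        have "clock g x r \<le> ennreal t"
          using clock_mono[of r s] r s t \<open>r < s\<close> by simp
        then have "clock g x r < \<infinity>"
          by (simp add: le_less_trans[OF _ ennreal_less_top])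
        then show False
          using clock_strict_mono[of r s] r s t \<open>r < s\<close> by simp
      qed
      then show "ereal s \<le> z"
        using r(1) by simp
    qed
  qed
  then show ?thesis
    by (simp add: time_change_def)
qed

lemma time_change_beyond:
  assumes "\<And>s. 0 \<le> s \<Longrightarrow> ereal s < explosion_time x \<Longrightarrow> clock g x s < ennreal t"
  shows "time_change g x t = None"
proof (cases "inverse_clock g x t = \<infinity>")
  case False
  have le: "explosion_time x \<le> inverse_clock g x t"
    unfolding inverse_clock_def
    by (rule Inf_greatest) (use assms in \<open>force simp: not_less[symmetric]\<close>)
  then have "0 \<le> inverse_clock g x t"
    using explosion_time_nonneg by (rule order_trans[rotated])
  then obtain r where r: "inverse_clock g x t = ereal r" "0 \<le> r"
    using False by (cases "inverse_clock g x t") auto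
  then show ?thesis
    using dead[of r] le by (simp add: time_change_def)
qed (simp add: time_change_def)

text \<open>
  The time \<open>u\<close> may be the explosion time of the time-changed path; the bounds then make the
  explosion time of \<open>x\<close> finite and the clock continuous up to it.
\<close>

lemma exists_clock_eq:
  assumes u: "0 \<le> u" and m: "0 < m"
    and y: "\<And>v. 0 \<le> v \<Longrightarrow> v < u \<Longrightarrow>
      time_change g x v \<noteq> None \<and> m \<le> g (the (time_change g x v)) \<and> g (the (time_change g x v)) \<le> M"
  obtains s where "0 \<le> s" "ereal s \<le> explosion_time x" "clock g x s = ennreal u"
    "\<And>r. 0 \<le> r \<Longrightarrow> r < s \<Longrightarrow> m \<le> g_at r \<and> g_at r \<le> M"
proof -
  \<comment> \<open>These are the times at which the clock has not passed \<open>u\<close>; their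
    supremum \<open>z\<close> is the time sought.\<close>
  define A where "A = {s. 0 \<le> s \<and> ereal s \<le> explosion_time x \<and> clock g x s \<le> ennreal u}"
  have "0 \<in> A"
    using explosion_time_nonneg by (simp add: A_def zero_ereal_def)
  have bounds: "m \<le> g_at r \<and> g_at r \<le> M" if s: "s \<in> A" and r: "0 \<le> r" "r < s" for r s
  proof -
    have rx: "ereal r \<le> explosion_time x"
      using s r(2) by (auto simp: A_def intro: order_trans[of _ "ereal s"])
    have "clock g x r \<le> clock g x s"
      using s r by (intro clock_mono) (auto simp: A_def)
    then have fin: "clock g x r < \<infinity>"
      using s by (auto simp: A_def intro: le_less_trans[OF _ ennreal_less_top] elim: order_trans)
    then have eq: "clock g x r = ennreal (real_clock r)"
      by (simp add: less_top)
    have "clock g x r < clock g x s"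
      using s r fin by (intro clock_strict_mono) (auto simp: A_def)
    also have "\<dots> \<le> ennreal u"
      using s by (simp add: A_def)
    finally have "clock g x r < ennreal u" .
    then have "real_clock r < u"
      by (subst (asm) eq) (simp add: ennreal_less_iff)
    then show ?thesis
      using y[of "real_clock r"] time_change_at_clock[OF r(1) rx eq] by simp
  qed
  \<comment> \<open>A speed of at most \<open>M\<close> bounds \<open>s\<close> by
    \<open>M * u\<close>. The maximum with 0 covers \<open>A = {0}\<close>, where the sign of
    \<open>M\<close> is unknown.\<close>
  have A_le: "s \<le> max 0 (M * u)" if "s \<in> A" for s
  proof (cases "s = 0")
    case False
    then have s: "0 < s" "ereal s \<le> explosion_time x" "clock g x s \<le> ennreal u"
      using that by (auto simp: A_def)
    then have "0 < M"
      using bounds[OF that, of 0] m by auto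
    have "clock g x 0 + ennreal ((s - 0) / M) \<le> clock g x s"
      using bounds[OF that] s \<open>0 < M\<close> by (intro clock_lower) auto
    also have "\<dots> \<le> ennreal u"
      by fact
    finally have "s / M \<le> u"
      using u by (simp add: ennreal_le_iff)
    then show ?thesis
      using \<open>0 < M\<close> by (simp add: field_simps max_def)
  qed simp
  define z where "z = Sup A"
  have bdd: "bdd_above A"
    using A_le by (rule bdd_aboveI)
  have z0: "0 \<le> z"
    unfolding z_def using \<open>0 \<in> A\<close> bdd by (rule cSup_upper)
  have zx: "ereal z \<le> explosion_time x"
  proof (rule ccontr)
    assume "\<not> ereal z \<le> explosion_time x"
    then obtain w where w: "explosion_time x = ereal w" "w < z"
      using explosion_time_nonneg by (cases "explosion_time x") auto
    then obtain s where "s \<in> A" "w < s"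
      unfolding z_def using less_cSupD[of A w] \<open>0 \<in> A\<close> by auto
    then show False
      using w by (simp add: A_def)
  qed
  have below: "\<exists>s\<in>A. r < s" if "r < z" for r
    using less_cSupD[of A r] \<open>0 \<in> A\<close> that unfolding z_def by auto
  have zbounds: "m \<le> g_at r \<and> g_at r \<le> M" if "0 \<le> r" "r < z" for r
    using below[OF that(2)] bounds that(1) by blast
  have zeq: "clock g x z = ennreal (real_clock z)"
    by (rule clock_eq[OF zx m]) (use zbounds z0 in auto)
  have "real_clock z \<le> u"
  proof (rule field_le_epsilon)
    fix e :: real assume "0 < e"
    then have "z - m * e < z"
      using m by simp
    then obtain s where s: "s \<in> A" "z - m * e < s"
      using below by blast
    then have "s \<le> z"
      unfolding z_def using bdd by (intro cSup_upper)
    have "real_clock z - real_clock s \<le> (z - s) / m"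
      by (rule real_clock_upper[OF zx m]) (use zbounds s \<open>s \<le> z\<close> m in \<open>auto simp: A_def\<close>)
    also have "\<dots> \<le> e"
      using s(2) m by (simp add: field_simps)
    finally have "real_clock z \<le> real_clock s + e"
      by simp
    moreover have "real_clock s \<le> u"
      using s(1) u by (simp add: A_def enn2real_leI)
    ultimately show "real_clock z \<le> u + e"
      by simp
  qed
  \<comment> \<open>With the clock at \<open>z\<close> below \<open>u\<close>, the time-changed path
    is alive at that clock value, so \<open>x\<close> is alive at \<open>z\<close> and can run on a
    little without its clock passing \<open>u\<close>. This contradicts the choice of
    \<open>z\<close>.\<close>
  moreover have "\<not> real_clock z < u"
  proof
    assume less: "real_clock z < u"
    have "time_change g x (real_clock z) = x z"
      by (rule time_change_at_clock[OF z0 zx zeq])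
    then have "x z \<noteq> None"
      using y[of "real_clock z"] less by simp
    then have zx': "ereal z < explosion_time x"
      using alive_iff[OF z0] by simp
    then have gz: "0 < g_at z"
      using g_at_pos z0 by simp
    then have "\<forall>\<^sub>F r in at_right z. g_at z / 2 < g_at r"
      by (intro order_tendstoD(1)[OF g_at_right_continuous[OF z0 zx']]) simp
    then obtain c where c: "z < c" "\<And>r. z < r \<Longrightarrow> r < c \<Longrightarrow> g_at z / 2 < g_at r"
      by (rule eventually_at_right_realE) (rule that)
    obtain b where b: "ereal z < ereal b" "ereal b < explosion_time x"
      using ereal_dense2[OF zx'] by blast
    \<comment> \<open>While the speed exceeds half its value at \<open>z\<close>, running for this
      long adds at most \<open>u - real_clock z\<close> to the clock.\<close>
    define s where "s = min (min b c) (z + (u - real_clock z) * (g_at z / 2))"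
    have s: "z < s" "s \<le> b" "s \<le> c" "s \<le> z + (u - real_clock z) * (g_at z / 2)"
      using c(1) b(1) less gz by (auto simp: s_def)
    have sx: "ereal s \<le> explosion_time x"
      using s(2) b(2) by (meson ereal_less_eq(3) less_imp_le order_trans)
    have "clock g x s \<le> clock g x z + ennreal ((s - z) / (g_at z / 2))"
    proof (rule clock_upper[OF z0 _ sx])
      show "g_at z / 2 \<le> g_at r" if "z \<le> r" "r < s" for r
        using c(2)[of r] s(3) gz that by (cases "r = z") (auto intro: less_imp_le)
    qed (use s gz in auto)
    also have "\<dots> = ennreal (real_clock z + (s - z) / (g_at z / 2))"
      by (subst zeq) (use s gz in \<open>simp add: ennreal_plus\<close>)
    also have "\<dots> \<le> ennreal u"
      using s(4) gz by (intro ennreal_leI) (simp add: field_simps)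
    finally have "s \<in> A"
      using s(1) z0 sx by (simp add: A_def)
    then have "s \<le> z"
      unfolding z_def using bdd by (rule cSup_upper)
    then show False
      using s(1) by simp
  qed
  ultimately have "clock g x z = ennreal u"
    by (subst zeq) simp
  then show thesis
    using that[OF z0 zx] zbounds by blast
qed

end

section \<open>Time-changed paths\<close>

context path_clock
begin

text \<open>Bisection for cadlag paths: near each \<open>t\<close> the left limit confines the path
  just before \<open>t\<close>, right continuity just after it, and \<open>trans\<close> joins the
  two sides. Confinement is to half-open intervals, so jumps at division points do no harm. Left
  limits are a hypothesis because \<open>T\<close> may be the explosion time.\<close>

lemma cadlag_interval_induct [consumes 2, case_names left cover small refl trans]:
  fixes P :: "real \<Rightarrow> real \<Rightarrow> bool"
  assumes T: "0 \<le> T" "ereal T \<le> explosion_time x"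
    and left: "\<And>t. 0 < t \<Longrightarrow> t \<le> T \<Longrightarrow> \<exists>l. limitin S (\<lambda>s. the (x s)) l (at_left t)"
    and cover: "\<And>p. p \<in> topspace S \<Longrightarrow> \<exists>U. openin S U \<and> p \<in> U \<and> Q U"
    and small: "\<And>a b U. 0 \<le> a \<Longrightarrow> a < b \<Longrightarrow> b \<le> T \<Longrightarrow> Q U \<Longrightarrow>
      (\<And>u. a \<le> u \<Longrightarrow> u < b \<Longrightarrow> the (x u) \<in> U) \<Longrightarrow> P a b"
    and refl: "\<And>a. 0 \<le> a \<Longrightarrow> a \<le> T \<Longrightarrow> P a a"
    and trans: "\<And>a b c. 0 \<le> a \<Longrightarrow> a \<le> b \<Longrightarrow> b \<le> c \<Longrightarrow> c \<le> T \<Longrightarrow> P a b \<Longrightarrow> P b c \<Longrightarrow> P a c"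
  shows "P 0 T"
proof -
  have "0 \<le> (0::real) \<and> T \<le> T \<longrightarrow> P 0 T"
  proof (rule Bolzano[where P = "\<lambda>a b. 0 \<le> a \<and> b \<le> T \<longrightarrow> P a b"])
    show "0 \<le> T" by fact
    show "0 \<le> a \<and> c \<le> T \<longrightarrow> P a c"
      if "0 \<le> a \<and> b \<le> T \<longrightarrow> P a b" "0 \<le> b \<and> c \<le> T \<longrightarrow> P b c" "a \<le> b" "b \<le> c" for a b c
      using that trans[of a b c] by auto
    fix t assume t: "0 \<le> t" "t \<le> T"
    have l: "\<exists>e>0. \<forall>a. 0 \<le> a \<and> a \<le> t \<and> t - a < e \<longrightarrow> P a t"
    proof (cases "t = 0")
      case True
      then show ?thesis
        using refl[of 0] T by (intro exI[of _ 1]) auto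
    next
      case False
      then obtain l where l: "limitin S (\<lambda>s. the (x s)) l (at_left t)"
        using left[of t] t by auto
      then have "l \<in> topspace S"
        by (simp add: limitin_def)
      then obtain U where U: "openin S U" "l \<in> U" "Q U"
        using cover by blast
      have "\<forall>\<^sub>F u in at_left t. the (x u) \<in> U"
        using l U by (simp add: limitin_def)
      then obtain c where c: "c < t" "\<And>u. c < u \<Longrightarrow> u < t \<Longrightarrow> the (x u) \<in> U"
        by (rule eventually_at_left_realE) (rule that)
      have "P a t" if a: "0 \<le> a" "a \<le> t" "t - a < t - c" for a
      proof (cases "a = t")
        case True
        then show ?thesis
          using refl a t by simp
      next
        case False
        show ?thesis
          by (rule small[OF a(1) _ t(2) U(3)]) (use False a c(2) in auto)
      qed
      then show ?thesis
        using c(1) by (intro exI[of _ "t - c"]) auto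
    qed
    have r: "\<exists>e>0. \<forall>b. t \<le> b \<and> b \<le> T \<and> b - t < e \<longrightarrow> P t b"
    proof (cases "t = T")
      case True
      then show ?thesis
        using refl[of T] T by (intro exI[of _ 1]) auto
    next
      case False
      then have tx: "ereal t < explosion_time x"
        using t T(2) by (meson less_ereal.simps(1) less_le order_less_le_trans)
      obtain U where U: "openin S U" "the (x t) \<in> U" "Q U"
        using cover[OF alive(1)[OF t(1) tx]] by blast
      obtain c where c: "t < c" "ereal c < explosion_time x" "\<And>u. t \<le> u \<Longrightarrow> u < c \<Longrightarrow> the (x u) \<in> U"
        by (rule right_nbhd[OF t(1) tx U(1,2)]) (rule that)
      have "P t b" if b: "t \<le> b" "b \<le> T" "b - t < c - t" for b
      proof (cases "t = b")
        case True
        then show ?thesis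
          using refl b t by simp
      next
        case False
        show ?thesis
          by (rule small[OF t(1) _ b(2) U(3)]) (use False b c(3) in auto)
      qed
      then show ?thesis
        using c(1) by (intro exI[of _ "c - t"]) auto
    qed
    from l obtain e1 where e1: "e1 > 0" "\<And>a. 0 \<le> a \<Longrightarrow> a \<le> t \<Longrightarrow> t - a < e1 \<Longrightarrow> P a t"
      by blast
    from r obtain e2 where e2: "e2 > 0" "\<And>b. t \<le> b \<Longrightarrow> b \<le> T \<Longrightarrow> b - t < e2 \<Longrightarrow> P t b"
      by blast
    show "\<exists>d>0. \<forall>a b. a \<le> t \<and> t \<le> b \<and> b - a < d \<longrightarrow> 0 \<le> a \<and> b \<le> T \<longrightarrow> P a b"
    proof (intro exI[of _ "min e1 e2"] conjI allI impI)
      show "0 < min e1 e2"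
        using e1 e2 by simp
      fix a b assume "a \<le> t \<and> t \<le> b \<and> b - a < min e1 e2" "0 \<le> a \<and> b \<le> T"
      then show "P a b"
        using trans[of a t b] e1(2)[of a] e2(2)[of b] by auto
    qed
  qed
  then show ?thesis
    by simp
qed

text \<open>Values and left limits have compact neighbourhoods, and finitely many of these contain
  the path before \<open>t\<close>; the point at \<open>t\<close> itself is added at the
  end.\<close>

lemma compact_range:
  assumes t: "0 \<le> t" "ereal t < explosion_time x"
  obtains K where "compactin S K" "\<And>s. 0 \<le> s \<Longrightarrow> s \<le> t \<Longrightarrow> the (x s) \<in> K"
proof -
  have "\<exists>K. compactin S K \<and> (\<forall>s. 0 \<le> s \<longrightarrow> s < t \<longrightarrow> the (x s) \<in> K)"
    using t(1) less_imp_le[OF t(2)]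
  proof (induction rule: cadlag_interval_induct[where Q = "\<lambda>U. \<exists>K. compactin S K \<and> U \<subseteq> K"])
    case (left s)
    then show ?case
      using t(2) by (intro left_limit) (auto intro: le_less_trans[of "ereal s" "ereal t"])
  next
    case (cover p)
    then show ?case
      using locally_compact unfolding locally_compact_space_def by blast
  next
    case (small a b U)
    then show ?case
      by (meson subsetD)
  next
    case (trans a b c)
    then obtain K K' where "compactin S K" "compactin S K'"
      "\<And>s. a \<le> s \<Longrightarrow> s < b \<Longrightarrow> the (x s) \<in> K" "\<And>s. b \<le> s \<Longrightarrow> s < c \<Longrightarrow> the (x s) \<in> K'"
      by blast
    then show ?case
      by (intro exI[of _ "K \<union> K'"]) (auto simp: compactin_Un not_less[symmetric])
  qed (auto intro!: exI[of _ "{}"])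
  then obtain K where K: "compactin S K" "\<And>s. 0 \<le> s \<Longrightarrow> s < t \<Longrightarrow> the (x s) \<in> K"
    by blast
  have "compactin S (K \<union> {the (x t)})"
    using K(1) alive(1)[OF t] by (intro compactin_Un) auto
  then show thesis
    using K(2) by (intro that[of "K \<union> {the (x t)}"]) (auto simp: less_le)
qed

section \<open>Speed bounds on compact sets and values of the time-changed path\<close>

lemma compact_speed_bounds:
  assumes "compactin S K"
  obtains m M where "0 < m" "\<And>p. p \<in> K \<Longrightarrow> m \<le> g p \<and> g p \<le> M"
proof (cases "K = {}")
  case True
  then show thesis
    using that[of 1 1] by simp
next
  case False
  have "compactin (top_of_set {0<..}) (g ` K)"
    using assms speed by (rule image_compactin)
  then have c: "compact (g ` K)" and pos: "g ` K \<subseteq> {0<..}"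
    by (auto simp: compactin_subtopology)
  obtain p where p: "p \<in> K" "\<And>r. r \<in> K \<Longrightarrow> g p \<le> g r"
    using compact_attains_inf[OF c] False by auto
  obtain p' where p': "p' \<in> K" "\<And>r. r \<in> K \<Longrightarrow> g r \<le> g p'"
    using compact_attains_sup[OF c] False by auto
  show thesis
    by (rule that[of "g p" "g p'"]) (use p p' pos in auto)
qed

lemma range_speed_bounds:
  assumes "0 \<le> t" "ereal t < explosion_time x"
  obtains m M where "0 < m" "\<And>s. 0 \<le> s \<Longrightarrow> s \<le> t \<Longrightarrow> m \<le> g_at s \<and> g_at s \<le> M"
proof -
  obtain K where K: "compactin S K" "\<And>s. 0 \<le> s \<Longrightarrow> s \<le> t \<Longrightarrow> the (x s) \<in> K"
    by (rule compact_range[OF assms]) (rule that)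
  obtain m M where "0 < m" "\<And>p. p \<in> K \<Longrightarrow> m \<le> g p \<and> g p \<le> M"
    by (rule compact_speed_bounds[OF K(1)]) (rule that)
  then show thesis
    by (rule that[of m M]) (use K(2) in auto)
qed

lemma clock_eq_alive:
  assumes "0 \<le> s" "ereal s < explosion_time x"
  shows "clock g x s = ennreal (real_clock s)"
proof -
  obtain m M where m: "0 < m" "\<And>u. 0 \<le> u \<Longrightarrow> u \<le> s \<Longrightarrow> m \<le> g_at u \<and> g_at u \<le> M"
    by (rule range_speed_bounds[OF assms]) (rule that)
  show ?thesis
    by (rule clock_eq[where T = s, OF less_imp_le[OF assms(2)] m(1)]) (use m(2) assms(1) in auto)
qed

lemma clock_finite_alive: "0 \<le> s \<Longrightarrow> ereal s < explosion_time x \<Longrightarrow> clock g x s < top"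
  by (subst clock_eq_alive) simp_all

lemma clock_surj:
  assumes s: "0 \<le> s" "ereal s < explosion_time x" and t: "0 \<le> t" "ennreal t \<le> clock g x s"
  obtains r where "0 \<le> r" "r \<le> s" "clock g x r = ennreal t" "time_change g x t = x r"
proof -
  obtain m M where m: "0 < m" "\<And>u. 0 \<le> u \<Longrightarrow> u \<le> s \<Longrightarrow> m \<le> g_at u \<and> g_at u \<le> M"
    by (rule range_speed_bounds[OF s]) (rule that)
  have "t \<le> real_clock s"
    using t(2) by (subst (asm) clock_eq_alive[OF s]) (simp add: ennreal_le_iff)
  then obtain r where r: "0 \<le> r" "r \<le> s" "real_clock r = t"
    using real_clock_surj[where T = s, OF less_imp_le[OF s(2)] m(1) _ s(1) t(1)] m(2) by (auto simp: less_imp_le)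
  have rx: "ereal r < explosion_time x"
    using r(2) s(2) by (meson ereal_less_eq(3) le_less_trans)
  have "clock g x r = ennreal t"
    using clock_eq_alive[OF r(1) rx] r(3) by simp
  then show thesis
    using that r time_change_at_clock[OF r(1) less_imp_le[OF rx]] by blast
qed

lemma time_change_cases:
  assumes "0 \<le> t"
  obtains (alive) s where "0 \<le> s" "ereal s < explosion_time x" "clock g x s = ennreal t" "time_change g x t = x s"
  | (dead) "time_change g x t = None" "\<And>s. 0 \<le> s \<Longrightarrow> ereal s < explosion_time x \<Longrightarrow> clock g x s < ennreal t"
proof (cases "\<exists>s\<ge>0. ereal s < explosion_time x \<and> ennreal t \<le> clock g x s")
  case True
  then obtain s where s: "0 \<le> s" "ereal s < explosion_time x" "ennreal t \<le> clock g x s"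
    by blast
  obtain r where r: "0 \<le> r" "r \<le> s" "clock g x r = ennreal t" "time_change g x t = x r"
    by (rule clock_surj[OF s(1,2) assms s(3)]) (rule that)
  moreover have "ereal r < explosion_time x"
    using r(2) s(2) by (meson ereal_less_eq(3) le_less_trans)
  ultimately show thesis
    by (intro alive[of r])
next
  case False
  have "clock g x s < ennreal t" if "0 \<le> s" "ereal s < explosion_time x" for s
  proof (rule ccontr)
    assume "\<not> clock g x s < ennreal t"
    then have "ennreal t \<le> clock g x s"
      by (simp only: not_less)
    then show False
      using False that by blast
  qed
  then show thesis
    by (intro dead time_change_beyond)
qed

lemma time_change_beyond_mono:
  assumes "\<And>s. 0 \<le> s \<Longrightarrow> ereal s < explosion_time x \<Longrightarrow> clock g x s < ennreal t" and "t \<le> u"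
  shows "time_change g x u = None"
proof (rule time_change_beyond)
  fix s assume "0 \<le> s" "ereal s < explosion_time x"
  then have "clock g x s < ennreal t"
    by (rule assms(1))
  also have "\<dots> \<le> ennreal u"
    using \<open>t \<le> u\<close> by (rule ennreal_leI)
  finally show "clock g x s < ennreal u" .
qed

lemma time_change_after_explosion:
  assumes "explosion_time x = ereal T" and a: "clock g x T = ennreal a" and "a \<le> u"
  shows "time_change g x u = None"
proof (rule time_change_beyond)
  fix s assume s: "0 \<le> s" "ereal s < explosion_time x"
  have "clock g x s < clock g x T"
    by (rule clock_strict_mono) (use s assms clock_finite_alive[OF s] in auto)
  also have "\<dots> \<le> ennreal u"
    using assms by (simp add: ennreal_leI)
  finally show "clock g x s < ennreal u" .
qed

lemma clock_less_imp_less: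
  assumes "clock g x r < clock g x s" "0 \<le> s" "ereal r \<le> explosion_time x"
  shows "r < s"
  using clock_mono[of s r] assms by (cases "r < s") auto

text \<open>As \<open>T\<close> may be an alive time or the explosion time, one argument serves both
  kinds of left limit. The clock takes every value below \<open>t\<close> before \<open>T\<close>,
  so times just before \<open>t\<close> correspond to times just before \<open>T\<close>.\<close>

lemma time_change_left_limit:
  assumes T: "0 < T" "ereal T \<le> explosion_time x"
    and less: "\<And>s. 0 \<le> s \<Longrightarrow> s < T \<Longrightarrow> clock g x s < ennreal t"
    and ex: "\<And>u. 0 \<le> u \<Longrightarrow> u < t \<Longrightarrow> \<exists>r. 0 \<le> r \<and> r < T \<and> clock g x r = ennreal u"
    and l: "limitin S (\<lambda>s. the (x s)) l (at_left T)"
  shows "limitin (Alexandroff_compactification S) (time_change g x) (Some l) (at_left t)"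
  unfolding limitin_def
proof (intro conjI allI impI)
  show "Some l \<in> topspace (Alexandroff_compactification S)"
    using l by (simp add: limitin_def topspace_Alexandroff_compactification)
  fix U assume U: "openin (Alexandroff_compactification S) U \<and> Some l \<in> U"
  define V where "V = {p \<in> topspace S. Some p \<in> U}"
  have "openin S V"
    unfolding V_def using U by (intro openin_continuous_map_preimage[OF continuous_map_Some]) auto
  moreover have "l \<in> V"
    using U l by (simp add: V_def limitin_def)
  ultimately have "\<forall>\<^sub>F u in at_left T. the (x u) \<in> V"
    using l by (simp add: limitin_def)
  then obtain c where c: "c < T" "\<And>u. c < u \<Longrightarrow> u < T \<Longrightarrow> the (x u) \<in> V"
    by (rule eventually_at_left_realE) (rule that)
  define c' where "c' = max c 0"
  have c': "0 \<le> c'" "c' < T" "c \<le> c'"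
    using c(1) T(1) by (auto simp: c'_def)
  have alive_below: "ereal r < explosion_time x" if "r < T" for r
    using that T(2) by (meson less_ereal.simps(1) order_less_le_trans)
  have "clock g x c' < ennreal t"
    using less c' by simp
  then have ct: "real_clock c' < t"
    by (subst (asm) clock_eq_alive[OF c'(1) alive_below[OF c'(2)]]) (simp add: ennreal_less_iff)
  have "time_change g x u \<in> U" if u: "real_clock c' < u" "u < t" for u
  proof -
    have "0 \<le> u"
      using u(1) enn2real_nonneg[of "clock g x c'"] by linarith
    then obtain r where r: "0 \<le> r" "r < T" "clock g x r = ennreal u"
      using ex u by blast
    have "clock g x c' < clock g x r"
      using u(1) by (subst clock_eq_alive[OF c'(1) alive_below[OF c'(2)]]) (simp add: r(3) ennreal_less_iff)
    then have "c' < r"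
      using r c' less_imp_le[OF alive_below[OF c'(2)]] by (intro clock_less_imp_less) auto
    then have "the (x r) \<in> V"
      using c(2)[of r] c' r by simp
    moreover have "time_change g x u = x r"
      using r alive_below[OF r(2)] by (intro time_change_at_clock) auto
    ultimately show ?thesis
      using path_at[OF r(1)] alive_below[OF r(2)] by (auto simp: V_def)
  qed
  then show "\<forall>\<^sub>F u in at_left t. time_change g x u \<in> U"
    unfolding eventually_at_left_field using ct by blast
qed

lemma time_change_right_continuous:
  assumes "0 \<le> t"
  shows "limitin (Alexandroff_compactification S) (time_change g x) (time_change g x t) (at_right t)"
  using assms
proof (cases t rule: time_change_cases)
  case (alive s)
  obtain p where xs: "p \<in> topspace S" "x s = Some p"
    using path_at[OF alive(1)] alive(2) by auto
  show ?thesis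
    unfolding limitin_def
  proof (intro conjI allI impI)
    show "time_change g x t \<in> topspace (Alexandroff_compactification S)"
      using xs alive(4) by (simp add: topspace_Alexandroff_compactification)
    fix U assume U: "openin (Alexandroff_compactification S) U \<and> time_change g x t \<in> U"
    define V where "V = {p \<in> topspace S. Some p \<in> U}"
    have "openin S V"
      unfolding V_def using U by (intro openin_continuous_map_preimage[OF continuous_map_Some]) auto
    moreover have "the (x s) \<in> V"
      using U xs alive(4) by (simp add: V_def)
    ultimately obtain c where c: "s < c" "ereal c < explosion_time x" "\<And>r. s \<le> r \<Longrightarrow> r < c \<Longrightarrow> the (x r) \<in> V"
      by (rule right_nbhd[OF alive(1,2)]) (rule that)
    obtain a where cl: "clock g x c = ennreal a" "0 \<le> a"
      using clock_eq_alive[of c] c alive(1) enn2real_nonneg by auto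
    have "clock g x s < clock g x c"
      using alive c by (intro clock_strict_mono) auto
    then have "t < a"
      using assms cl(1) alive(3) by (simp add: ennreal_less_iff)
    moreover have "time_change g x u \<in> U" if u: "t < u" "u < a" for u
    proof -
      obtain r where r: "0 \<le> r" "r \<le> c" "clock g x r = ennreal u" "time_change g x u = x r"
        by (rule clock_surj[of c u]) (use cl c alive(1) u assms in \<open>auto simp: ennreal_leI intro: that\<close>)
      have rx: "ereal r < explosion_time x"
        using r(2) c(2) by (meson ereal_less_eq(3) le_less_trans)
      have "clock g x s < clock g x r"
        using r(3) u(1) alive(3) assms by (simp add: ennreal_less_iff)
      then have "s < r"
        using r alive less_imp_le[OF alive(2)] by (intro clock_less_imp_less) auto
      moreover have "r \<noteq> c"
        using r(3) cl u assms by (auto simp: ennreal_inj)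
      ultimately have "the (x r) \<in> V"
        using c(3)[of r] r(2) by simp
      then show ?thesis
        using path_at[OF r(1)] rx r(4) by (auto simp: V_def)
    qed
    ultimately show "\<forall>\<^sub>F u in at_right t. time_change g x u \<in> U"
      unfolding eventually_at_right_field by (intro exI[of _ a]) auto
  qed
next
  case dead
  have "time_change g x u = None" if "t < u" for u
    using that by (intro time_change_beyond_mono[OF dead(2)]) auto
  then have "\<forall>\<^sub>F u in at_right t. time_change g x u = None"
    unfolding eventually_at_right_field by (intro exI[of _ "t + 1"]) auto
  then show ?thesis
    unfolding dead(1) by (intro limitin_eventually) (auto simp: topspace_Alexandroff_compactification)
qed

text \<open>The delicate time is the explosion of the time-changed path. If \<open>x\<close> leaves
  every compact set, \<open>unbounded\<close> makes that time infinite. Otherwise, if it is finite,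
  \<open>x\<close> explodes at a finite time inside a compact set, where \<open>D_loc\<close>
  supplies a left limit.\<close>

lemma time_change_in_D_cadlag:
  assumes x: "x \<in> D_loc S"
    and unbounded: "\<And>t. \<not> relatively_compact_in S (visited x) \<Longrightarrow>
      \<exists>s\<ge>0. ereal s < explosion_time x \<and> ennreal t \<le> clock g x s"
  shows "time_change g x \<in> D_cadlag (Alexandroff_compactification S)"
  unfolding D_cadlag_def
proof (safe)
  fix t :: real assume t: "0 \<le> t"
  show "limitin (Alexandroff_compactification S) (time_change g x) (time_change g x t) (at_right t)"
    using t by (rule time_change_right_continuous)
  then show "time_change g x t \<in> topspace (Alexandroff_compactification S)"
    by (simp add: limitin_def)
next
  fix t :: real assume "0 < t"
  then have "0 \<le> t"
    by simp
  then show "\<exists>l. limitin (Alexandroff_compactification S) (time_change g x) l (at_left t)"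
  proof (cases t rule: time_change_cases)
    case (alive s)
    have "s \<noteq> 0"
      using alive(3) \<open>0 < t\<close> by (auto simp: ennreal_eq_0_iff)
    then have "0 < s"
      using alive(1) by simp
    then obtain l where l: "limitin S (\<lambda>s. the (x s)) l (at_left s)"
      using left_limit alive(2) by blast
    have "limitin (Alexandroff_compactification S) (time_change g x) (Some l) (at_left t)"
    proof (rule time_change_left_limit[OF \<open>0 < s\<close> _ _ _ l])
      show "ereal s \<le> explosion_time x"
        using alive(2) by simp
      show "clock g x r < ennreal t" if "0 \<le> r" "r < s" for r
      proof -
        have "ereal r < explosion_time x"
          using that(2) alive(2) by (meson less_ereal.simps(1) less_trans)
        then have "clock g x r < clock g x s"
          using that alive clock_finite_alive[of r] by (intro clock_strict_mono) auto
        then show ?thesis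
          using alive(3) by simp
      qed
      show "\<exists>r\<ge>0. r < s \<and> clock g x r = ennreal u" if u: "0 \<le> u" "u < t" for u
      proof -
        obtain r where r: "0 \<le> r" "r \<le> s" "clock g x r = ennreal u"
          using clock_surj[OF alive(1,2) u(1)] alive(3) u by (auto simp: ennreal_leI)
        moreover have "r \<noteq> s"
          using r(3) alive(3) u by auto
        ultimately show ?thesis
          by (intro exI[of _ r]) auto
      qed
    qed
    then show ?thesis
      by blast
  next
    case dead
    show ?thesis
    proof (cases "\<exists>t0\<ge>0. t0 < t \<and> (\<forall>s\<ge>0. ereal s < explosion_time x \<longrightarrow> clock g x s < ennreal t0)")
      case True
      then obtain t0 where t0: "0 \<le> t0" "t0 < t" "\<And>s. 0 \<le> s \<Longrightarrow> ereal s < explosion_time x \<Longrightarrow> clock g x s < ennreal t0"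
        by blast
      have "time_change g x u = None" if "t0 < u" for u
        using that by (intro time_change_beyond_mono[OF t0(3)]) auto
      then have "\<forall>\<^sub>F u in at_left t. time_change g x u = None"
        unfolding eventually_at_left_field using t0(2) by (intro exI[of _ t0]) auto
      then have "limitin (Alexandroff_compactification S) (time_change g x) None (at_left t)"
        by (intro limitin_eventually) (auto simp: topspace_Alexandroff_compactification)
      then show ?thesis
        by blast
    next
      \<comment> \<open>Now \<open>t\<close> is the supremum of the clock over the lifetime of
        \<open>x\<close>, that is, the explosion time of the time-changed path.\<close>
      case False
      have ex: "\<exists>r\<ge>0. ereal r < explosion_time x \<and> clock g x r = ennreal u" if u: "0 \<le> u" "u < t" for u
      proof -
        obtain s where s: "0 \<le> s" "ereal s < explosion_time x" "ennreal u \<le> clock g x s"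
          using False u by (force simp: not_less)
        obtain r where "0 \<le> r" "r \<le> s" "clock g x r = ennreal u"
          by (rule clock_surj[OF s(1,2) u(1) s(3)]) (rule that)
        then show ?thesis
          using s(2) by (intro exI[of _ r]) (auto intro: le_less_trans[of "ereal r" "ereal s"])
      qed
      have "relatively_compact_in S (visited x)"
      proof (rule ccontr)
        assume "\<not> relatively_compact_in S (visited x)"
        from unbounded[OF this, of t] obtain s where "0 \<le> s" "ereal s < explosion_time x" "ennreal t \<le> clock g x s"
          by blast
        then show False
          using dead(2)[of s] by simp
      qed
      then obtain K where K: "compactin S K" "visited x \<subseteq> K"
        by (auto simp: relatively_compact_in_def)
      obtain m M where mM: "0 < m" "\<And>p. p \<in> K \<Longrightarrow> m \<le> g p \<and> g p \<le> M"
        by (rule compact_speed_bounds[OF K(1)]) (rule that)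
      have range: "the (x u) \<in> K" if "0 \<le> u" "ereal u < explosion_time x" for u
        using K(2) that by (auto simp: visited_def)
      have pos: "0 < explosion_time x"
        using ex[of 0] \<open>0 < t\<close> by (auto intro: le_less_trans[of 0 "ereal _"])
      then have "0 < M"
        using mM(1) mM(2)[OF range[of 0]] by (simp add: zero_ereal_def)
      \<comment> \<open>A speed of at most \<open>M\<close> turns the bound on the clock into a
        bound on the lifetime.\<close>
      have bound: "s \<le> M * t" if s: "0 \<le> s" "ereal s < explosion_time x" for s
      proof -
        have "clock g x 0 + ennreal ((s - 0) / M) \<le> clock g x s"
        proof (rule clock_lower)
          fix u assume u: "0 \<le> u" "u < s"
          then have "ereal u < ereal s"
            by simp
          then have "ereal u < explosion_time x"
            using s(2) by (rule less_trans)
          then show "g_at u \<le> M"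
            using mM(2)[OF range[OF u(1)]] by simp
        qed (use s \<open>0 < M\<close> in auto)
        also have "\<dots> < ennreal t"
          using dead(2) s by blast
        finally have "ennreal (s / M) < ennreal t"
          by simp
        then have "s / M < t"
          using s(1) \<open>0 < M\<close> by (subst (asm) ennreal_less_iff) auto
        then show ?thesis
          using \<open>0 < M\<close> by (simp add: field_simps)
      qed
      have "explosion_time x \<le> ereal (M * t)"
      proof (rule ccontr)
        assume "\<not> ?thesis"
        then have "ereal (M * t) < explosion_time x"
          by simp
        then obtain z where z: "ereal (M * t) < ereal z" "ereal z < explosion_time x"
          using ereal_dense2 by blast
        have "0 < M * t"
          using \<open>0 < M\<close> \<open>0 < t\<close> by simp
        then show False
          using bound[OF _ z(2)] z(1) by simp
      qed
      then obtain T where T: "explosion_time x = ereal T" "0 < T"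
        using pos by (cases "explosion_time x") auto
      have "\<exists>l. limitin S (\<lambda>s. the (x s)) l (at_left T)"
        using x pos \<open>relatively_compact_in S (visited x)\<close> by (simp add: D_loc_def T)
      then obtain l where l: "limitin S (\<lambda>s. the (x s)) l (at_left T)"
        by blast
      have "limitin (Alexandroff_compactification S) (time_change g x) (Some l) (at_left t)"
      proof (rule time_change_left_limit[OF T(2) _ _ _ l])
        show "clock g x s < ennreal t" if "0 \<le> s" "s < T" for s
          using that by (intro dead(2)) (simp_all add: T)
        show "\<exists>r\<ge>0. r < T \<and> clock g x r = ennreal u" if "0 \<le> u" "u < t" for u
          using ex[OF that] by (simp add: T)
      qed (simp add: T)
      then show ?thesis
        by blast
    qed
  qed
qed

end

section \<open>Paths in a locally compact metrizable space\<close>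

text \<open>A Lebesgue number argument: finitely many balls of radius \<open>r p\<close> cover
  \<open>K\<close>, the relation holds on the balls of twice the radius, and \<open>\<delta>\<close>
  is at most each of these radii. Only the first point is tied to \<open>K\<close>, since the second
  will lie on an approximating path.\<close>

lemma compactin_uniform_relation:
  assumes m: "mtopology_of m = X" and K: "compactin X K"
    and R: "\<And>p. p \<in> K \<Longrightarrow> \<exists>U. openin X U \<and> p \<in> U \<and> (\<forall>a\<in>U \<inter> K. \<forall>b\<in>U. R a b)"
  obtains \<delta> where "0 < \<delta>" "\<And>a b. a \<in> K \<Longrightarrow> b \<in> mspace m \<Longrightarrow> mdist m a b < \<delta> \<Longrightarrow> R a b"
proof -
  interpret Metric_space "mspace m" "mdist m"
    by simp
  have X: "mtopology = X"
    using m by (simp add: mtopology_of_def)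
  have K_sub: "K \<subseteq> mspace m"
    using compactin_subset_topspace[OF K] X by auto
  have "\<exists>r>0. \<forall>a\<in>mball p (2 * r) \<inter> K. \<forall>b\<in>mball p (2 * r). R a b" if p: "p \<in> K" for p
  proof -
    obtain U where U: "openin X U" "p \<in> U" "\<forall>a\<in>U \<inter> K. \<forall>b\<in>U. R a b"
      using R[OF p] by blast
    then obtain r where r: "r > 0" "mball p r \<subseteq> U"
      unfolding X[symmetric] openin_mtopology by blast
    show ?thesis
      by (rule exI[of _ "r / 2"]) (use r U(3) in auto)
  qed
  then have "\<exists>r. \<forall>p\<in>K. r p > 0 \<and> (\<forall>a\<in>mball p (2 * r p) \<inter> K. \<forall>b\<in>mball p (2 * r p). R a b)"
    by (intro bchoice ballI)
  then obtain r where "\<forall>p\<in>K. r p > 0 \<and> (\<forall>a\<in>mball p (2 * r p) \<inter> K. \<forall>b\<in>mball p (2 * r p). R a b)"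
    by (rule exE)
  then have r: "r p > 0"
    "a \<in> mball p (2 * r p) \<Longrightarrow> a \<in> K \<Longrightarrow> b \<in> mball p (2 * r p) \<Longrightarrow> R a b" if "p \<in> K" for p a b
    using that by blast+
  have "\<exists>F. finite F \<and> F \<subseteq> (\<lambda>p. mball p (r p)) ` K \<and> K \<subseteq> \<Union>F"
  proof (rule compactinD[OF K])
    show "openin X U" if "U \<in> (\<lambda>p. mball p (r p)) ` K" for U
      using that X by auto
    show "K \<subseteq> \<Union> ((\<lambda>p. mball p (r p)) ` K)"
      using r(1) K_sub by (force simp: in_mball)
  qed
  then obtain F where F: "finite F" "F \<subseteq> (\<lambda>p. mball p (r p)) ` K" "K \<subseteq> \<Union>F"
    by blast
  obtain C where "C \<subseteq> K" "finite C" "F = (\<lambda>p. mball p (r p)) ` C"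
    using finite_subset_image[OF F(1,2)] by blast
  with F(3) have C: "finite C" "C \<subseteq> K" "K \<subseteq> (\<Union>p\<in>C. mball p (r p))"
    by simp_all
  define \<delta> where "\<delta> = Min (insert 1 (r ` C))"
  have "0 < \<delta>"
    using C r(1) by (auto simp: \<delta>_def)
  moreover have "R a b" if ab: "a \<in> K" "b \<in> mspace m" "mdist m a b < \<delta>" for a b
  proof -
    obtain p where p: "p \<in> C" "a \<in> mball p (r p)"
      using C(3) ab(1) by blast
    have "\<delta> \<le> r p"
      using C(1) p(1) by (auto simp: \<delta>_def)
    moreover have "mdist m p b \<le> mdist m p a + mdist m a b"
      using p C K_sub ab by (intro triangle) auto
    ultimately have "b \<in> mball p (2 * r p)" "a \<in> mball p (2 * r p)"
      using p ab C K_sub r(1)[of p] by auto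
    then show ?thesis
      using r(2)[of p a b] p(1) C(2) ab(1) by auto
  qed
  ultimately show thesis
    using that by blast
qed

locale skorokhod_metrics =
  fixes S :: "'a topology" and d :: "'a metric" and d\<^sub>\<Delta> :: "'a option metric"
  assumes lc: "locally_compact_space S"
    and d: "mtopology_of d = S"
    and d\<^sub>\<Delta>: "mtopology_of d\<^sub>\<Delta> = Alexandroff_compactification S"
begin

lemma topspace_eq: "topspace S = mspace d"
  using topspace_mtopology_of[of d] by (simp add: d)

lemma mspace_d\<^sub>\<Delta>: "mspace d\<^sub>\<Delta> = insert None (Some ` topspace S)"
  using topspace_mtopology_of[of d\<^sub>\<Delta>] by (simp add: d\<^sub>\<Delta> topspace_Alexandroff_compactification)

text \<open>The speeds are compared multiplicatively, since clocks run at rate \<open>1 / g\<close>.\<close>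

definition near :: "('a \<Rightarrow> real) \<Rightarrow> real \<Rightarrow> real \<Rightarrow> 'a \<Rightarrow> 'a \<Rightarrow> bool" where
  "near g \<epsilon> q a b \<longleftrightarrow>
     mdist d a b \<le> \<epsilon> \<and> mdist d\<^sub>\<Delta> (Some a) (Some b) \<le> \<epsilon> \<and> g a \<le> q * g b \<and> g b \<le> q * g a"

lemma near_nbhd:
  assumes g: "continuous_map S (top_of_set {0<..}) g" and "0 < \<epsilon>" "1 < q" and p: "p \<in> topspace S"
  obtains U where "openin S U" "p \<in> U" "\<And>a b. a \<in> U \<Longrightarrow> b \<in> U \<Longrightarrow> near g \<epsilon> q a b"
proof -
  interpret D: Metric_space "mspace d" "mdist d"
    by simp
  interpret E: Metric_space "mspace d\<^sub>\<Delta>" "mdist d\<^sub>\<Delta>"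
    by simp
  have gp: "g a > 0" if "a \<in> topspace S" for a
    using g that by (auto simp: continuous_map_in_subtopology)
  \<comment> \<open>Both points are compared with \<open>p\<close>, so each comparison may spend a
    factor \<open>sqrt q\<close> and a distance \<open>\<epsilon> / 2\<close>.\<close>
  define w where "w = sqrt q"
  have w: "1 < w" "w * w = q"
    using \<open>1 < q\<close> by (auto simp: w_def)
  define U1 where "U1 = D.mball p (\<epsilon> / 2)"
  define U2 where "U2 = {a \<in> topspace S. Some a \<in> E.mball (Some p) (\<epsilon> / 2)}"
  define U3 where "U3 = {a \<in> topspace S. g a \<in> {g p / w<..<w * g p}}"
  have "openin S U1"
    using D.openin_mball[of p "\<epsilon> / 2"] d unfolding U1_def mtopology_of_def by simp
  moreover have "openin S U2"
    unfolding U2_def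
  proof (rule openin_continuous_map_preimage[OF continuous_map_Some])
    show "openin (Alexandroff_compactification S) (E.mball (Some p) (\<epsilon> / 2))"
      using E.openin_mball[of "Some p" "\<epsilon> / 2"] d\<^sub>\<Delta> unfolding mtopology_of_def by simp
  qed
  moreover have "openin S U3"
    unfolding U3_def
    by (rule openin_continuous_map_preimage[of S euclideanreal])
      (use g in \<open>auto simp: continuous_map_in_subtopology\<close>)
  ultimately have "openin S (U1 \<inter> U2 \<inter> U3)"
    by (intro openin_Int)
  moreover have "Some p \<in> E.mball (Some p) (\<epsilon> / 2)"
    using p \<open>0 < \<epsilon>\<close> by (simp only: E.centre_in_mball_iff) (simp add: mspace_d\<^sub>\<Delta>)
  then have "p \<in> U1 \<inter> U2 \<inter> U3"
    using p \<open>0 < \<epsilon>\<close> gp[OF p] w(1) by (auto simp: U1_def U2_def U3_def field_simps topspace_eq)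
  moreover have "near g \<epsilon> q a b" if ab: "a \<in> U1 \<inter> U2 \<inter> U3" "b \<in> U1 \<inter> U2 \<inter> U3" for a b
  proof -
    have "mdist d a b \<le> mdist d p a + mdist d p b"
      using D.triangle[of a p b] D.commute[of a p] ab p by (auto simp: U1_def topspace_eq)
    then have 1: "mdist d a b \<le> \<epsilon>"
      using ab by (auto simp: U1_def)
    have "mdist d\<^sub>\<Delta> (Some a) (Some b) \<le> mdist d\<^sub>\<Delta> (Some p) (Some a) + mdist d\<^sub>\<Delta> (Some p) (Some b)"
      using E.triangle[of "Some a" "Some p" "Some b"] E.commute[of "Some a" "Some p"] ab p
      by (auto simp: U2_def mspace_d\<^sub>\<Delta>)
    then have 2: "mdist d\<^sub>\<Delta> (Some a) (Some b) \<le> \<epsilon>"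
      using ab by (auto simp: U2_def)
    have 3: "g a' \<le> q * g b'" if a'b': "a' \<in> U3" "b' \<in> U3" for a' b'
    proof -
      have "g a' \<le> w * g p" "g p \<le> w * g b'"
        using a'b' w(1) by (auto simp: U3_def field_simps)
      then have "g a' \<le> w * (w * g b')"
        using w(1) mult_left_mono[of "g p" "w * g b'" w] by linarith
      then show ?thesis
        by (simp flip: w(2) add: mult.assoc)
    qed
    show ?thesis
      unfolding near_def using 1 2 3 ab by auto
  qed
  ultimately show thesis
    using that by blast
qed

lemma near_of_dist:
  assumes g: "continuous_map S (top_of_set {0<..}) g" and "0 < \<epsilon>" "1 < q" and K: "compactin S K"
  obtains \<delta> where "0 < \<delta>" "\<And>a b. a \<in> K \<Longrightarrow> b \<in> topspace S \<Longrightarrow> mdist d a b < \<delta> \<Longrightarrow> near g \<epsilon> q a b"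
proof (rule compactin_uniform_relation[OF d K, of "near g \<epsilon> q"])
  fix p assume "p \<in> K"
  then have "p \<in> topspace S"
    using compactin_subset_topspace[OF K] by blast
  obtain U where "openin S U" "p \<in> U" "\<And>a b. a \<in> U \<Longrightarrow> b \<in> U \<Longrightarrow> near g \<epsilon> q a b"
    by (rule near_nbhd[OF assms(1-3) \<open>p \<in> topspace S\<close>]) (rule that)
  then show "\<exists>U. openin S U \<and> p \<in> U \<and> (\<forall>a\<in>U \<inter> K. \<forall>b\<in>U. near g \<epsilon> q a b)"
    by blast
qed (use that in \<open>auto simp: topspace_eq\<close>)

text \<open>\<open>S\<close> is open in its compactification, so a point close enough to
  \<open>K\<close> there cannot be the cemetery. Closeness in the compactification thus yields
  survival together with closeness in \<open>S\<close>.\<close>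

lemma near_of_dist_Some:
  assumes g: "continuous_map S (top_of_set {0<..}) g" and "0 < \<epsilon>" "1 < q" and K: "compactin S K"
  obtains \<delta> where "0 < \<delta>"
    "\<And>a z. a \<in> K \<Longrightarrow> z \<in> topspace (Alexandroff_compactification S) \<Longrightarrow> mdist d\<^sub>\<Delta> (Some a) z < \<delta> \<Longrightarrow>
      \<exists>b\<in>topspace S. z = Some b \<and> near g \<epsilon> q a b"
proof (rule compactin_uniform_relation[OF d\<^sub>\<Delta> image_compactin[OF K continuous_map_Some],
      of "\<lambda>y z. \<exists>a b. b \<in> topspace S \<and> y = Some a \<and> z = Some b \<and> near g \<epsilon> q a b"])
  fix y assume "y \<in> Some ` K"
  then obtain p where p: "p \<in> K" "y = Some p"
    by blast
  then have "p \<in> topspace S"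
    using compactin_subset_topspace[OF K] by blast
  obtain U where U: "openin S U" "p \<in> U" "\<And>a b. a \<in> U \<Longrightarrow> b \<in> U \<Longrightarrow> near g \<epsilon> q a b"
    by (rule near_nbhd[OF assms(1-3) \<open>p \<in> topspace S\<close>]) (rule that)
  show "\<exists>V. openin (Alexandroff_compactification S) V \<and> y \<in> V \<and>
      (\<forall>y\<in>V \<inter> Some ` K. \<forall>z\<in>V. \<exists>a b. b \<in> topspace S \<and> y = Some a \<and> z = Some b \<and> near g \<epsilon> q a b)"
  proof (rule exI[of _ "Some ` U"], intro conjI)
    show "\<forall>y\<in>Some ` U \<inter> Some ` K. \<forall>z\<in>Some ` U. \<exists>a b. b \<in> topspace S \<and> y = Some a \<and> z = Some b \<and> near g \<epsilon> q a b"
      using U(3) openin_subset[OF U(1)] by auto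
  qed (use U p in auto)
next
  fix \<delta> assume \<delta>: "0 < \<delta>" "\<And>y z. y \<in> Some ` K \<Longrightarrow> z \<in> mspace d\<^sub>\<Delta> \<Longrightarrow> mdist d\<^sub>\<Delta> y z < \<delta> \<Longrightarrow>
    \<exists>a b. b \<in> topspace S \<and> y = Some a \<and> z = Some b \<and> near g \<epsilon> q a b"
  have "\<exists>b\<in>topspace S. z = Some b \<and> near g \<epsilon> q a b"
    if a: "a \<in> K" and z: "z \<in> topspace (Alexandroff_compactification S)" and dist: "mdist d\<^sub>\<Delta> (Some a) z < \<delta>" for a z
  proof -
    have "z \<in> mspace d\<^sub>\<Delta>"
      using z by (simp add: mspace_d\<^sub>\<Delta> topspace_Alexandroff_compactification)
    from \<delta>(2)[OF imageI[OF a] this dist] show ?thesis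
      by auto
  qed
  then show thesis
    using that \<delta>(1) by blast
qed

text \<open>The sublevel sets of this function are the traces on \<open>S\<close> of a neighbourhood base of the cemetery.\<close>

abbreviation dist_cemetery :: "'a \<Rightarrow> real" where
  "dist_cemetery p \<equiv> mdist d\<^sub>\<Delta> (Some p) None"

lemma dist_cemetery_pos: "p \<in> topspace S \<Longrightarrow> 0 < dist_cemetery p"
  using mdist_nonneg[of d\<^sub>\<Delta> "Some p" None] mdist_zero[of "Some p" d\<^sub>\<Delta> None]
  by (auto simp: mspace_d\<^sub>\<Delta> less_le)

lemma continuous_dist_cemetery: "continuous_map S euclideanreal dist_cemetery"
proof -
  interpret E: Metric_space "mspace d\<^sub>\<Delta>" "mdist d\<^sub>\<Delta>"
    by simp
  have "None \<in> mspace d\<^sub>\<Delta>"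
    by (simp add: mspace_d\<^sub>\<Delta>)
  then have "continuous_map E.mtopology euclideanreal (\<lambda>z. mdist d\<^sub>\<Delta> z None)"
    by (intro continuous_map_mdist[where m = d\<^sub>\<Delta>, unfolded mtopology_of_def]) simp_all
  then have "continuous_map (Alexandroff_compactification S) euclideanreal (\<lambda>z. mdist d\<^sub>\<Delta> z None)"
    using d\<^sub>\<Delta> by (simp add: mtopology_of_def)
  from continuous_map_compose[OF continuous_map_Some this] show ?thesis
    by (simp add: o_def)
qed

text \<open>The speed is the infimum of 1 and of the functions \<open>f i\<close>, evaluated at the
  distance to the cemetery. Each \<open>f i\<close> is 1-Lipschitz and equals
  \<open>\<beta> i\<close> up to \<open>\<delta> i\<close>, so the infimum is 1-Lipschitz and obeys
  all the bounds; finiteness of the index sets keeps it positive.\<close>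

lemma exists_slow_speed:
  fixes \<delta> \<beta> :: "'i \<Rightarrow> real"
  assumes \<beta>: "\<And>i. i \<in> I \<Longrightarrow> 0 < \<beta> i" and fin: "\<And>e. 0 < e \<Longrightarrow> finite {i \<in> I. e \<le> \<delta> i}"
  obtains g where "continuous_map S (top_of_set {0<..}) g"
    "\<And>i p. i \<in> I \<Longrightarrow> p \<in> topspace S \<Longrightarrow> dist_cemetery p \<le> \<delta> i \<Longrightarrow> g p \<le> \<beta> i"
proof -
  define f where "f i r = \<beta> i + max 0 (r - \<delta> i)" for i r
  define \<phi> where "\<phi> r = Inf (insert 1 ((\<lambda>i. f i r) ` I))" for r
  have f_pos: "0 \<le> f i r" if "i \<in> I" for i r
    using \<beta>[OF that] by (auto simp: f_def)
  have bdd: "bdd_below (insert 1 ((\<lambda>i. f i r) ` I))" for r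
    using f_pos by (intro bdd_belowI[of _ 0]) auto
  have "\<phi> r \<le> \<phi> s + \<bar>r - s\<bar>" for r s
  proof -
    have "\<phi> r - \<bar>r - s\<bar> \<le> y" if "y \<in> insert 1 ((\<lambda>i. f i s) ` I)" for y
      using that
    proof
      assume "y = 1"
      moreover have "\<phi> r \<le> 1"
        unfolding \<phi>_def by (intro cInf_lower bdd) simp
      ultimately show ?thesis
        by simp
    next
      assume "y \<in> (\<lambda>i. f i s) ` I"
      then obtain i where i: "i \<in> I" "y = f i s"
        by blast
      have "\<phi> r \<le> f i r"
        unfolding \<phi>_def using i by (intro cInf_lower bdd) simp
      also have "\<dots> \<le> y + \<bar>r - s\<bar>"
        using i by (auto simp: f_def)
      finally show ?thesis
        by simp
    qed
    then have "\<phi> r - \<bar>r - s\<bar> \<le> \<phi> s"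
      unfolding \<phi>_def[of s] by (intro cInf_greatest) auto
    then show ?thesis
      by simp
  qed
  note lip = this
  have "1-lipschitz_on UNIV \<phi>"
  proof (rule lipschitz_onI)
    fix r s
    show "dist (\<phi> r) (\<phi> s) \<le> 1 * dist r s"
      using lip[of r s] lip[of s r] by (simp add: dist_real_def abs_le_iff abs_minus_commute)
  qed simp
  then have cont: "continuous_on UNIV \<phi>"
    by (rule lipschitz_on_continuous_on)
  have pos: "0 < \<phi> r" if "0 < r" for r
  proof -
    \<comment> \<open>For indices outside \<open>J\<close> the value \<open>f i r\<close> exceeds
      \<open>r / 2\<close>, so beside 1 and \<open>r / 2\<close> only finitely many values
      \<open>\<beta> i\<close> matter.\<close>
    define J where "J = {i \<in> I. r / 2 \<le> \<delta> i}"
    have "finite J"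
      unfolding J_def using \<open>0 < r\<close> by (intro fin) simp
    define b where "b = Min (insert 1 (insert (r / 2) (\<beta> ` J)))"
    have "0 < b"
      using \<open>finite J\<close> \<beta> \<open>0 < r\<close> by (auto simp: b_def J_def)
    have "b \<le> y" if "y \<in> insert 1 ((\<lambda>i. f i r) ` I)" for y
      using that
    proof
      assume "y = 1"
      then show ?thesis
        using \<open>finite J\<close> by (simp add: b_def)
    next
      assume "y \<in> (\<lambda>i. f i r) ` I"
      then obtain i where i: "i \<in> I" "y = f i r"
        by blast
      show ?thesis
      proof (cases "i \<in> J")
        case True
        then have "b \<le> \<beta> i"
          unfolding b_def using \<open>finite J\<close> by (intro Min_le) auto
        then show ?thesis
          using i by (simp add: f_def)
      next
        case False
        then have "r / 2 \<le> y"
          using i \<beta>[OF i(1)] by (auto simp: f_def J_def max_def)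
        moreover have "b \<le> r / 2"
          unfolding b_def using \<open>finite J\<close> by (intro Min_le) auto
        ultimately show ?thesis
          by simp
      qed
    qed
    then have "b \<le> \<phi> r"
      unfolding \<phi>_def by (intro cInf_greatest) auto
    then show ?thesis
      using \<open>0 < b\<close> by simp
  qed
  show thesis
  proof (rule that[of "\<lambda>p. \<phi> (dist_cemetery p)"])
    have "continuous_map S euclideanreal (\<phi> \<circ> dist_cemetery)"
      using cont by (intro continuous_map_compose[OF continuous_dist_cemetery]) simp
    then show "continuous_map S (top_of_set {0<..}) (\<lambda>p. \<phi> (dist_cemetery p))"
      using pos dist_cemetery_pos by (auto simp: continuous_map_in_subtopology o_def)
    fix i p assume i: "i \<in> I" "dist_cemetery p \<le> \<delta> i"
    have "\<phi> (dist_cemetery p) \<le> f i (dist_cemetery p)"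
      unfolding \<phi>_def using i(1) by (intro cInf_lower bdd) simp
    also have "\<dots> = \<beta> i"
      using i(2) by (simp add: f_def)
    finally show "\<phi> (dist_cemetery p) \<le> \<beta> i" .
  qed
qed

lemma path_clockI: "y \<in> D_exp S \<Longrightarrow> continuous_map S (top_of_set {0<..}) g \<Longrightarrow> path_clock S g y"
  using lc by (intro path_clock.intro)

text \<open>The complement of an open ball around the cemetery is compact in the compactification
  and corresponds to a compact subset of \<open>S\<close>, which cannot contain all of
  \<open>visited y\<close>.\<close>

lemma path_leaves_compacts:
  assumes y: "path_clock S g y" and "\<not> relatively_compact_in S (visited y)" and "0 < e"
  obtains s where "0 \<le> s" "ereal s < explosion_time y" "dist_cemetery (the (y s)) < e"
proof -
  interpret E: Metric_space "mspace d\<^sub>\<Delta>" "mdist d\<^sub>\<Delta>"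
    by simp
  define C where "C = mspace d\<^sub>\<Delta> - E.mball None e"
  have top: "E.mtopology = Alexandroff_compactification S"
    using d\<^sub>\<Delta> by (simp add: mtopology_of_def)
  have "closedin E.mtopology C"
    unfolding C_def using closedin_diff[OF closedin_topspace[of E.mtopology] E.openin_mball] by simp
  then have "closedin (Alexandroff_compactification S) C"
    by (simp only: top)
  then have C: "compactin (Alexandroff_compactification S) C"
    by (intro closedin_compact_space) auto
  have "None \<in> E.mball None e"
    using \<open>0 < e\<close> by (simp only: E.centre_in_mball_iff) (simp add: mspace_d\<^sub>\<Delta>)
  then have "None \<notin> C"
    unfolding C_def by blast
  define K where "K = {p \<in> topspace S. Some p \<in> C}"
  have "Some ` K = C"
    using \<open>None \<notin> C\<close> by (auto simp: K_def C_def mspace_d\<^sub>\<Delta>)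
  have "compactin S K"
  proof -
    have "homeomorphic_map S (subtopology (Alexandroff_compactification S) (Some ` topspace S)) Some"
      using embedding_map_Some by (simp add: embedding_map_def)
    moreover have "K \<subseteq> topspace S"
      by (auto simp: K_def)
    moreover have "compactin (subtopology (Alexandroff_compactification S) (Some ` topspace S)) (Some ` K)"
      using C \<open>Some ` K = C\<close> \<open>K \<subseteq> topspace S\<close> by (auto simp: compactin_subtopology)
    ultimately show ?thesis
      by (simp add: homeomorphic_map_compactness_eq)
  qed
  then have "\<not> visited y \<subseteq> K"
    using assms(2) by (auto simp: relatively_compact_in_def)
  then obtain s where s: "0 \<le> s" "ereal s < explosion_time y" "the (y s) \<notin> K"
    by (auto simp: visited_def)
  have "the (y s) \<in> topspace S"
    using path_clock.alive(1)[OF y s(1,2)] .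
  then have "Some (the (y s)) \<in> E.mball None e"
    using s(3) by (auto simp: K_def C_def mspace_d\<^sub>\<Delta>)
  then have "dist_cemetery (the (y s)) < e"
    by (simp add: E.commute)
  then show thesis
    using that s by blast
qed

end

section \<open>Sequences of time changes\<close>

lemma SUP_ennreal_tendsto_0D:
  fixes f :: "nat \<Rightarrow> 'b \<Rightarrow> real"
  assumes "(\<lambda>k. SUP s\<in>I. ennreal (f k s)) \<longlonglongrightarrow> 0" "0 < e"
  shows "\<forall>\<^sub>F k in sequentially. \<forall>s\<in>I. f k s < e"
proof -
  have "\<forall>\<^sub>F k in sequentially. (SUP s\<in>I. ennreal (f k s)) < ennreal e"
    using assms by (intro order_tendstoD(2)[OF assms(1)]) simp
  then show ?thesis
  proof (rule eventually_mono, intro ballI)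
    fix k s assume k: "(SUP s\<in>I. ennreal (f k s)) < ennreal e" and s: "s \<in> I"
    have "ennreal (f k s) < ennreal e"
      using SUP_upper[OF s, of "\<lambda>s. ennreal (f k s)"] k by (rule le_less_trans)
    then show "f k s < e"
      using \<open>0 < e\<close> by (cases "0 \<le> f k s") (auto simp: ennreal_less_iff)
  qed
qed

lemma SUP_ennreal_tendsto_0I:
  fixes f :: "nat \<Rightarrow> 'b \<Rightarrow> real"
  assumes "\<And>e. 0 < e \<Longrightarrow> \<forall>\<^sub>F k in sequentially. \<forall>s\<in>I. f k s \<le> e"
  shows "(\<lambda>k. SUP s\<in>I. ennreal (f k s)) \<longlonglongrightarrow> 0"
proof (rule order_tendstoI)
  fix a :: ennreal assume "0 < a"
  then obtain b where b: "0 < b" "b < a"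
    using dense by blast
  then obtain e where e: "b = ennreal e" "0 < e"
    by (cases b) (auto simp: ennreal_less_zero_iff)
  from assms[OF e(2)] show "\<forall>\<^sub>F k in sequentially. (SUP s\<in>I. ennreal (f k s)) < a"
  proof (rule eventually_mono)
    fix k assume "\<forall>s\<in>I. f k s \<le> e"
    then have "(SUP s\<in>I. ennreal (f k s)) \<le> ennreal e"
      by (intro SUP_least ennreal_leI) blast
    then show "(SUP s\<in>I. ennreal (f k s)) < a"
      using b e by simp
  qed
qed simp

text \<open>For each \<open>k\<close> take a member of \<open>L\<close> that serves the largest
  solvable level \<open>j \<le> k\<close>; the cap by \<open>k\<close> makes the maximum exist. A
  fixed level is eventually solvable and below that maximum, so \<open>anti\<close> passes its
  property down.\<close>

lemma diagonal_sequence: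
  fixes Q :: "nat \<Rightarrow> nat \<Rightarrow> 'b \<Rightarrow> bool"
  assumes ex: "\<And>j. \<forall>\<^sub>F k in sequentially. \<exists>l\<in>L. Q j k l" and anti: "\<And>j k l. Q (Suc j) k l \<Longrightarrow> Q j k l"
    and "l0 \<in> L"
  obtains l where "\<And>k. l k \<in> L" "\<And>j. \<forall>\<^sub>F k in sequentially. Q j k (l k)"
proof -
  define J where "J k = {j. j \<le> k \<and> (\<exists>l\<in>L. Q j k l)}" for k
  have fin: "finite (J k)" for k
    by (rule finite_subset[of _ "{..k}"]) (auto simp: J_def)
  have "\<exists>l\<in>L. J k \<noteq> {} \<longrightarrow> Q (Max (J k)) k l" for k
  proof (cases "J k = {}")
    case False
    then show ?thesis
      using Max_in[OF fin False] by (auto simp: J_def)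
  qed (use \<open>l0 \<in> L\<close> in auto)
  then have "\<forall>k. \<exists>l. l \<in> L \<and> (J k \<noteq> {} \<longrightarrow> Q (Max (J k)) k l)"
    by blast
  from choice[OF this] obtain l where l: "\<And>k. l k \<in> L" "\<And>k. J k \<noteq> {} \<Longrightarrow> Q (Max (J k)) k (l k)"
    by auto
  have anti_le: "Q j k l" if "Q i k l" "j \<le> i" for i j k l
    using that(2,1) by (induction rule: inc_induct) (auto dest: anti)
  have "\<forall>\<^sub>F k in sequentially. Q j k (l k)" for j
    using ex[of j] eventually_ge_at_top[of j]
  proof eventually_elim
    case (elim k)
    then have "j \<in> J k"
      by (simp add: J_def)
    then have "J k \<noteq> {}" "j \<le> Max (J k)"
      using fin by auto
    then show ?case
      using l(2) anti_le by blast
  qed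
  then show thesis
    using that l(1) by blast
qed

lemma global_skorokhod_convergesD:
  assumes "global_skorokhod_converges d ys y"
  obtains l where "\<And>k. l k \<in> increasing_homeomorphisms"
    "\<And>t e. 0 \<le> t \<Longrightarrow> 0 < e \<Longrightarrow>
      \<forall>\<^sub>F k in sequentially. \<forall>s\<in>{0..t}. mdist d (y s) (ys k (l k s)) < e \<and> \<bar>l k s - s\<bar> < e"
proof -
  obtain l where l: "\<And>k. l k \<in> increasing_homeomorphisms"
    "\<And>t. 0 \<le> t \<Longrightarrow> (\<lambda>k. SUP s\<in>{0..t}. ennreal (mdist d (y s) (ys k (l k s)))) \<longlonglongrightarrow> 0"
    "\<And>t. 0 \<le> t \<Longrightarrow> (\<lambda>k. SUP s\<in>{0..t}. ennreal \<bar>l k s - s\<bar>) \<longlonglongrightarrow> 0"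
    using assms unfolding global_skorokhod_converges_def by blast
  show thesis
  proof (rule that[OF l(1)])
    fix t e :: real assume "0 \<le> t" "0 < e"
    show "\<forall>\<^sub>F k in sequentially. \<forall>s\<in>{0..t}. mdist d (y s) (ys k (l k s)) < e \<and> \<bar>l k s - s\<bar> < e"
      using SUP_ennreal_tendsto_0D[OF l(2)[OF \<open>0 \<le> t\<close>] \<open>0 < e\<close>]
        SUP_ennreal_tendsto_0D[OF l(3)[OF \<open>0 \<le> t\<close>] \<open>0 < e\<close>]
      by eventually_elim blast
  qed
qed

lemma id_in_increasing_homeomorphisms: "(\<lambda>s. s) \<in> increasing_homeomorphisms"
proof (rule increasing_homeomorphismsI)
  show "\<exists>s\<ge>0. y \<le> s" for y :: real
    by (rule exI[of _ "max 0 y"]) simp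
qed (auto simp: strict_mono_on_def)

text \<open>Window and precision improve together: level \<open>j\<close> asks for error
  \<open>1 / Suc j\<close> on \<open>{0..j}\<close>, so one good homeomorphism per level and index
  is enough.\<close>

lemma global_skorokhod_convergesI:
  assumes ex: "\<And>t e. 0 \<le> t \<Longrightarrow> 0 < e \<Longrightarrow> \<forall>\<^sub>F k in sequentially.
    \<exists>l\<in>increasing_homeomorphisms. \<forall>s\<in>{0..t}. mdist d (y s) (ys k (l s)) \<le> e \<and> \<bar>l s - s\<bar> \<le> e"
  shows "global_skorokhod_converges d ys y"
proof -
  let ?Q = "\<lambda>j k l. \<forall>s\<in>{0..real j}. mdist d (y s) (ys k (l s)) \<le> 1 / real (Suc j) \<and> \<bar>l s - s\<bar> \<le> 1 / real (Suc j)"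
  have anti: "?Q j k l" if "?Q (Suc j) k l" for j k l
  proof
    fix s assume "s \<in> {0..real j}"
    then have "mdist d (y s) (ys k (l s)) \<le> 1 / real (Suc (Suc j)) \<and> \<bar>l s - s\<bar> \<le> 1 / real (Suc (Suc j))"
      using that by simp
    moreover have "1 / real (Suc (Suc j)) \<le> 1 / real (Suc j)"
      by (simp add: frac_le)
    ultimately show "mdist d (y s) (ys k (l s)) \<le> 1 / real (Suc j) \<and> \<bar>l s - s\<bar> \<le> 1 / real (Suc j)"
      by linarith
  qed
  obtain l where l: "\<And>k. l k \<in> increasing_homeomorphisms"
    "\<And>j. \<forall>\<^sub>F k in sequentially. ?Q j k (l k)"
  proof (rule diagonal_sequence[where Q = ?Q and L = increasing_homeomorphisms])
    show "\<forall>\<^sub>F k in sequentially. \<exists>l\<in>increasing_homeomorphisms. ?Q j k l" for j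
      by (rule ex) simp_all
  qed (use anti id_in_increasing_homeomorphisms in blast)+
  have bound: "\<forall>\<^sub>F k in sequentially. \<forall>s\<in>{0..t}. mdist d (y s) (ys k (l k s)) \<le> e \<and> \<bar>l k s - s\<bar> \<le> e"
    if "0 < e" for t e :: real
  proof -
    obtain j1 :: nat where j1: "t \<le> real j1"
      using real_arch_simple by blast
    obtain j2 :: nat where j2: "1 / real (Suc j2) < e"
      using \<open>0 < e\<close> nat_approx_posE by blast
    define j where "j = max j1 j2"
    have "1 / real (Suc j) \<le> 1 / real (Suc j2)" "t \<le> real j"
      using j1 by (auto simp: j_def frac_le)
    then show ?thesis
      using l(2)[of j] j2 by (auto elim!: eventually_mono) (meson atLeastAtMost_iff less_imp_le order_trans)+
  qed
  show ?thesis
    unfolding global_skorokhod_converges_def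
    by (intro exI[of _ l] conjI allI impI l(1) SUP_ennreal_tendsto_0I eventually_mono[OF bound]) auto
qed

section \<open>Maps with slopes between \<open>1 / q\<close> and \<open>q\<close> on an initial
  interval\<close>

context
  fixes q T :: real and l :: "real \<Rightarrow> real"
  assumes q: "1 < q" and T: "0 \<le> T" and l0: "l 0 = 0"
    and slopes: "\<And>r s. 0 \<le> r \<Longrightarrow> r \<le> s \<Longrightarrow> s \<le> T \<Longrightarrow> (s - r) / q \<le> l s - l r \<and> l s - l r \<le> q * (s - r)"
begin

lemma slopes_strict_mono: "strict_mono_on {0..T} l"
proof (rule strict_mono_onI)
  fix r s assume "r \<in> {0..T}" "s \<in> {0..T}" "r < s"
  moreover from this have "0 < (s - r) / q"
    using q by simp
  ultimately show "l r < l s"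
    using slopes[of r s] by auto
qed

lemma slopes_continuous: "continuous_on {0..T} l"
proof (rule lipschitz_on_continuous_on, rule lipschitz_onI)
  have *: "dist (l s) (l r) \<le> q * dist s r" if "0 \<le> r" "r \<le> s" "s \<le> T" for r s
    using slopes[OF that] that q strict_mono_on_leD[OF slopes_strict_mono, of r s]
    by (simp add: dist_real_def)
  show "dist (l s) (l r) \<le> q * dist s r" if "s \<in> {0..T}" "r \<in> {0..T}" for r s
    using that *[of s r] *[of r s] by (cases "s \<le> r") (simp_all add: dist_commute)
qed (use q in simp)

lemma slopes_surj:
  assumes "0 \<le> a" "a \<le> b" "b \<le> T" "l a \<le> v" "v < l b"
  obtains u where "a \<le> u" "u < b" "l u = v"
proof -
  have "continuous_on {a..b} l"
    using slopes_continuous by (rule continuous_on_subset) (use assms in auto)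
  then obtain u where u: "a \<le> u" "u \<le> b" "l u = v"
    using IVT'[of l a v b] assms by auto
  then have "u \<noteq> b"
    using assms(5) by auto
  then show thesis
    using that u by auto
qed

lemma slopes_nonneg: "0 \<le> s \<Longrightarrow> s \<le> T \<Longrightarrow> 0 \<le> l s"
  using strict_mono_on_leD[OF slopes_strict_mono, of 0 s] l0 by simp

end

text \<open>Just after \<open>s\<close> the speed along \<open>x\<close> stays within a factor
  \<open>q\<close> of \<open>G\<close>, hence that along \<open>x'\<close> within
  \<open>q ^ 2\<close>, and \<open>l\<close> contributes another \<open>q\<close>. No common length
  of these intervals is known, so the comparison is propagated by
  \<open>locally_decreasing_imp_le\<close>.\<close>

lemma clock_comparison:
  fixes q T m :: real
  assumes X: "path_clock S g x" and Y: "path_clock S g x'"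
    and q: "1 < q" and T: "0 \<le> T" "ereal T \<le> explosion_time x"
    and l0: "l 0 = 0"
    and slopes: "\<And>r s. 0 \<le> r \<Longrightarrow> r \<le> s \<Longrightarrow> s \<le> T \<Longrightarrow> (s - r) / q \<le> l s - l r \<and> l s - l r \<le> q * (s - r)"
    and lT: "ereal (l T) \<le> explosion_time x'"
    and m: "0 < m" "\<And>s. 0 \<le> s \<Longrightarrow> s < T \<Longrightarrow> m \<le> g (the (x s))"
    and near: "\<And>s. 0 \<le> s \<Longrightarrow> s < T \<Longrightarrow>
      g (the (x s)) \<le> q * g (the (x' (l s))) \<and> g (the (x' (l s))) \<le> q * g (the (x s))"
  shows "\<And>u. 0 \<le> u \<Longrightarrow> u < l T \<Longrightarrow> m / q \<le> g (the (x' u))"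
    and "\<And>s. 0 \<le> s \<Longrightarrow> s \<le> T \<Longrightarrow>
      enn2real (clock g x' (l s)) \<le> q ^ 4 * enn2real (clock g x s) \<and>
      enn2real (clock g x s) \<le> q ^ 4 * enn2real (clock g x' (l s))"
proof -
  note mono = slopes_strict_mono[where l = l and T = T, OF q T(1) l0 slopes]
  note cont = slopes_continuous[where l = l and T = T, OF q T(1) l0 slopes]
  note nonneg = slopes_nonneg[where l = l and T = T, OF q T(1) l0 slopes]
  interpret X: path_clock S g x by fact
  interpret Y: path_clock S g x' by fact
  \<comment> \<open>Every time before \<open>l T\<close> is \<open>l v\<close> for some
    \<open>v < T\<close>, which transfers the lower speed bound to \<open>x'\<close>.\<close>
  show m': "m / q \<le> g (the (x' u))" if u: "0 \<le> u" "u < l T" for u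
  proof -
    obtain v where v: "0 \<le> v" "v < T" "l v = u"
      by (rule slopes_surj[where l = l and T = T and a = 0 and b = T and v = u, OF q T(1) l0 slopes])
        (use u T l0 in \<open>auto intro: that\<close>)
    have "m \<le> q * g (the (x' u))"
      using m(2)[of v] near[of v] v by auto
    then show ?thesis
      using q by (simp add: field_simps)
  qed
  have mq: "0 < m / q"
    using m q by simp
  let ?a = "\<lambda>s. enn2real (clock g x s)" and ?a' = "\<lambda>s. enn2real (clock g x' (l s))"
  have ca: "continuous_on {0..T} ?a"
    by (rule X.real_clock_continuous[OF T(2) m])
  have ca': "continuous_on {0..T} ?a'"
  proof (rule continuous_on_compose2[OF Y.real_clock_continuous[OF lT mq m'] cont])
    show "l ` {0..T} \<subseteq> {0..l T}"
      using nonneg strict_mono_on_leD[OF mono] T by auto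
  qed
  have local: "\<exists>\<delta>>0. \<forall>r. s < r \<and> r < s + \<delta> \<and> r \<le> T \<longrightarrow>
      ?a' r - ?a' s \<le> q ^ 4 * (?a r - ?a s) \<and> ?a r - ?a s \<le> q ^ 4 * (?a' r - ?a' s)"
    if s: "0 \<le> s" "s < T" for s
  proof -
    have sx: "ereal s < explosion_time x"
      using s(2) T(2) by (meson less_ereal.simps(1) order_less_le_trans)
    define G where "G = g (the (x s))"
    have "0 < G"
      unfolding G_def using X.g_at_pos[OF s(1) sx] .
    have "\<forall>\<^sub>F u in at_right s. g (the (x u)) < q * G" "\<forall>\<^sub>F u in at_right s. G / q < g (the (x u))"
      using \<open>0 < G\<close> q
      by (intro order_tendstoD[OF X.g_at_right_continuous[OF s(1) sx]]; simp add: G_def field_simps)+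
    then have "\<forall>\<^sub>F u in at_right s. G / q < g (the (x u)) \<and> g (the (x u)) < q * G"
      by eventually_elim simp
    then obtain c where c: "s < c" "\<And>u. s < u \<Longrightarrow> u < c \<Longrightarrow> G / q < g (the (x u)) \<and> g (the (x u)) < q * G"
      by (rule eventually_at_right_realE) (rule that)
    have bounds: "G / q \<le> g (the (x u)) \<and> g (the (x u)) \<le> q * G" if "s \<le> u" "u < c" for u
    proof (cases "u = s")
      case True
      then show ?thesis
        using \<open>0 < G\<close> q by (simp add: G_def field_simps)
    next
      case False
      then show ?thesis
        using c(2)[of u] that by auto
    qed
    have "?a' r - ?a' s \<le> q ^ 4 * (?a r - ?a s) \<and> ?a r - ?a s \<le> q ^ 4 * (?a' r - ?a' s)"
      if r: "s < r" "r < c" "r \<le> T" for r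
    proof -
      have bounds': "G / q ^ 2 \<le> g (the (x' v)) \<and> g (the (x' v)) \<le> q ^ 2 * G" if v: "l s \<le> v" "v < l r" for v
      proof -
        obtain u where u: "s \<le> u" "u < r" "l u = v"
          by (rule slopes_surj[where l = l and T = T and a = s and b = r and v = v, OF q T(1) l0 slopes])
            (use s r v in \<open>auto intro: that\<close>)
        have "G \<le> q * g (the (x u))" "g (the (x u)) \<le> q * G"
          using bounds[of u] u r q by (auto simp: field_simps)
        moreover have "g (the (x u)) \<le> q * g (the (x' v))" "g (the (x' v)) \<le> q * g (the (x u))"
          using near[of u] u s r by auto
        moreover have "q * g (the (x u)) \<le> q * (q * g (the (x' v)))" "q * g (the (x u)) \<le> q * (q * G)"
          using calculation q by (auto intro!: mult_left_mono)
        ultimately have "G \<le> q ^ 2 * g (the (x' v))" "g (the (x' v)) \<le> q ^ 2 * G"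
          by (simp_all add: power2_eq_square)
        then show ?thesis
          using q by (simp add: field_simps)
      qed
      have Gq: "0 < G / q" "0 < q * G" "0 < G / q ^ 2" "0 < q ^ 2 * G"
        using \<open>0 < G\<close> q by simp_all
      have "?a r - ?a s \<le> (r - s) / (G / q)"
        by (rule X.real_clock_upper[OF T(2) m]) (use s r Gq bounds in auto)
      moreover have "(r - s) / (q * G) \<le> ?a r - ?a s"
        by (rule X.real_clock_lower[OF T(2) m]) (use s r Gq bounds in auto)
      moreover have lr: "0 \<le> l s" "l s \<le> l r" "l r \<le> l T"
        using nonneg strict_mono_on_leD[OF mono] s r by auto
      have "?a' r - ?a' s \<le> (l r - l s) / (G / q ^ 2)"
        by (rule Y.real_clock_upper[OF lT mq m']) (use lr Gq bounds' in auto)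
      moreover have "(l r - l s) / (q ^ 2 * G) \<le> ?a' r - ?a' s"
        by (rule Y.real_clock_lower[OF lT mq m']) (use lr Gq bounds' in auto)
      moreover have "(l r - l s) / (G / q ^ 2) \<le> q * (r - s) / (G / q ^ 2)"
        using slopes[of s r] s r Gq by (intro divide_right_mono) auto
      moreover have "(r - s) / q / (q ^ 2 * G) \<le> (l r - l s) / (q ^ 2 * G)"
        using slopes[of s r] s r Gq by (intro divide_right_mono) auto
      \<comment> \<open>Both directions lose the same four factors: one from the clock of
        \<open>x\<close>, two from that of \<open>x'\<close> and one from \<open>l\<close>.\<close>
      moreover have "q * (r - s) / (G / q ^ 2) = q ^ 4 * ((r - s) / (q * G))"
        "(r - s) / (G / q) = q ^ 4 * ((r - s) / q / (q ^ 2 * G))"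
        using \<open>0 < G\<close> q by (simp_all add: field_simps power2_eq_square power4_eq_xxxx)
      moreover have "q ^ 4 * ((r - s) / (q * G)) \<le> q ^ 4 * (?a r - ?a s)"
        using calculation(2) q by (intro mult_left_mono) auto
      moreover have "q ^ 4 * ((r - s) / q / (q ^ 2 * G)) \<le> q ^ 4 * (?a' r - ?a' s)"
        using calculation q by (intro mult_left_mono) auto
      ultimately show ?thesis
        by linarith
    qed
    then show ?thesis
      using c(1) by (intro exI[of _ "c - s"]) auto
  qed
  show "?a' s \<le> q ^ 4 * ?a s \<and> ?a s \<le> q ^ 4 * ?a' s" if s: "0 \<le> s" "s \<le> T" for s
  proof
    have sub: "continuous_on {0..s} ?a" "continuous_on {0..s} ?a'"
      using continuous_on_subset[OF ca, of "{0..s}"] continuous_on_subset[OF ca', of "{0..s}"] s by auto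
    have "?a' s - q ^ 4 * ?a s \<le> ?a' 0 - q ^ 4 * ?a 0"
    proof (rule locally_decreasing_imp_le[OF s(1)])
      show "continuous_on {0..s} (\<lambda>s. ?a' s - q ^ 4 * ?a s)"
        using sub by (intro continuous_intros)
      fix r assume "0 \<le> r" "r < s"
      then obtain \<delta> where "\<delta> > 0" "\<forall>u. r < u \<and> u < r + \<delta> \<and> u \<le> T \<longrightarrow> ?a' u - ?a' r \<le> q ^ 4 * (?a u - ?a r)"
        using local[of r] s by force
      then show "\<exists>\<delta>>0. \<forall>u. r < u \<and> u < r + \<delta> \<and> u \<le> s \<longrightarrow> ?a' u - q ^ 4 * ?a u \<le> ?a' r - q ^ 4 * ?a r"
        using s by (intro exI[of _ \<delta>]) (auto simp: right_diff_distrib)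
    qed
    then show "?a' s \<le> q ^ 4 * ?a s"
      by (simp add: l0)
    have "?a s - q ^ 4 * ?a' s \<le> ?a 0 - q ^ 4 * ?a' 0"
    proof (rule locally_decreasing_imp_le[OF s(1)])
      show "continuous_on {0..s} (\<lambda>s. ?a s - q ^ 4 * ?a' s)"
        using sub by (intro continuous_intros)
      fix r assume "0 \<le> r" "r < s"
      then obtain \<delta> where "\<delta> > 0" "\<forall>u. r < u \<and> u < r + \<delta> \<and> u \<le> T \<longrightarrow> ?a u - ?a r \<le> q ^ 4 * (?a' u - ?a' r)"
        using local[of r] s by force
      then show "\<exists>\<delta>>0. \<forall>u. r < u \<and> u < r + \<delta> \<and> u \<le> s \<longrightarrow> ?a u - q ^ 4 * ?a' u \<le> ?a r - q ^ 4 * ?a' r"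
        using s by (intro exI[of _ \<delta>]) (auto simp: right_diff_distrib)
    qed
    then show "?a s \<le> q ^ 4 * ?a' s"
      by (simp add: l0)
  qed
qed

section \<open>From local to global convergence\<close>

text \<open>The comparison of clocks gives \<open>u \<le> q ^ 4 * \<mu> u\<close> and
  \<open>\<mu> u \<le> q ^ 4 * u\<close> up to \<open>A\<close>, hence a displacement of at most
  \<open>(q ^ 4 - 1) * A\<close>. A translation after \<open>A\<close> keeps the displacement
  reached there.\<close>

lemma conjugate_homeomorphism:
  fixes q T m :: real
  assumes X: "path_clock S g x" and Y: "path_clock S g x'"
    and q: "1 < q" and T: "0 \<le> T" "ereal T \<le> explosion_time x"
    and l0: "l 0 = 0"
    and slopes: "\<And>r s. 0 \<le> r \<Longrightarrow> r \<le> s \<Longrightarrow> s \<le> T \<Longrightarrow> (s - r) / q \<le> l s - l r \<and> l s - l r \<le> q * (s - r)"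
    and lT: "ereal (l T) \<le> explosion_time x'"
    and m: "0 < m" "\<And>s. 0 \<le> s \<Longrightarrow> s < T \<Longrightarrow> m \<le> g (the (x s))"
    and near: "\<And>s. 0 \<le> s \<Longrightarrow> s < T \<Longrightarrow>
      g (the (x s)) \<le> q * g (the (x' (l s))) \<and> g (the (x' (l s))) \<le> q * g (the (x s))"
  defines "A \<equiv> enn2real (clock g x T)" and "A' \<equiv> enn2real (clock g x' (l T))"
  obtains \<mu> where "\<mu> \<in> increasing_homeomorphisms"
    "\<And>u. 0 \<le> u \<Longrightarrow> u < A \<Longrightarrow> \<exists>s. 0 \<le> s \<and> s < T \<and> time_change g x u = x s \<and> time_change g x' (\<mu> u) = x' (l s)"
    "\<And>u. A \<le> u \<Longrightarrow> \<mu> u = A' + (u - A)"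
    "\<And>u. 0 \<le> u \<Longrightarrow> \<bar>\<mu> u - u\<bar> \<le> (q ^ 4 - 1) * A"
    "clock g x T = ennreal A" "clock g x' (l T) = ennreal A'"
proof -
  have mono: "strict_mono_on {0..T} l"
    by (rule slopes_strict_mono[OF q T(1) l0 slopes])
  have cont: "continuous_on {0..T} l"
    by (rule slopes_continuous[OF q T(1) l0 slopes])
  interpret X: path_clock S g x by fact
  interpret Y: path_clock S g x' by fact
  have m': "m / q \<le> g (the (x' u))" if "0 \<le> u" "u < l T" for u
    by (rule clock_comparison(1)[OF X Y q T l0 slopes lT m near that])
  have comparison: "enn2real (clock g x' (l s)) \<le> q ^ 4 * enn2real (clock g x s) \<and>
      enn2real (clock g x s) \<le> q ^ 4 * enn2real (clock g x' (l s))" if "0 \<le> s" "s \<le> T" for s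
    by (rule clock_comparison(2)[OF X Y q T l0 slopes lT m near that])
  have mq: "0 < m / q"
    using m q by simp
  define a where "a s = enn2real (clock g x s)" for s
  define a' where "a' s = enn2real (clock g x' s)" for s
  have a_cont: "continuous_on {0..T} a" and a_mono: "strict_mono_on {0..T} a"
    unfolding a_def using X.real_clock_continuous[OF T(2) m] X.real_clock_strict_mono[OF T(2) m] by auto
  have a'_cont: "continuous_on {0..l T} a'" and a'_mono: "strict_mono_on {0..l T} a'"
    unfolding a'_def using Y.real_clock_continuous[OF lT mq m'] Y.real_clock_strict_mono[OF lT mq m'] by auto
  have a0: "a 0 = 0" "a' 0 = 0"
    by (simp_all add: a_def a'_def)
  have A: "a T = A" "a' (l T) = A'"
    by (simp_all add: a_def a'_def A_def A'_def)
  have A_nonneg: "0 \<le> A"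
    by (simp add: A_def)
  have image: "a ` {0..T} = {0..A}"
  proof (intro equalityI subsetI)
    fix u assume "u \<in> a ` {0..T}"
    then obtain s where s: "0 \<le> s" "s \<le> T" "u = a s"
      by auto
    then show "u \<in> {0..A}"
      using strict_mono_on_leD[OF a_mono, of 0 s] strict_mono_on_leD[OF a_mono, of s T] A a0 by simp
  next
    fix u assume u: "u \<in> {0..A}"
    then obtain s where "0 \<le> s" "s \<le> T" "a s = u"
      using IVT'[of a 0 u T] a_cont T A a0 by auto
    then show "u \<in> a ` {0..T}"
      by auto
  qed
  obtain b where b: "homeomorphism {0..T} {0..A} a b"
    using homeomorphism_compact[OF _ a_cont image strict_mono_on_imp_inj_on[OF a_mono]] by auto
  then have b_cont: "continuous_on {0..A} b" and ba: "\<And>s. s \<in> {0..T} \<Longrightarrow> b (a s) = s"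
    by (auto simp: homeomorphism_def)
  \<comment> \<open>With a translation after \<open>A\<close>, the time elapsed since
    \<open>A\<close> equals the time elapsed since \<open>A'\<close>; the explosive case relies on
    this.\<close>
  define \<mu> where "\<mu> u = (if u \<le> A then a' (l (b u)) else A' + (u - A))" for u
  have \<mu>_a: "\<mu> (a s) = a' (l s)" if "0 \<le> s" "s \<le> T" for s
    using that ba[of s] strict_mono_on_leD[OF a_mono, of s T] T by (simp add: \<mu>_def A)
  have \<mu>_after: "\<mu> u = A' + (u - A)" if "A \<le> u" for u
  proof (cases "u = A")
    case True
    then show ?thesis
      using \<mu>_a[of T] T A by simp
  qed (use that in \<open>simp add: \<mu>_def\<close>)
  have preimage: "\<exists>s. 0 \<le> s \<and> s \<le> T \<and> a s = u" if "0 \<le> u" "u \<le> A" for u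
  proof -
    have "u \<in> a ` {0..T}"
      using that by (simp add: image)
    then show ?thesis
      by auto
  qed
  have l_range: "0 \<le> l s" "l s \<le> l T" if "0 \<le> s" "s \<le> T" for s
    using strict_mono_on_leD[OF mono, of 0 s] strict_mono_on_leD[OF mono, of s T] that T l0 by auto
  have mono1: "\<mu> u < \<mu> v" if uv: "0 \<le> u" "u < v" "v \<le> A" for u v
  proof -
    obtain s where s: "0 \<le> s" "s \<le> T" "a s = u"
      using preimage[of u] uv by auto
    obtain r where r: "0 \<le> r" "r \<le> T" "a r = v"
      using preimage[of v] uv by auto
    have "s < r"
      using strict_mono_on_leD[OF a_mono, of r s] s r uv by fastforce
    then have "l s < l r"
      using strict_mono_onD[OF mono, of s r] s r by simp
    then have "a' (l s) < a' (l r)"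
      using strict_mono_onD[OF a'_mono, of "l s" "l r"] l_range s r by simp
    then show ?thesis
      using \<mu>_a s r by auto
  qed
  have "\<mu> \<in> increasing_homeomorphisms"
  proof (rule increasing_homeomorphismsI)
    show "strict_mono_on {0..} \<mu>"
    proof (rule strict_mono_onI)
      fix u v :: real assume uv: "u \<in> {0..}" "v \<in> {0..}" "u < v"
      consider "v \<le> A" | "A \<le> u" | "u < A" "A < v"
        by linarith
      then show "\<mu> u < \<mu> v"
      proof cases
        case 1
        then show ?thesis
          using mono1 uv by simp
      next
        case 2
        then show ?thesis
          using \<mu>_after[of u] \<mu>_after[of v] uv by simp
      next
        case 3
        then show ?thesis
          using mono1[of u A] \<mu>_after[of A] \<mu>_after[of v] uv by simp
      qed
    qed
    show "continuous_on {0..} \<mu>"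
      unfolding \<mu>_def
    proof (rule continuous_on_cases_le[where h = "\<lambda>u. u"])
      have "{t \<in> {0..}. t \<le> A} = {0..A}"
        by auto
      moreover have "continuous_on {0..A} (\<lambda>u. a' (l (b u)))"
      proof (rule continuous_on_compose2[OF a'_cont])
        have "b ` {0..A} = {0..T}"
          using b by (simp add: homeomorphism_def)
        then show "continuous_on {0..A} (\<lambda>u. l (b u))"
          by (intro continuous_on_compose2[OF cont b_cont]) simp
        show "(\<lambda>u. l (b u)) ` {0..A} \<subseteq> {0..l T}"
        proof
          fix w assume "w \<in> (\<lambda>u. l (b u)) ` {0..A}"
          then obtain u where u: "u \<in> {0..A}" "w = l (b u)"
            by blast
          have "b u \<in> {0..T}"
            using u(1) \<open>b ` {0..A} = {0..T}\<close> by blast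
          then show "w \<in> {0..l T}"
            using l_range[of "b u"] u(2) by simp
        qed
      qed
      ultimately show "continuous_on {t \<in> {0..}. t \<le> A} (\<lambda>u. a' (l (b u)))"
        by simp
      show "a' (l (b u)) = A' + (u - A)" if "u \<in> {0..}" "u = A" for u
        using \<mu>_after[of A] that by (simp add: \<mu>_def)
    qed (auto intro!: continuous_intros)
    show "\<mu> 0 = 0"
      using \<mu>_a[of 0] T a0 l0 by simp
    show "\<exists>s\<ge>0. y \<le> \<mu> s" for y
    proof (intro exI[of _ "A + \<bar>y - A'\<bar>"] conjI)
      show "y \<le> \<mu> (A + \<bar>y - A'\<bar>)"
        by (subst \<mu>_after) auto
    qed (use A_nonneg in auto)
  qed
  moreover have "\<exists>s. 0 \<le> s \<and> s < T \<and> time_change g x u = x s \<and> time_change g x' (\<mu> u) = x' (l s)"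
    if u: "0 \<le> u" "u < A" for u
  proof -
    obtain s where s: "0 \<le> s" "s \<le> T" "a s = u"
      using preimage[of u] u by auto
    have "s \<noteq> T"
      using s u A by auto
    have "time_change g x u = x s"
    proof (rule X.time_change_at_clock)
      show "clock g x s = ennreal u"
        using X.clock_eq[OF T(2) m s(1,2)] s(3) by (simp add: a_def)
      show "ereal s \<le> explosion_time x"
        using s(2) T(2) by (meson ereal_less_eq(3) order_trans)
    qed fact
    moreover have "time_change g x' (\<mu> u) = x' (l s)"
    proof (rule Y.time_change_at_clock)
      show "clock g x' (l s) = ennreal (\<mu> u)"
        using Y.clock_eq[OF lT mq m' l_range[OF s(1,2)]] \<mu>_a[OF s(1,2)] s(3) by (simp add: a'_def)
      show "ereal (l s) \<le> explosion_time x'"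
        using l_range(2)[OF s(1,2)] lT by (meson ereal_less_eq(3) order_trans)
    qed (rule l_range(1)[OF s(1,2)])
    ultimately show ?thesis
      using s \<open>s \<noteq> T\<close> by (intro exI[of _ s]) auto
  qed
  moreover have "\<bar>\<mu> u - u\<bar> \<le> (q ^ 4 - 1) * A" if "0 \<le> u" for u
  proof -
    have "1 \<le> q ^ 4"
      using q by (intro one_le_power) auto
    have small: "\<bar>\<mu> u - u\<bar> \<le> (q ^ 4 - 1) * A" if u: "0 \<le> u" "u \<le> A" for u
    proof -
      obtain s where s: "0 \<le> s" "s \<le> T" "a s = u"
        using preimage[of u] u by auto
      have "a' (l s) \<le> q ^ 4 * u" "u \<le> q ^ 4 * a' (l s)"
        using comparison[OF s(1,2)] s(3) by (auto simp: a_def a'_def)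
      then have c: "\<mu> u \<le> q ^ 4 * u" "u \<le> q ^ 4 * \<mu> u"
        using \<mu>_a[OF s(1,2)] s(3) by auto
      have "\<mu> u - u \<le> (q ^ 4 - 1) * u"
        using c by (simp add: left_diff_distrib)
      moreover have "u - \<mu> u \<le> (q ^ 4 - 1) * u"
      proof (cases "\<mu> u \<le> u")
        case True
        then have "(q ^ 4 - 1) * \<mu> u \<le> (q ^ 4 - 1) * u"
          using \<open>1 \<le> q ^ 4\<close> by (intro mult_left_mono) auto
        then show ?thesis
          using c by (simp add: left_diff_distrib)
      next
        case False
        then show ?thesis
          using u \<open>1 \<le> q ^ 4\<close> by (auto intro: order_trans[of _ 0])
      qed
      moreover have "(q ^ 4 - 1) * u \<le> (q ^ 4 - 1) * A"
        using u \<open>1 \<le> q ^ 4\<close> by (intro mult_left_mono) auto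
      ultimately show ?thesis
        by linarith
    qed
    show ?thesis
    proof (cases "u \<le> A")
      case True
      then show ?thesis
        using small that by simp
    next
      case False
      then have "\<mu> u - u = \<mu> A - A"
        using \<mu>_after[of u] \<mu>_after[of A] by simp
      then show ?thesis
        using small[of A] A_nonneg by simp
    qed
  qed
  moreover have "clock g x T = ennreal A"
    unfolding A_def by (rule X.clock_eq[OF T(2) m]) (use T in auto)
  moreover have "clock g x' (l T) = ennreal A'"
    unfolding A'_def by (rule Y.clock_eq[OF lT mq m']) (use l_range[OF T(1)] in auto)
  ultimately show thesis
    using \<mu>_after by (intro that[of \<mu>]) simp_all
qed

section \<open>Construction of slow speeds near the cemetery\<close>

context skorokhod_metrics
begin

text \<open>A path that leaves every compact set spends, for each \<open>n\<close>, some interval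
  within \<open>1 / Suc n\<close> of the cemetery. A small enough speed there makes its clock gain
  \<open>Suc n\<close>. The claim covers all speeds below \<open>g\<close>, so that speeds with
  different tasks can be combined by a minimum.\<close>

lemma exists_speed_unbounded_clock:
  assumes ys: "\<And>k::nat. ys k \<in> D_exp S"
  obtains g where "continuous_map S (top_of_set {0<..}) g"
    "\<forall>h k t. continuous_map S (top_of_set {0<..}) h \<longrightarrow> (\<forall>p\<in>topspace S. h p \<le> g p) \<longrightarrow>
      \<not> relatively_compact_in S (visited (ys k)) \<longrightarrow>
      (\<exists>s\<ge>0. ereal s < explosion_time (ys k) \<and> ennreal t \<le> clock h (ys k) s)"
proof -
  \<comment> \<open>The restriction \<open>k \<le> n\<close> leaves finitely many pairs with
    \<open>1 / Suc n\<close> above a given level, although all paths are treated at once.\<close>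
  define I where "I = {(k, n). k \<le> n \<and> \<not> relatively_compact_in S (visited (ys k))}"
  have const: "continuous_map S (top_of_set {0<..}) (\<lambda>_. 1::real)"
    by (simp add: continuous_map_in_subtopology)
  have "\<exists>s b. 0 \<le> s \<and> s < b \<and> ereal b < explosion_time (ys k) \<and>
      (\<forall>u. s \<le> u \<longrightarrow> u < b \<longrightarrow> dist_cemetery (the (ys k u)) \<le> 1 / real (Suc n))"
    if nrc: "\<not> relatively_compact_in S (visited (ys k))" for k n
  proof -
    interpret path_clock S "\<lambda>_. 1" "ys k"
      by (rule path_clockI[OF ys const])
    obtain s where s: "0 \<le> s" "ereal s < explosion_time (ys k)" "dist_cemetery (the (ys k s)) < 1 / real (Suc n)"
      by (rule path_leaves_compacts[OF path_clock_axioms nrc, of "1 / real (Suc n)"]) (auto intro: that)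
    let ?U = "{p \<in> topspace S. dist_cemetery p \<in> {..<1 / real (Suc n)}}"
    have "openin S ?U"
      by (rule openin_continuous_map_preimage[OF continuous_dist_cemetery]) simp
    moreover have "the (ys k s) \<in> ?U"
      using s alive(1) by simp
    ultimately obtain c where "s < c" "ereal c < explosion_time (ys k)"
      "\<And>r. s \<le> r \<Longrightarrow> r < c \<Longrightarrow> the (ys k r) \<in> ?U"
      by (rule right_nbhd[OF s(1,2)]) (rule that)
    then show ?thesis
      using s(1) by (intro exI[of _ s] exI[of _ c]) (auto intro: less_imp_le)
  qed
  then have "\<forall>i\<in>I. \<exists>sb. 0 \<le> fst sb \<and> fst sb < snd sb \<and> ereal (snd sb) < explosion_time (ys (fst i)) \<and>
      (\<forall>u. fst sb \<le> u \<longrightarrow> u < snd sb \<longrightarrow> dist_cemetery (the (ys (fst i) u)) \<le> 1 / real (Suc (snd i)))"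
    by (auto simp: I_def)
  from bchoice[OF this] obtain f where f: "\<And>i. i \<in> I \<Longrightarrow> 0 \<le> fst (f i)" "\<And>i. i \<in> I \<Longrightarrow> fst (f i) < snd (f i)"
    "\<And>i. i \<in> I \<Longrightarrow> ereal (snd (f i)) < explosion_time (ys (fst i))"
    "\<And>i u. i \<in> I \<Longrightarrow> fst (f i) \<le> u \<Longrightarrow> u < snd (f i) \<Longrightarrow> dist_cemetery (the (ys (fst i) u)) \<le> 1 / real (Suc (snd i))"
    by blast
  \<comment> \<open>At this speed, crossing the chosen interval takes \<open>Suc (snd i)\<close>
    units of clock time.\<close>
  define \<beta> where "\<beta> i = (snd (f i) - fst (f i)) / real (Suc (snd i))" for i
  obtain g where g: "continuous_map S (top_of_set {0<..}) g"
    "\<And>i p. i \<in> I \<Longrightarrow> p \<in> topspace S \<Longrightarrow> dist_cemetery p \<le> 1 / real (Suc (snd i)) \<Longrightarrow> g p \<le> \<beta> i"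
  proof (rule exists_slow_speed[of I \<beta> "\<lambda>i. 1 / real (Suc (snd i))"])
    show "0 < \<beta> i" if "i \<in> I" for i
      using f(2)[OF that] by (simp add: \<beta>_def)
    fix e :: real assume "0 < e"
    obtain N :: nat where N: "1 / e \<le> real N"
      using real_arch_simple by blast
    have "{i \<in> I. e \<le> 1 / real (Suc (snd i))} \<subseteq> {..N} \<times> {..N}"
    proof
      fix i assume i: "i \<in> {i \<in> I. e \<le> 1 / real (Suc (snd i))}"
      then have "real (Suc (snd i)) \<le> 1 / e"
        using \<open>0 < e\<close> by (simp add: field_simps)
      then have "snd i \<le> N"
        using N by simp
      then show "i \<in> {..N} \<times> {..N}"
        using i by (auto simp: I_def)
    qed
    then show "finite {i \<in> I. e \<le> 1 / real (Suc (snd i))}"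
      by (rule finite_subset) simp
  qed (rule that)
  show thesis
  proof (rule that[OF g(1)], intro allI impI)
    fix h k t
    assume h: "continuous_map S (top_of_set {0<..}) h" "\<forall>p\<in>topspace S. h p \<le> g p"
      and nrc: "\<not> relatively_compact_in S (visited (ys k))"
    interpret path_clock S h "ys k"
      by (rule path_clockI[OF ys h(1)])
    obtain N :: nat where N: "t \<le> real N"
      using real_arch_simple by blast
    define n where "n = max k N"
    define i where "i = (k, n)"
    have i: "i \<in> I" "fst i = k" "snd i = n"
      using nrc by (auto simp: i_def I_def n_def)
    define s b where "s = fst (f i)" and "b = snd (f i)"
    have sb: "0 \<le> s" "s < b" "ereal b < explosion_time (ys k)"
      using f(1-3)[OF i(1)] i(2) by (simp_all add: s_def b_def)
    have "clock h (ys k) s + ennreal ((b - s) / \<beta> i) \<le> clock h (ys k) b"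
    proof (rule clock_lower)
      show "g_at u \<le> \<beta> i" if u: "s \<le> u" "u < b" for u
      proof -
        have "ereal u < explosion_time (ys k)"
          using u(2) sb(3) by (meson less_ereal.simps(1) less_trans)
        then have "the (ys k u) \<in> topspace S"
          using alive(1) u(1) sb(1) by simp
        moreover have "dist_cemetery (the (ys k u)) \<le> 1 / real (Suc (snd i))"
          using f(4)[OF i(1), of u] u i(2) by (simp add: s_def b_def)
        ultimately show ?thesis
          using g(2)[OF i(1), of "the (ys k u)"] h(2) by (blast intro: order_trans)
      qed
      show "0 < \<beta> i"
        using sb by (simp add: \<beta>_def s_def b_def)
    qed (use sb in auto)
    moreover have "(b - s) / \<beta> i = real (Suc n)"
      using sb by (simp add: \<beta>_def s_def b_def i(3) del: of_nat_Suc)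
    ultimately have "clock h (ys k) s + ennreal (real (Suc n)) \<le> clock h (ys k) b"
      by (simp only:)
    moreover have "ennreal t \<le> ennreal (real (Suc n))"
      using N by (intro ennreal_leI) (simp add: n_def)
    moreover have "ennreal (real (Suc n)) \<le> clock h (ys k) s + ennreal (real (Suc n))"
      by (rule add_increasing) simp_all
    ultimately have "ennreal t \<le> clock h (ys k) b"
      by (blast intro: order_trans)
    then show "\<exists>s\<ge>0. ereal s < explosion_time (ys k) \<and> ennreal t \<le> clock h (ys k) s"
      using sb by (intro exI[of _ b]) simp
  qed
qed

end

lemma exists_power4_near_1:
  fixes A e :: real
  assumes "0 < e"
  obtains q where "1 < q" "(q ^ 4 - 1) * A \<le> e"
proof -
  have "((\<lambda>q::real. (q ^ 4 - 1) * A) \<longlongrightarrow> (1 ^ 4 - 1) * A) (at_right 1)"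
    by (intro tendsto_intros)
  then have "\<forall>\<^sub>F q in at_right 1. (q ^ 4 - 1) * A < e"
    by (rule order_tendstoD) (use assms in simp)
  then obtain c where c: "1 < c" "\<And>q. 1 < q \<Longrightarrow> q < c \<Longrightarrow> (q ^ 4 - 1) * A < e"
    by (rule eventually_at_right_realE) (rule that)
  show thesis
    by (rule that[of "(1 + c) / 2"]) (use c(1) c(2)[of "(1 + c) / 2"] in auto)
qed

context skorokhod_metrics
begin

text \<open>If \<open>zs k\<close> is alive at \<open>r k\<close>, it stays within twice its
  distance to the cemetery until some later \<open>b k\<close>. A small enough speed there stretches
  this stay to more than \<open>k\<close> units of the new time, so any fixed horizon is eventually
  covered.\<close>

lemma exists_speed_staying_near_cemetery:
  assumes zs: "\<And>k::nat. zs k \<in> D_exp S" and r: "\<And>k. 0 \<le> r k"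
    and lim: "limitin (Alexandroff_compactification S) (\<lambda>k. zs k (r k)) None sequentially"
  obtains g where "continuous_map S (top_of_set {0<..}) g"
    "\<forall>h e. continuous_map S (top_of_set {0<..}) h \<longrightarrow> (\<forall>p\<in>topspace S. h p \<le> g p) \<longrightarrow> 0 < e \<longrightarrow>
      (\<forall>\<^sub>F k in sequentially. \<forall>a w. ereal (r k) \<le> explosion_time (zs k) \<longrightarrow> clock h (zs k) (r k) = ennreal a \<longrightarrow>
        0 \<le> a \<longrightarrow> 0 \<le> w \<longrightarrow> w \<le> real k \<longrightarrow> mdist d\<^sub>\<Delta> None (time_change h (zs k) (a + w)) \<le> e)"
proof -
  interpret E: Metric_space "mspace d\<^sub>\<Delta>" "mdist d\<^sub>\<Delta>"
    by simp
  have top: "E.mtopology = Alexandroff_compactification S"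
    using d\<^sub>\<Delta> by (simp add: mtopology_of_def)
  define I where "I = {k. zs k (r k) \<noteq> None}"
  define D where "D k = dist_cemetery (the (zs k (r k)))" for k
  have D_small: "\<forall>\<^sub>F k in sequentially. k \<in> I \<longrightarrow> D k < e" if "0 < e" for e
  proof -
    have "None \<in> mspace d\<^sub>\<Delta>"
      by (simp add: mspace_d\<^sub>\<Delta>)
    then have "None \<in> E.mball None e"
      using \<open>0 < e\<close> by (simp only: E.centre_in_mball_iff)
    moreover have "openin (Alexandroff_compactification S) (E.mball None e)"
      unfolding top[symmetric] by (rule E.openin_mball)
    ultimately have "\<forall>\<^sub>F k in sequentially. zs k (r k) \<in> E.mball None e"
      using lim unfolding limitin_def by blast
    then show ?thesis
      by (rule eventually_mono) (auto simp: I_def D_def E.commute)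
  qed
  have const: "continuous_map S (top_of_set {0<..}) (\<lambda>_. 1::real)"
    by (simp add: continuous_map_in_subtopology)
  have alive_I: "ereal (r k) < explosion_time (zs k)" if "k \<in> I" for k
    using path_clock.alive_iff[OF path_clockI[OF zs const] r] that by (simp add: I_def)
  have "\<exists>b. r k < b \<and> ereal b < explosion_time (zs k) \<and>
      (\<forall>u. r k \<le> u \<longrightarrow> u \<le> b \<longrightarrow> dist_cemetery (the (zs k u)) \<le> 2 * D k)" if kI: "k \<in> I" for k
  proof -
    interpret path_clock S "\<lambda>_. 1" "zs k"
      by (rule path_clockI[OF zs const])
    note rk = r[of k] alive_I[OF kI]
    let ?U = "{p \<in> topspace S. dist_cemetery p \<in> {..<2 * D k}}"
    have "openin S ?U"
      by (rule openin_continuous_map_preimage[OF continuous_dist_cemetery]) simp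
    moreover have "the (zs k (r k)) \<in> ?U"
      using alive(1)[OF rk] dist_cemetery_pos[OF alive(1)[OF rk]] by (simp add: D_def)
    ultimately obtain c where c: "r k < c" "ereal c < explosion_time (zs k)"
      "\<And>u. r k \<le> u \<Longrightarrow> u < c \<Longrightarrow> the (zs k u) \<in> ?U"
      by (rule right_nbhd[OF rk]) (rule that)
    show ?thesis
    \<comment> \<open>The midpoint puts the whole closed interval inside the neighbourhood; the time
      later returned by \<open>clock_surj\<close> may equal its right end.\<close>
    proof (intro exI[of _ "(r k + c) / 2"] conjI allI impI)
      have "ereal ((r k + c) / 2) \<le> ereal c"
        using c(1) by simp
      then show "ereal ((r k + c) / 2) < explosion_time (zs k)"
        using c(2) by (rule le_less_trans)
      show "dist_cemetery (the (zs k u)) \<le> 2 * D k" if "r k \<le> u" "u \<le> (r k + c) / 2" for u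
        using c(3)[of u] that c(1) by auto
    qed (use c(1) in simp)
  qed
  then have "\<forall>k\<in>I. \<exists>b. r k < b \<and> ereal b < explosion_time (zs k) \<and>
      (\<forall>u. r k \<le> u \<longrightarrow> u \<le> b \<longrightarrow> dist_cemetery (the (zs k u)) \<le> 2 * D k)"
    by blast
  from bchoice[OF this] obtain b where b: "\<And>k. k \<in> I \<Longrightarrow> r k < b k"
    "\<And>k. k \<in> I \<Longrightarrow> ereal (b k) < explosion_time (zs k)"
    "\<And>k u. k \<in> I \<Longrightarrow> r k \<le> u \<Longrightarrow> u \<le> b k \<Longrightarrow> dist_cemetery (the (zs k u)) \<le> 2 * D k"
    by blast
  define \<beta> where "\<beta> k = (b k - r k) / real (Suc k)" for k
  obtain g where g: "continuous_map S (top_of_set {0<..}) g"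
    "\<And>k p. k \<in> I \<Longrightarrow> p \<in> topspace S \<Longrightarrow> dist_cemetery p \<le> 2 * D k \<Longrightarrow> g p \<le> \<beta> k"
  proof (rule exists_slow_speed[of I \<beta> "\<lambda>k. 2 * D k"])
    show "0 < \<beta> k" if "k \<in> I" for k
      using b(1)[OF that] by (simp add: \<beta>_def)
    fix e :: real assume "0 < e"
    \<comment> \<open>The distances tend to 0 along \<open>I\<close>, so only finitely many of them
      exceed a given level.\<close>
    then have "\<forall>\<^sub>F k in sequentially. k \<in> I \<longrightarrow> D k < e / 2"
      by (intro D_small) simp
    then have "finite {k. \<not> (k \<in> I \<longrightarrow> D k < e / 2)}"
      by (simp add: cofinite_eq_sequentially[symmetric] eventually_cofinite)
    then show "finite {k \<in> I. e \<le> 2 * D k}"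
      by (rule rev_finite_subset) auto
  qed (rule that)
  show thesis
  proof (rule that[OF g(1)], intro allI impI)
    fix h e
    assume h: "continuous_map S (top_of_set {0<..}) h" "\<forall>p\<in>topspace S. h p \<le> g p"
      and "0 < (e::real)"
    have "\<forall>\<^sub>F k in sequentially. k \<in> I \<longrightarrow> D k < e / 2"
      using \<open>0 < e\<close> by (intro D_small) simp
    then show "\<forall>\<^sub>F k in sequentially. \<forall>a w. ereal (r k) \<le> explosion_time (zs k) \<longrightarrow> clock h (zs k) (r k) = ennreal a \<longrightarrow>
        0 \<le> a \<longrightarrow> 0 \<le> w \<longrightarrow> w \<le> real k \<longrightarrow> mdist d\<^sub>\<Delta> None (time_change h (zs k) (a + w)) \<le> e"
    proof (rule eventually_mono, intro allI impI)
      fix k a w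
      assume Dk: "k \<in> I \<longrightarrow> D k < e / 2" and rx: "ereal (r k) \<le> explosion_time (zs k)"
        and a: "clock h (zs k) (r k) = ennreal a" "0 \<le> a" and w: "0 \<le> w" "w \<le> real k"
      interpret path_clock S h "zs k"
        by (rule path_clockI[OF zs h(1)])
      show "mdist d\<^sub>\<Delta> None (time_change h (zs k) (a + w)) \<le> e"
      proof (cases "k \<in> I")
        case False
        \<comment> \<open>A path dead at \<open>r k\<close>, with \<open>r k\<close> no later than
          its explosion, explodes exactly at \<open>r k\<close>; the time-changed path is then dead
          from \<open>a\<close> on.\<close>
        then have "explosion_time (zs k) \<le> ereal (r k)"
          using alive_iff[OF r[of k]] by (simp add: I_def not_less)
        then have "explosion_time (zs k) = ereal (r k)"
          using rx by simp
        then have "time_change h (zs k) (a + w) = None"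
          using w(1) by (intro time_change_after_explosion[OF _ a(1)]) auto
        moreover have "None \<in> mspace d\<^sub>\<Delta>"
          by (simp add: mspace_d\<^sub>\<Delta>)
        ultimately show ?thesis
          using \<open>0 < e\<close> by simp
      next
        case True
        note bk = b(1,2)[OF True]
        have "clock h (zs k) (r k) + ennreal ((b k - r k) / \<beta> k) \<le> clock h (zs k) (b k)"
        proof (rule clock_lower)
          show "g_at u \<le> \<beta> k" if u: "r k \<le> u" "u < b k" for u
          proof -
            have "ereal u < ereal (b k)"
              using u(2) by simp
            then have "ereal u < explosion_time (zs k)"
              using bk(2) by (rule less_trans)
            then have "the (zs k u) \<in> topspace S"
              using alive(1) u(1) r[of k] by simp
            moreover have "dist_cemetery (the (zs k u)) \<le> 2 * D k"
              using b(3)[OF True, of u] u by simp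
            ultimately show ?thesis
              using g(2)[OF True, of "the (zs k u)"] h(2) by (blast intro: order_trans)
          qed
          show "0 < \<beta> k"
            using bk by (simp add: \<beta>_def)
        qed (use bk r in auto)
        moreover have "(b k - r k) / \<beta> k = real (Suc k)"
          using bk by (simp add: \<beta>_def del: of_nat_Suc)
        ultimately have "ennreal a + ennreal (real (Suc k)) \<le> clock h (zs k) (b k)"
          using a by simp
        moreover have "ennreal (a + w) \<le> ennreal (a + real (Suc k))"
          using w by (intro ennreal_leI) simp
        moreover have "ennreal (a + real (Suc k)) = ennreal a + ennreal (real (Suc k))"
          using a(2) by (intro ennreal_plus) simp_all
        ultimately have "ennreal (a + w) \<le> clock h (zs k) (b k)"
          by (metis order_trans)
        moreover have "0 \<le> b k" "0 \<le> a + w"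
          using bk(1) r[of k] a w by auto
        ultimately obtain s where s: "0 \<le> s" "s \<le> b k" "clock h (zs k) s = ennreal (a + w)"
          "time_change h (zs k) (a + w) = zs k s"
          using clock_surj[OF _ bk(2)] by blast
        have "r k \<le> s"
        proof (rule ccontr)
          assume "\<not> r k \<le> s"
          then have "clock h (zs k) s < clock h (zs k) (r k)"
            using s(1,3) rx by (intro clock_strict_mono) auto
          then show False
            using s(3) a w by (simp add: ennreal_less_iff)
        qed
        then have "dist_cemetery (the (zs k s)) \<le> e"
          using b(3)[OF True, of s] s(2) Dk True by simp
        moreover have "zs k s = Some (the (zs k s))"
        proof (rule alive(2)[OF s(1)])
          have "ereal s \<le> ereal (b k)"
            using s(2) by simp
          then show "ereal s < explosion_time (zs k)"
            using bk(2) by (rule le_less_trans)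
        qed
        ultimately show ?thesis
          using s(4) by (metis E.commute)
      qed
    qed
  qed
qed

text \<open>Compactness of the range bounds the speed below, so the clock is finite at
  \<open>T\<close> even if \<open>x\<close> explodes there. The tolerances depend on each other in
  this order: \<open>q\<close> is chosen for the displacement, then \<open>\<delta>\<close> for the
  distances, and \<open>ln q\<close> bounds the slopes.\<close>

lemma forward_window:
  assumes x: "x \<in> D_exp S" and xs: "\<And>k. xs k \<in> D_exp S"
    and g: "continuous_map S (top_of_set {0<..}) g" and l: "\<And>k. l k \<in> bilipschitz_changes"
    and T: "0 \<le> T" "ereal T \<le> explosion_time x"
    and K: "compactin S K" "\<And>s. 0 \<le> s \<Longrightarrow> s < T \<Longrightarrow> the (x s) \<in> K"
    and lT: "\<forall>\<^sub>F k in sequentially. ereal (l k T) \<le> explosion_time (xs k)"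
    and close: "\<And>e. 0 < e \<Longrightarrow> \<forall>\<^sub>F k in sequentially. \<forall>s\<in>{0..<T}. mdist d (the (x s)) (the (xs k (l k s))) < e"
    and slope: "(\<lambda>k. log_slope_norm (l k) T) \<longlonglongrightarrow> 0" and "0 < e"
  defines "A \<equiv> enn2real (clock g x T)"
  shows "clock g x T = ennreal A"
    and "\<forall>\<^sub>F k in sequentially. \<exists>A' \<mu>. \<mu> \<in> increasing_homeomorphisms \<and> 0 \<le> A' \<and>
      clock g (xs k) (l k T) = ennreal A' \<and>
      (\<forall>u. 0 \<le> u \<longrightarrow> u < A \<longrightarrow> mdist d\<^sub>\<Delta> (time_change g x u) (time_change g (xs k) (\<mu> u)) \<le> e) \<and>
      (\<forall>u. A \<le> u \<longrightarrow> \<mu> u = A' + (u - A)) \<and> (\<forall>u. 0 \<le> u \<longrightarrow> \<bar>\<mu> u - u\<bar> \<le> e)"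
proof -
  interpret X: path_clock S g x
    by (rule path_clockI[OF x g])
  obtain m M where m: "0 < m" "\<And>p. p \<in> K \<Longrightarrow> m \<le> g p \<and> g p \<le> M"
    by (rule X.compact_speed_bounds[OF K(1)]) (rule that)
  have m_le: "m \<le> g (the (x s))" if "0 \<le> s" "s < T" for s
    using m(2)[OF K(2)[OF that]] by simp
  show "clock g x T = ennreal A"
    unfolding A_def by (rule X.clock_eq[OF T(2) m(1) m_le]) (use T in auto)
  obtain q where q: "1 < q" "(q ^ 4 - 1) * A \<le> e"
    by (rule exists_power4_near_1[OF \<open>0 < e\<close>]) (rule that)
  obtain \<delta> where \<delta>: "0 < \<delta>"
    "\<And>a b. a \<in> K \<Longrightarrow> b \<in> topspace S \<Longrightarrow> mdist d a b < \<delta> \<Longrightarrow> near g e q a b"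
    by (rule near_of_dist[OF g \<open>0 < e\<close> q(1) K(1)]) (rule that)
  have ln_q: "0 < ln q" "exp (ln q) = q"
    using q(1) by auto
  have "\<forall>\<^sub>F k in sequentially. log_slope_norm (l k) T < ennreal (ln q)"
    using ln_q(1) by (intro order_tendstoD(2)[OF slope]) simp
  with lT close[OF \<delta>(1)]
  show "\<forall>\<^sub>F k in sequentially. \<exists>A' \<mu>. \<mu> \<in> increasing_homeomorphisms \<and> 0 \<le> A' \<and>
      clock g (xs k) (l k T) = ennreal A' \<and>
      (\<forall>u. 0 \<le> u \<longrightarrow> u < A \<longrightarrow> mdist d\<^sub>\<Delta> (time_change g x u) (time_change g (xs k) (\<mu> u)) \<le> e) \<and>
      (\<forall>u. A \<le> u \<longrightarrow> \<mu> u = A' + (u - A)) \<and> (\<forall>u. 0 \<le> u \<longrightarrow> \<bar>\<mu> u - u\<bar> \<le> e)"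
  proof eventually_elim
    case (elim k)
    interpret Y: path_clock S g "xs k"
      by (rule path_clockI[OF xs g])
    have bij: "bij_betw (l k) {0..} {0..}" and mono: "strict_mono_on {0..} (l k)"
      using l[of k] by (auto simp: bilipschitz_changes_def)
    have l0: "l k 0 = 0"
    proof -
      obtain s where s: "0 \<le> s" "l k s = 0"
        using bij_betw_imp_surj_on[OF bij] by (metis atLeast_iff imageE order_refl)
      moreover have "0 \<le> l k 0"
        using bij_betwE[OF bij] by simp
      ultimately show ?thesis
        using strict_mono_on_leD[OF mono, of 0 s] by simp
    qed
    have slopes: "(s - r) / q \<le> l k s - l k r \<and> l k s - l k r \<le> q * (s - r)"
      if "0 \<le> r" "r \<le> s" "s \<le> T" for r s
      using log_slope_norm_less_imp_bilipschitz[OF l elim(3) that] ln_q(2) q(1)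
      by (simp add: exp_minus field_simps)
    have near_l: "near g e q (the (x s)) (the (xs k (l k s)))"
      and alive_l: "0 \<le> l k s" "ereal (l k s) < explosion_time (xs k)" if s: "0 \<le> s" "s < T" for s
    proof -
      show "0 \<le> l k s"
        using bij_betwE[OF bij] s by simp
      have "ereal (l k s) < ereal (l k T)"
        using strict_mono_onD[OF mono, of s T] s by simp
      then show "ereal (l k s) < explosion_time (xs k)"
        using elim(1) by (rule less_le_trans)
      then have "the (xs k (l k s)) \<in> topspace S"
        using Y.alive(1) \<open>0 \<le> l k s\<close> by simp
      then show "near g e q (the (x s)) (the (xs k (l k s)))"
        using elim(2) s by (intro \<delta>(2) K(2)) auto
    qed
    have near_g: "g (the (x s)) \<le> q * g (the (xs k (l k s))) \<and> g (the (xs k (l k s))) \<le> q * g (the (x s))"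
      if "0 \<le> s" "s < T" for s
      using near_l[OF that] by (simp add: near_def)
    obtain \<mu> where \<mu>: "\<mu> \<in> increasing_homeomorphisms"
      "\<And>u. 0 \<le> u \<Longrightarrow> u < A \<Longrightarrow> \<exists>s. 0 \<le> s \<and> s < T \<and> time_change g x u = x s \<and>
        time_change g (xs k) (\<mu> u) = xs k (l k s)"
      "\<And>u. A \<le> u \<Longrightarrow> \<mu> u = enn2real (clock g (xs k) (l k T)) + (u - A)"
      "\<And>u. 0 \<le> u \<Longrightarrow> \<bar>\<mu> u - u\<bar> \<le> (q ^ 4 - 1) * A"
      "clock g (xs k) (l k T) = ennreal (enn2real (clock g (xs k) (l k T)))"
      by (rule conjugate_homeomorphism[OF X.path_clock_axioms Y.path_clock_axioms q(1) T l0 slopes elim(1) m(1) m_le near_g,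
            folded A_def]) (assumption | rule that)+
    have "mdist d\<^sub>\<Delta> (time_change g x u) (time_change g (xs k) (\<mu> u)) \<le> e" if u: "0 \<le> u" "u < A" for u
    proof -
      obtain s where s: "0 \<le> s" "s < T" "time_change g x u = x s" "time_change g (xs k) (\<mu> u) = xs k (l k s)"
        using \<mu>(2)[OF u] by blast
      have "ereal s < ereal T"
        using s(2) by simp
      then have "ereal s < explosion_time x"
        using T(2) by (rule less_le_trans)
      then have "x s = Some (the (x s))" "xs k (l k s) = Some (the (xs k (l k s)))"
        using X.alive(2)[OF s(1)] Y.alive(2)[OF alive_l[OF s(1,2)]] by auto
      then have "mdist d\<^sub>\<Delta> (x s) (xs k (l k s)) \<le> e"
        using near_l[OF s(1,2)] unfolding near_def by metis
      then show ?thesis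
        by (simp add: s(3,4))
    qed
    moreover have "\<bar>\<mu> u - u\<bar> \<le> e" if "0 \<le> u" for u
      using \<mu>(4)[OF that] q(2) by (rule order_trans)
    ultimately show ?case
      using \<mu>(1,3,5) by (intro exI[of _ "enn2real (clock g (xs k) (l k T))"] exI[of _ \<mu>]) auto
  qed
qed

end

lemma bilipschitz_change_nonneg: "l \<in> bilipschitz_changes \<Longrightarrow> 0 \<le> t \<Longrightarrow> 0 \<le> l t"
  unfolding bilipschitz_changes_def bij_betw_def by blast

context skorokhod_metrics
begin

text \<open>With speed at most \<open>M\<close>, the clock grows at rate at least
  \<open>1 / M\<close> over a lifetime without end.\<close>

lemma relatively_compact_clock_unbounded:
  assumes X: "path_clock S g x" and "relatively_compact_in S (visited x)" and "explosion_time x = \<infinity>"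
  shows "\<exists>s\<ge>0. ereal s < explosion_time x \<and> ennreal t \<le> clock g x s"
proof -
  interpret path_clock S g x by fact
  obtain K where K: "compactin S K" "visited x \<subseteq> K"
    using assms(2) by (auto simp: relatively_compact_in_def)
  obtain m M where m: "0 < m" "\<And>p. p \<in> K \<Longrightarrow> m \<le> g p \<and> g p \<le> M"
    by (rule compact_speed_bounds[OF K(1)]) (rule that)
  have le: "g_at u \<le> M" if "0 \<le> u" for u
    using m(2)[of "the (x u)"] K(2) that assms(3) by (auto simp: visited_def)
  have "0 < M"
    using g_at_pos[of 0] le[of 0] assms(3) by simp
  define s where "s = M * max t 0"
  have "0 \<le> s"
    using \<open>0 < M\<close> by (simp add: s_def)
  have "clock g x 0 + ennreal ((s - 0) / M) \<le> clock g x s"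
    by (rule clock_lower) (use le \<open>0 \<le> s\<close> \<open>0 < M\<close> assms(3) in auto)
  then have "ennreal (max t 0) \<le> clock g x s"
    using \<open>0 < M\<close> by (simp add: s_def)
  moreover have "ennreal t \<le> ennreal (max t 0)"
    by (intro ennreal_leI) simp
  ultimately have "ennreal t \<le> clock g x s"
    by (metis order_trans)
  then show ?thesis
    using \<open>0 \<le> s\<close> assms(3) by (intro exI[of _ s]) simp
qed

lemma D_loc_imp_D_exp: "x \<in> D_loc S \<Longrightarrow> x \<in> D_exp S"
  by (simp add: D_loc_def)

text \<open>\<open>gA\<close> makes the clock unbounded along each path that leaves all compact
  sets. If \<open>x\<close> explodes inside a compact set, \<open>gB\<close> in addition holds the
  approximating paths near the cemetery.\<close>

lemma local_imp_global:
  assumes x: "x \<in> D_loc S" and xs: "\<And>k. xs k \<in> D_loc S"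
    and local: "local_skorokhod_converges S d xs x"
  obtains g where "continuous_map S (top_of_set {0<..}) g"
    "time_change g x \<in> D_cadlag (Alexandroff_compactification S)"
    "\<And>k. time_change g (xs k) \<in> D_cadlag (Alexandroff_compactification S)"
    "global_skorokhod_converges d\<^sub>\<Delta> (\<lambda>k. time_change g (xs k)) (time_change g x)"
proof -
  note x' = D_loc_imp_D_exp[OF x] and xs' = D_loc_imp_D_exp[OF xs]
  define inner where "inner \<longleftrightarrow> explosion_time x < \<infinity> \<and> relatively_compact_in S (visited x)"
  define T where "T = real_of_ereal (explosion_time x)"
  obtain l where l: "\<And>k. l k \<in> bilipschitz_changes"
    and in1: "inner \<Longrightarrow> \<forall>\<^sub>F k in sequentially. ereal (l k T) \<le> explosion_time (xs k)"
    and in2: "inner \<Longrightarrow> (\<lambda>k. SUP s\<in>{0..<T}. ennreal (mdist d (the (x s)) (the (xs k (l k s))))) \<longlonglongrightarrow> 0"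
    and in3: "inner \<Longrightarrow> limitin (Alexandroff_compactification S) (\<lambda>k. xs k (l k T)) None sequentially"
    and in4: "inner \<Longrightarrow> (\<lambda>k. log_slope_norm (l k) T) \<longlonglongrightarrow> 0"
    and out1: "\<And>t. \<not> inner \<Longrightarrow> 0 \<le> t \<Longrightarrow> ereal t < explosion_time x \<Longrightarrow>
      \<forall>\<^sub>F k in sequentially. ereal (l k t) < explosion_time (xs k)"
    and out2: "\<And>t. \<not> inner \<Longrightarrow> 0 \<le> t \<Longrightarrow> ereal t < explosion_time x \<Longrightarrow>
      (\<lambda>k. SUP s\<in>{0..t}. ennreal (mdist d (the (x s)) (the (xs k (l k s))))) \<longlonglongrightarrow> 0"
    and out3: "\<And>t. \<not> inner \<Longrightarrow> 0 \<le> t \<Longrightarrow> ereal t < explosion_time x \<Longrightarrow>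
      (\<lambda>k. log_slope_norm (l k) t) \<longlonglongrightarrow> 0"
    using local unfolding local_skorokhod_converges_def inner_def[symmetric] T_def[symmetric] Let_def
    by (cases inner) auto
  \<comment> \<open>Adjoining \<open>x\<close> at index 0 lets one speed serve the limit and all
    approximating paths.\<close>
  define ys where "ys k = (case k of 0 \<Rightarrow> x | Suc n \<Rightarrow> xs n)" for k
  have ys: "ys k \<in> D_exp S" for k
    using x' xs' by (simp add: ys_def split: nat.split)
  obtain gA where gA: "continuous_map S (top_of_set {0<..}) gA"
    "\<forall>h k t. continuous_map S (top_of_set {0<..}) h \<longrightarrow> (\<forall>p\<in>topspace S. h p \<le> gA p) \<longrightarrow>
      \<not> relatively_compact_in S (visited (ys k)) \<longrightarrow>
      (\<exists>s\<ge>0. ereal s < explosion_time (ys k) \<and> ennreal t \<le> clock h (ys k) s)"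
    by (rule exists_speed_unbounded_clock[of ys, OF ys]) (rule that)
  have "\<exists>gB. continuous_map S (top_of_set {0<..}) gB \<and> (inner \<longrightarrow>
    (\<forall>h e. continuous_map S (top_of_set {0<..}) h \<longrightarrow> (\<forall>p\<in>topspace S. h p \<le> gB p) \<longrightarrow> 0 < e \<longrightarrow>
      (\<forall>\<^sub>F k in sequentially. \<forall>a w. ereal (l k T) \<le> explosion_time (xs k) \<longrightarrow> clock h (xs k) (l k T) = ennreal a \<longrightarrow>
        0 \<le> a \<longrightarrow> 0 \<le> w \<longrightarrow> w \<le> real k \<longrightarrow> mdist d\<^sub>\<Delta> None (time_change h (xs k) (a + w)) \<le> e)))"
  proof (cases inner)
    case True
    have "0 \<le> T"
      using path_clock.explosion_time_nonneg[OF path_clockI[OF x' gA(1)]]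
      by (simp add: T_def real_of_ereal_pos)
    then have "0 \<le> l k T" for k
      using bilipschitz_change_nonneg[OF l] by blast
    then show ?thesis
      by (rule exists_speed_staying_near_cemetery[of xs "\<lambda>k. l k T", OF xs' _ in3[OF True]])
        (rule exI, rule conjI, assumption, rule impI, assumption)
  qed (use gA(1) in blast)
  then obtain gB where gB: "continuous_map S (top_of_set {0<..}) gB"
    "inner \<longrightarrow>
    (\<forall>h e. continuous_map S (top_of_set {0<..}) h \<longrightarrow> (\<forall>p\<in>topspace S. h p \<le> gB p) \<longrightarrow> 0 < e \<longrightarrow>
      (\<forall>\<^sub>F k in sequentially. \<forall>a w. ereal (l k T) \<le> explosion_time (xs k) \<longrightarrow> clock h (xs k) (l k T) = ennreal a \<longrightarrow>
        0 \<le> a \<longrightarrow> 0 \<le> w \<longrightarrow> w \<le> real k \<longrightarrow> mdist d\<^sub>\<Delta> None (time_change h (xs k) (a + w)) \<le> e))"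
    by (elim exE conjE) (rule that)
  \<comment> \<open>The properties of \<open>gA\<close> and \<open>gB\<close> hold for all smaller
    speeds as well, hence for the minimum.\<close>
  define g where "g p = min (gA p) (gB p)" for p
  have g: "continuous_map S (top_of_set {0<..}) g"
    using gA(1) gB(1) by (auto simp: g_def[abs_def] continuous_map_in_subtopology intro: continuous_map_real_min)
  have unbounded: "\<exists>s\<ge>0. ereal s < explosion_time (ys k) \<and> ennreal t \<le> clock g (ys k) s"
    if "\<not> relatively_compact_in S (visited (ys k))" for k t
    by (rule gA(2)[rule_format, OF g _ that]) (simp add: g_def)
  interpret X: path_clock S g x
    by (rule path_clockI[OF x' g])
  have stays: "\<forall>\<^sub>F k in sequentially. \<forall>a w. ereal (l k T) \<le> explosion_time (xs k) \<longrightarrow> clock g (xs k) (l k T) = ennreal a \<longrightarrow>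
        0 \<le> a \<longrightarrow> 0 \<le> w \<longrightarrow> w \<le> real k \<longrightarrow> mdist d\<^sub>\<Delta> None (time_change g (xs k) (a + w)) \<le> e"
    if "inner" "0 < e" for e
    by (rule gB(2)[THEN mp, OF that(1), THEN spec, THEN spec, THEN mp, OF g, THEN mp, THEN mp, OF _ that(2)])
      (simp add: g_def)
  show thesis
  proof (rule that[OF g])
    show "time_change g x \<in> D_cadlag (Alexandroff_compactification S)"
      using unbounded[of 0] by (intro X.time_change_in_D_cadlag[OF x]) (simp add: ys_def)
    show "time_change g (xs k) \<in> D_cadlag (Alexandroff_compactification S)" for k
      using unbounded[of "Suc k"]
      by (intro path_clock.time_change_in_D_cadlag[OF path_clockI[OF xs' g] xs]) (simp add: ys_def)
    show "global_skorokhod_converges d\<^sub>\<Delta> (\<lambda>k. time_change g (xs k)) (time_change g x)"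
    proof (rule global_skorokhod_convergesI)
      fix J e :: real assume "0 \<le> J" "0 < e"
      show "\<forall>\<^sub>F k in sequentially. \<exists>\<mu>\<in>increasing_homeomorphisms. \<forall>u\<in>{0..J}.
          mdist d\<^sub>\<Delta> (time_change g x u) (time_change g (xs k) (\<mu> u)) \<le> e \<and> \<bar>\<mu> u - u\<bar> \<le> e"
      proof (cases inner)
        case True
        have Tx: "explosion_time x = ereal T" "0 \<le> T"
          using True X.explosion_time_nonneg
          by (cases "explosion_time x"; auto simp: inner_def T_def)+
        obtain K where K: "compactin S K" "visited x \<subseteq> K"
          using True by (auto simp: inner_def relatively_compact_in_def)
        have K': "the (x s) \<in> K" if "0 \<le> s" "s < T" for s
          using K(2) that Tx(1) by (auto simp: visited_def)
        have close: "\<forall>\<^sub>F k in sequentially. \<forall>s\<in>{0..<T}. mdist d (the (x s)) (the (xs k (l k s))) < e'" if "0 < e'" for e'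
          using SUP_ennreal_tendsto_0D[OF in2[OF True] that] .
        have Tx': "ereal T \<le> explosion_time x"
          by (simp add: Tx)
        note window = forward_window[OF x' xs' g l Tx(2) Tx' K(1) K' in1[OF True] close in4[OF True] \<open>0 < e\<close>]
        define A where "A = enn2real (clock g x T)"
        have A: "clock g x T = ennreal A"
          unfolding A_def by (rule window(1))
        \<comment> \<open>From index \<open>N\<close> on, the stay near the cemetery outlasts the
          horizon \<open>J\<close>, while \<open>x\<close> is dead from \<open>A\<close> on.\<close>
        obtain N :: nat where N: "J \<le> real N"
          using real_arch_simple by blast
        have "\<forall>\<^sub>F k in sequentially. \<exists>A' \<mu>. \<mu> \<in> increasing_homeomorphisms \<and> 0 \<le> A' \<and>
            clock g (xs k) (l k T) = ennreal A' \<and>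
            (\<forall>u. 0 \<le> u \<longrightarrow> u < A \<longrightarrow> mdist d\<^sub>\<Delta> (time_change g x u) (time_change g (xs k) (\<mu> u)) \<le> e) \<and>
            (\<forall>u. A \<le> u \<longrightarrow> \<mu> u = A' + (u - A)) \<and> (\<forall>u. 0 \<le> u \<longrightarrow> \<bar>\<mu> u - u\<bar> \<le> e)"
          unfolding A_def by (rule window(2))
        with in1[OF True] stays[OF True \<open>0 < e\<close>] eventually_ge_at_top[of N]
        show ?thesis
        proof eventually_elim
          case (elim k)
          obtain A' \<mu> where \<mu>: "\<mu> \<in> increasing_homeomorphisms" "0 \<le> A'" "clock g (xs k) (l k T) = ennreal A'"
            "\<And>u. 0 \<le> u \<Longrightarrow> u < A \<Longrightarrow> mdist d\<^sub>\<Delta> (time_change g x u) (time_change g (xs k) (\<mu> u)) \<le> e"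
            "\<And>u. A \<le> u \<Longrightarrow> \<mu> u = A' + (u - A)" "\<And>u. 0 \<le> u \<Longrightarrow> \<bar>\<mu> u - u\<bar> \<le> e"
            using elim(4) by blast
          have "mdist d\<^sub>\<Delta> (time_change g x u) (time_change g (xs k) (\<mu> u)) \<le> e" if u: "u \<in> {0..J}" for u
          proof (cases "u < A")
            case True
            then show ?thesis
              using \<mu>(4) u by simp
          next
            case False
            then have "A \<le> u"
              by simp
            then have "time_change g x u = None"
              by (rule X.time_change_after_explosion[OF Tx(1) A])
            moreover have "0 \<le> A"
              by (simp add: A_def)
            then have "u - A \<le> real k"
              using u N elim(3) by simp
            then have "mdist d\<^sub>\<Delta> None (time_change g (xs k) (A' + (u - A))) \<le> e"
              using elim(2) elim(1) \<mu>(2,3) \<open>A \<le> u\<close> by simp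
            ultimately show ?thesis
              using \<mu>(5)[OF \<open>A \<le> u\<close>] by simp
          qed
          then show ?case
            using \<mu>(1,6) by (intro bexI[of _ \<mu>]) auto
        qed
      next
        case False
        \<comment> \<open>Either \<open>x\<close> leaves all compact sets and its clock is unbounded
          by the choice of \<open>gA\<close>, or it lives forever at bounded speed. The summand 1
          places \<open>{0..J}\<close> strictly before \<open>A\<close>, where the window controls
          the distances.\<close>
        have "\<exists>s\<ge>0. ereal s < explosion_time x \<and> ennreal (J + 1) \<le> clock g x s"
        proof (cases "relatively_compact_in S (visited x)")
          case True
          then have "explosion_time x = \<infinity>"
            using False by (simp add: inner_def)
          with True show ?thesis
            by (intro relatively_compact_clock_unbounded[OF X.path_clock_axioms])
        next
          case False
          then show ?thesis
            using unbounded[of 0 "J + 1"] by (simp add: ys_def)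
        qed
        then obtain T0 where T0: "0 \<le> T0" "ereal T0 < explosion_time x" "ennreal (J + 1) \<le> clock g x T0"
          by blast
        obtain K where K: "compactin S K" "\<And>s. 0 \<le> s \<Longrightarrow> s \<le> T0 \<Longrightarrow> the (x s) \<in> K"
          by (rule X.compact_range[OF T0(1,2)]) (rule that)
        have K': "the (x s) \<in> K" if "0 \<le> s" "s < T0" for s
          using K(2) that by simp
        have le: "\<forall>\<^sub>F k in sequentially. ereal (l k T0) \<le> explosion_time (xs k)"
          using out1[OF False T0(1,2)] by (rule eventually_mono) simp
        have close: "\<forall>\<^sub>F k in sequentially. \<forall>s\<in>{0..<T0}. mdist d (the (x s)) (the (xs k (l k s))) < e'" if "0 < e'" for e'
          using SUP_ennreal_tendsto_0D[OF out2[OF False T0(1,2)] that] by (rule eventually_mono) simp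
        note window = forward_window[OF x' xs' g l T0(1) less_imp_le[OF T0(2)] K(1) K' le close
            out3[OF False T0(1,2)] \<open>0 < e\<close>]
        define A where "A = enn2real (clock g x T0)"
        have A: "clock g x T0 = ennreal A"
          unfolding A_def by (rule window(1))
        have "J + 1 \<le> A"
          using T0(3) unfolding A by (subst (asm) ennreal_le_iff) (simp_all add: A_def)
        then have "J < A"
          by simp
        have "\<forall>\<^sub>F k in sequentially. \<exists>A' \<mu>. \<mu> \<in> increasing_homeomorphisms \<and> 0 \<le> A' \<and>
            clock g (xs k) (l k T0) = ennreal A' \<and>
            (\<forall>u. 0 \<le> u \<longrightarrow> u < A \<longrightarrow> mdist d\<^sub>\<Delta> (time_change g x u) (time_change g (xs k) (\<mu> u)) \<le> e) \<and>
            (\<forall>u. A \<le> u \<longrightarrow> \<mu> u = A' + (u - A)) \<and> (\<forall>u. 0 \<le> u \<longrightarrow> \<bar>\<mu> u - u\<bar> \<le> e)"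
          unfolding A_def by (rule window(2))
        then show ?thesis
        proof eventually_elim
          case (elim k)
          then obtain \<mu> where "\<mu> \<in> increasing_homeomorphisms"
            "\<And>u. 0 \<le> u \<Longrightarrow> u < A \<Longrightarrow> mdist d\<^sub>\<Delta> (time_change g x u) (time_change g (xs k) (\<mu> u)) \<le> e"
            "\<And>u. 0 \<le> u \<Longrightarrow> \<bar>\<mu> u - u\<bar> \<le> e"
            by blast
          then show ?case
            using \<open>J < A\<close> by (intro bexI[of _ \<mu>]) auto
        qed
      qed
    qed
  qed
qed

end

section \<open>From global to local convergence\<close>

text \<open>If the integrand is not measurable on the larger interval, the right-hand side is
  infinite. Otherwise measurability and the almost sure bound restrict.\<close>

lemma log_slope_norm_mono:
  assumes "t \<le> t'"
  shows "log_slope_norm l t \<le> log_slope_norm l t'"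
proof -
  define f where "f s = (if l field_differentiable at s then ennreal \<bar>ln (deriv l s)\<bar> else \<infinity>)" for s
  have sub: "{0..t} \<subseteq> {0..t'}"
    using assms by auto
  show ?thesis
    unfolding log_slope_norm_def f_def[symmetric]
  proof (cases "f \<in> borel_measurable (lebesgue_on {0..t'})")
    case False
    then show "esssup (lebesgue_on {0..t}) f \<le> esssup (lebesgue_on {0..t'}) f"
      by (simp add: esssup_non_measurable)
  next
    case True
    show "esssup (lebesgue_on {0..t}) f \<le> esssup (lebesgue_on {0..t'}) f"
    proof (rule esssup_I)
      show "f \<in> borel_measurable (lebesgue_on {0..t})"
        using True sub by (rule measurable_restrict_mono)
      have "AE s in lebesgue_on {0..t'}. f s \<le> esssup (lebesgue_on {0..t'}) f"
        by (rule esssup_AE)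
      then have "AE s in lebesgue. s \<in> {0..t'} \<longrightarrow> f s \<le> esssup (lebesgue_on {0..t'}) f"
        by (subst (asm) AE_restrict_space_iff) simp_all
      then have "AE s in lebesgue. s \<in> {0..t} \<longrightarrow> f s \<le> esssup (lebesgue_on {0..t'}) f"
        by (rule eventually_mono) (use sub in blast)
      then show "AE s in lebesgue_on {0..t}. f s \<le> esssup (lebesgue_on {0..t'}) f"
        by (subst AE_restrict_space_iff) simp_all
    qed
  qed
qed

section \<open>Order properties of increasing homeomorphisms\<close>

lemma increasing_homeomorphism_0:
  assumes "l \<in> increasing_homeomorphisms"
  shows "l 0 = 0" and "\<And>s. 0 \<le> s \<Longrightarrow> 0 \<le> l s"
proof -
  have mono: "strict_mono_on {0..} l" and image: "l ` {0..} = {0..}"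
    using assms by (auto simp: increasing_homeomorphisms_def homeomorphism_def)
  show nonneg: "0 \<le> l s" if "0 \<le> s" for s
    using image that by auto
  have "0 \<in> l ` {0..}"
    using image by simp
  then obtain s where s: "0 \<le> s" "l s = 0"
    by auto
  then have "l 0 \<le> 0"
    using strict_mono_on_leD[OF mono, of 0 s] by simp
  then show "l 0 = 0"
    using nonneg[of 0] by simp
qed

lemma increasing_homeomorphism_surj:
  assumes "l \<in> increasing_homeomorphisms" and "0 \<le> a" "0 \<le> b" "l a \<le> v" "v < l b"
  obtains w where "a \<le> w" "w < b" "l w = v"
proof -
  have mono: "strict_mono_on {0..} l" and image: "l ` {0..} = {0..}"
    using assms(1) by (auto simp: increasing_homeomorphisms_def homeomorphism_def)
  have "0 \<le> v"
    using increasing_homeomorphism_0(2)[OF assms(1,2)] assms(4) by simp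
  then have "v \<in> l ` {0..}"
    using image by simp
  then obtain w where w: "0 \<le> w" "l w = v"
    by auto
  have "\<not> w < a"
    using strict_mono_onD[OF mono, of w a] w assms by auto
  moreover have "\<not> b \<le> w"
    using strict_mono_on_leD[OF mono, of b w] w assms by auto
  ultimately show thesis
    using that[of w] w by simp
qed

context skorokhod_metrics
begin

text \<open>The interval induction yields a linear piece of \<open>l\<close> on each interval of
  small oscillation and glues the pieces at common values of \<open>\<nu> k\<close>. The value at
  \<open>l T\<close> is expressed through \<open>\<mu> k A\<close> because its use differs: at an
  explosion of \<open>x\<close> it tends to the cemetery, otherwise it shows that
  \<open>xs k\<close> survives.\<close>

lemma backward_window:
  assumes x: "x \<in> D_exp S" and xs: "\<And>k. xs k \<in> D_exp S"
    and g: "continuous_map S (top_of_set {0<..}) g" and \<mu>: "\<And>k. \<mu> k \<in> increasing_homeomorphisms"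
    and T: "0 \<le> T" "ereal T \<le> explosion_time x"
    and left: "\<And>t. 0 < t \<Longrightarrow> t \<le> T \<Longrightarrow> \<exists>p. limitin S (\<lambda>s. the (x s)) p (at_left t)"
    and K: "compactin S K" "\<And>s. 0 \<le> s \<Longrightarrow> s < T \<Longrightarrow> the (x s) \<in> K"
    and conv: "\<And>t e. 0 \<le> t \<Longrightarrow> 0 < e \<Longrightarrow> \<forall>\<^sub>F k in sequentially. \<forall>u\<in>{0..t}.
      mdist d\<^sub>\<Delta> (time_change g x u) (time_change g (xs k) (\<mu> k u)) < e \<and> \<bar>\<mu> k u - u\<bar> < e"
    and e: "0 < e" and q: "1 < q"
  defines "A \<equiv> enn2real (clock g x T)"
  shows "clock g x T = ennreal A"
    and "\<forall>\<^sub>F k in sequentially. \<exists>l\<in>bilipschitz_changes. 0 \<le> l T \<and> ereal (l T) \<le> explosion_time (xs k) \<and>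
      xs k (l T) = time_change g (xs k) (\<mu> k A) \<and> log_slope_norm l T \<le> ennreal (ln (q ^ 4)) \<and>
      (\<forall>s\<in>{0..<T}. mdist d (the (x s)) (the (xs k (l s))) \<le> 2 * e)"
proof -
  interpret X: path_clock S g x
    by (rule path_clockI[OF x g])
  interpret D: Metric_space "mspace d" "mdist d"
    by simp
  have Y: "path_clock S g (xs k)" for k
    by (rule path_clockI[OF xs g])
  obtain m M where m: "0 < m" "\<And>p. p \<in> K \<Longrightarrow> m \<le> g p \<and> g p \<le> M"
    by (rule X.compact_speed_bounds[OF K(1)]) (rule that)
  have m_le: "m \<le> g (the (x s))" if "0 \<le> s" "s < T" for s
    using m(2)[OF K(2)[OF that]] by simp
  show clock_T: "clock g x T = ennreal A"
    unfolding A_def by (rule X.clock_eq[OF T(2) m(1) m_le]) (use T in auto)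
  define a where "a s = enn2real (clock g x s)" for s
  have clock_a: "clock g x s = ennreal (a s)" if "0 \<le> s" "s \<le> T" for s
    unfolding a_def by (rule X.clock_eq[OF T(2) m(1) m_le]) (use that in auto)
  have a_mono: "strict_mono_on {0..T} a"
    unfolding a_def by (rule X.real_clock_strict_mono[OF T(2) m(1) m_le])
  have a0: "a 0 = 0" and aT: "a T = A" and a_nonneg: "0 \<le> a s" for s
    by (simp_all add: a_def A_def)
  have a_le: "a s \<le> A" if "0 \<le> s" "s \<le> T" for s
    using strict_mono_on_leD[OF a_mono, of s T] that aT by simp
  have below_T: "ereal s < explosion_time x" if "s < T" for s
  proof -
    have "ereal s < ereal T"
      using that by simp
    then show ?thesis
      using T(2) by (rule less_le_trans)
  qed
  have x_at: "time_change g x (a s) = x s" if "0 \<le> s" "s \<le> T" for s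
  proof (rule X.time_change_at_clock[OF that(1) _ clock_a[OF that]])
    have "ereal s \<le> ereal T"
      using that(2) by simp
    then show "ereal s \<le> explosion_time x"
      using T(2) by (rule order_trans)
  qed
  have a_surj: "\<exists>s. s1 \<le> s \<and> s < s2 \<and> a s = w"
    if s: "0 \<le> s1" "s1 \<le> s2" "s2 \<le> T" and w: "a s1 \<le> w" "w < a s2" for s1 s2 w
  proof -
    have cont: "continuous_on {0..T} a"
      unfolding a_def by (rule X.real_clock_continuous[OF T(2) m(1) m_le])
    have "continuous_on {s1..s2} a"
      using cont by (rule continuous_on_subset) (use s in auto)
    then obtain r where "s1 \<le> r" "r \<le> s2" "a r = w"
      using IVT'[of a s1 w s2] s w by auto
    then show ?thesis
      using w by (intro exI[of _ r]) (auto simp: less_le)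
  qed
  obtain \<delta> where \<delta>: "0 < \<delta>"
    "\<And>p z. p \<in> K \<Longrightarrow> z \<in> topspace (Alexandroff_compactification S) \<Longrightarrow> mdist d\<^sub>\<Delta> (Some p) z < \<delta> \<Longrightarrow>
      \<exists>p'\<in>topspace S. z = Some p' \<and> near g e q p p'"
    by (rule near_of_dist_Some[OF g e q K(1)]) (rule that)
  have y_topspace: "time_change g (xs k) u \<in> topspace (Alexandroff_compactification S)" if "0 \<le> u" for k u
    using path_clock.time_change_right_continuous[OF Y that] by (simp add: limitin_def)
  define good where "good k \<longleftrightarrow> (\<forall>u\<in>{0..A}. mdist d\<^sub>\<Delta> (time_change g x u) (time_change g (xs k) (\<mu> k u)) < \<delta>)" for k
  have good_ev: "\<forall>\<^sub>F k in sequentially. good k"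
    using conv[OF _ \<delta>(1), of A] unfolding good_def by (auto simp: A_def elim!: eventually_mono)
  have mu_mono: "strict_mono_on {0..} (\<mu> k)" for k
    using \<mu>[of k] by (simp add: increasing_homeomorphisms_def)
  note mu_0 = increasing_homeomorphism_0(1)[OF \<mu>] and mu_nonneg = increasing_homeomorphism_0(2)[OF \<mu>]
  \<comment> \<open>A new time between \<open>\<mu> k (a s1)\<close> and
    \<open>\<mu> k (a s2)\<close> is matched, first through \<open>\<mu> k\<close> and then through
    the clock of \<open>x\<close>, with a time \<open>r\<close> in the same interval. In particular
    the time-changed \<open>xs k\<close> is alive there.\<close>
  have near_y: "\<exists>r. s1 \<le> r \<and> r < s2 \<and>
      (\<exists>p'\<in>topspace S. time_change g (xs k) v = Some p' \<and> near g e q (the (x r)) p')"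
    if k: "good k" and s: "0 \<le> s1" "s1 \<le> s2" "s2 \<le> T" and v: "\<mu> k (a s1) \<le> v" "v < \<mu> k (a s2)" for k s1 s2 v
  proof -
    obtain w where w: "a s1 \<le> w" "w < a s2" "\<mu> k w = v"
      by (rule increasing_homeomorphism_surj[OF \<mu> a_nonneg a_nonneg v]) (rule that)
    obtain r where r: "s1 \<le> r" "r < s2" "a r = w"
      using a_surj[OF s w(1,2)] by blast
    have r': "0 \<le> r" "r < T" "r \<le> T"
      using r s by auto
    have "mdist d\<^sub>\<Delta> (time_change g x w) (time_change g (xs k) (\<mu> k w)) < \<delta>"
      using k a_nonneg[of r] a_le[OF r'(1,3)] r(3) by (auto simp: good_def)
    moreover have "time_change g x w = Some (the (x r))"
      using x_at[OF r'(1,3)] r(3) X.alive(2)[OF r'(1) below_T[OF r'(2)]] by metis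
    moreover have "0 \<le> v"
      using mu_nonneg[of "a s1" k] a_nonneg v by auto
    ultimately have "\<exists>p'\<in>topspace S. time_change g (xs k) v = Some p' \<and> near g e q (the (x r)) p'"
      using w(3) by (intro \<delta>(2) K(2) r' y_topspace) auto
    then show ?thesis
      using r by blast
  qed
  have g_pos: "0 < g p" if "p \<in> topspace S" for p
    using X.speed_pos that by blast
  have K_topspace: "p \<in> topspace S" if "p \<in> K" for p
    using compactin_subset_topspace[OF K(1)] that by blast
  \<comment> \<open>The lower speed bound is carried along for the real-valued clock estimates up to
    \<open>v\<close>, which may be the explosion time of \<open>xs k\<close>.\<close>
  define P where "P k s v \<longleftrightarrow> 0 \<le> v \<and> ereal v \<le> explosion_time (xs k) \<and> clock g (xs k) v = ennreal (\<mu> k (a s)) \<and>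
      (\<forall>r. 0 \<le> r \<longrightarrow> r < v \<longrightarrow> m / q \<le> g (the (xs k r)))" for k s v
  define \<nu> where "\<nu> k s = (SOME v. P k s v)" for k s
  have nu: "P k s (\<nu> k s)" if k: "good k" and s: "0 \<le> s" "s \<le> T" for k s
  proof -
    have "\<exists>v. P k s v"
    \<comment> \<open>The speed along \<open>x\<close> lies between \<open>m\<close> and
      \<open>M\<close>, and nearness of the paths costs a factor \<open>q\<close> on either
      side.\<close>
    proof (rule path_clock.exists_clock_eq[OF Y, of "\<mu> k (a s)" "m / q" k "q * M"])
      show "0 \<le> \<mu> k (a s)"
        using mu_nonneg a_nonneg by blast
      show "0 < m / q"
        using m q by simp
      fix v assume v: "0 \<le> v" "v < \<mu> k (a s)"
      then have "\<mu> k (a 0) \<le> v"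
        by (simp add: a0 mu_0)
      then obtain r p' where r: "0 \<le> r" "r < s" and p': "p' \<in> topspace S" "time_change g (xs k) v = Some p'"
        "near g e q (the (x r)) p'"
        using near_y[OF k order_refl s _ v(2)] by blast
      have "m \<le> g (the (x r))" "g (the (x r)) \<le> M"
        using m(2)[OF K(2), of r] r s by auto
      moreover have "g (the (x r)) \<le> q * g p'" "g p' \<le> q * g (the (x r))"
        using p'(3) by (simp_all add: near_def)
      moreover have "q * g (the (x r)) \<le> q * M"
        using calculation q by (intro mult_left_mono) auto
      ultimately have "m \<le> q * g p'" "g p' \<le> q * M"
        by linarith+
      then have "m / q \<le> g p'" "g p' \<le> q * M"
        using q by (simp_all add: pos_divide_le_eq mult.commute)
      then show "time_change g (xs k) v \<noteq> None \<and> m / q \<le> g (the (time_change g (xs k) v)) \<and>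
          g (the (time_change g (xs k) v)) \<le> q * M"
        using p'(2) by simp
    next
      fix v assume "0 \<le> v" "ereal v \<le> explosion_time (xs k)" "clock g (xs k) v = ennreal (\<mu> k (a s))"
        "\<And>r. 0 \<le> r \<Longrightarrow> r < v \<Longrightarrow> m / q \<le> g (the (xs k r)) \<and> g (the (xs k r)) \<le> q * M"
      then show "\<exists>v. P k s v"
        unfolding P_def by blast
    qed
    then show ?thesis
      unfolding \<nu>_def by (rule someI_ex)
  qed
  have nu_less: "\<nu> k s1 < \<nu> k s2" if k: "good k" and s: "0 \<le> s1" "s1 < s2" "s2 \<le> T" for k s1 s2
  proof (rule path_clock.clock_less_imp_less[OF Y])
    have "a s1 < a s2"
      using strict_mono_onD[OF a_mono, of s1 s2] s by simp
    then have "\<mu> k (a s1) < \<mu> k (a s2)"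
      using strict_mono_onD[OF mu_mono, of "a s1" "a s2" k] a_nonneg by simp
    then show "clock g (xs k) (\<nu> k s1) < clock g (xs k) (\<nu> k s2)"
      using nu[OF k, of s1] nu[OF k, of s2] s mu_nonneg[OF a_nonneg]
      by (simp add: P_def ennreal_less_iff)
  qed (use nu[OF k, of s1] nu[OF k, of s2] s in \<open>auto simp: P_def\<close>)
  have nu_0: "\<nu> k 0 = 0" if k: "good k" for k
  proof (rule ccontr)
    interpret Yk: path_clock S g "xs k"
      by (rule Y)
    have P0: "P k 0 (\<nu> k 0)"
      using nu[OF k, of 0] T by simp
    assume "\<nu> k 0 \<noteq> 0"
    then have "clock g (xs k) 0 < clock g (xs k) (\<nu> k 0)"
      using P0 by (intro Yk.clock_strict_mono) (auto simp: P_def)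
    then show False
      using P0 by (simp add: P_def a0 mu_0)
  qed
  have near_between: "\<exists>r. s1 \<le> r \<and> r < s2 \<and> the (xs k v) \<in> topspace S \<and> near g e q (the (x r)) (the (xs k v))"
    if k: "good k" and s: "0 \<le> s1" "s1 < s2" "s2 \<le> T" and v: "\<nu> k s1 \<le> v" "v < \<nu> k s2" for k s1 s2 v
  proof -
    interpret Yk: path_clock S g "xs k"
      by (rule Y)
    have P1: "P k s1 (\<nu> k s1)" and P2: "P k s2 (\<nu> k s2)"
      using nu[OF k] s by auto
    have v': "0 \<le> v" "v \<le> \<nu> k s2" "ereal v \<le> explosion_time (xs k)"
    proof -
      show "0 \<le> v" "v \<le> \<nu> k s2"
        using P1 v by (auto simp: P_def)
      have "ereal v \<le> ereal (\<nu> k s2)"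
        using v by simp
      moreover have "ereal (\<nu> k s2) \<le> explosion_time (xs k)"
        using P2 by (simp add: P_def)
      ultimately show "ereal v \<le> explosion_time (xs k)"
        by (rule order_trans)
    qed
    have "clock g (xs k) v \<le> clock g (xs k) (\<nu> k s2)"
      using v' P2 by (intro Yk.clock_mono) (auto simp: P_def)
    also have "\<dots> < \<infinity>"
      using P2 by (simp add: P_def)
    finally have "clock g (xs k) v < \<infinity>" .
    then have "clock g (xs k) v < clock g (xs k) (\<nu> k s2)"
      using v' v(2) P2 by (intro Yk.clock_strict_mono) (auto simp: P_def)
    moreover have "clock g (xs k) (\<nu> k s1) \<le> clock g (xs k) v"
      using v(1) v' P1 by (intro Yk.clock_mono) (auto simp: P_def)
    moreover obtain c where c: "clock g (xs k) v = ennreal c" "0 \<le> c"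
      using \<open>clock g (xs k) v < \<infinity>\<close> by (cases "clock g (xs k) v") auto
    ultimately have "\<mu> k (a s1) \<le> c" "c < \<mu> k (a s2)"
      using P1 P2 mu_nonneg[OF a_nonneg]
      by (simp_all add: P_def ennreal_less_iff ennreal_le_iff)
    then obtain r p' where r: "s1 \<le> r" "r < s2" "p' \<in> topspace S" "time_change g (xs k) c = Some p'"
      "near g e q (the (x r)) p'"
      using near_y[OF k s(1) less_imp_le[OF s(2)] s(3)] by blast
    moreover have "time_change g (xs k) c = xs k v"
      by (rule Yk.time_change_at_clock[OF v'(1,3) c(1)])
    ultimately show ?thesis
      by (intro exI[of _ r]) simp
  qed
  \<comment> \<open>A piece is tied to \<open>\<nu> k\<close> at its ends only. In between, the
    slopes of \<open>\<nu> k\<close> itself need not be controlled.\<close>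
  define piece where "piece k s1 s2 l \<longleftrightarrow> slopes_within (q ^ 4) s1 s2 l \<and> l s1 = \<nu> k s1 \<and> l s2 = \<nu> k s2 \<and>
      (\<forall>v. s1 \<le> v \<longrightarrow> v < s2 \<longrightarrow> mdist d (the (x v)) (the (xs k (l v))) \<le> 2 * e)" for k s1 s2 l
  have "0 < T \<longrightarrow> (\<forall>\<^sub>F k in sequentially. \<exists>l. piece k 0 T l)"
    using T
  proof (induction rule: X.cadlag_interval_induct[where
        Q = "\<lambda>U. \<forall>p\<in>U. \<forall>p'\<in>U. near g e q p p'" and
        P = "\<lambda>s1 s2. s1 < s2 \<longrightarrow> (\<forall>\<^sub>F k in sequentially. \<exists>l. piece k s1 s2 l)"])
    case (left t)
    then show ?case
      by (rule assms(7))
  next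
    case (cover p)
    obtain U where "openin S U" "p \<in> U" "\<And>b b'. b \<in> U \<Longrightarrow> b' \<in> U \<Longrightarrow> near g e q b b'"
      by (rule near_nbhd[OF g e q cover]) (rule that)
    then show ?case
      by blast
  next
    case (small s1 s2 U)
    have s12: "0 \<le> s1" "s1 < s2" "s2 \<le> T"
      using small by blast+
    have near_U: "near g e q p p'" if "p \<in> U" "p' \<in> U" for p p'
      using small that by blast
    have range_U: "the (x u) \<in> U" if "s1 \<le> u" "u < s2" for u
      using small that by blast
    have "a s1 < a s2"
      using strict_mono_onD[OF a_mono, of s1 s2] small by simp
    \<comment> \<open>Errors below \<open>\<eta>\<close> at both ends change the increment by at
      most \<open>(1 - 1 / q) * (a s2 - a s1)\<close>, which keeps it within a factor
      \<open>q\<close> of the increment of \<open>a\<close>.\<close>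
    define \<eta> where "\<eta> = (1 - 1 / q) * (a s2 - a s1) / 2"
    have "0 < \<eta>"
      using \<open>a s1 < a s2\<close> q by (simp add: \<eta>_def)
    define G where "G = g (the (x s1))"
    have in_U: "the (x s1) \<in> U"
      using s12 by (intro range_U) auto
    have "0 < G"
      unfolding G_def using s12 by (intro X.g_at_pos below_T) auto
    have gU: "g (the (x u)) \<le> q * G \<and> G / q \<le> g (the (x u))" if "s1 \<le> u" "u < s2" for u
    proof -
      have "near g e q (the (x u)) (the (x s1))"
        by (intro near_U range_U that in_U)
      then show ?thesis
        using q by (auto simp: near_def G_def pos_divide_le_eq mult.commute)
    qed
    have "\<forall>\<^sub>F k in sequentially. \<forall>u\<in>{0..A}.
        mdist d\<^sub>\<Delta> (time_change g x u) (time_change g (xs k) (\<mu> k u)) < \<eta> \<and> \<bar>\<mu> k u - u\<bar> < \<eta>"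
      using conv[OF _ \<open>0 < \<eta>\<close>, of A] a_nonneg[of T] aT by simp
    with good_ev have "\<forall>\<^sub>F k in sequentially. \<exists>l. piece k s1 s2 l"
    proof eventually_elim
      case (elim k)
      interpret Yk: path_clock S g "xs k"
        by (rule Y)
      note k = elim(1)
      have P1: "P k s1 (\<nu> k s1)" and P2: "P k s2 (\<nu> k s2)"
        using nu[OF k] s12 by auto
      have nu12: "\<nu> k s1 < \<nu> k s2"
        using nu_less[OF k] s12 by simp
      define \<Delta>\<mu> where "\<Delta>\<mu> = \<mu> k (a s2) - \<mu> k (a s1)"
      define \<Delta>a where "\<Delta>a = a s2 - a s1"
      define \<Delta>\<nu> where "\<Delta>\<nu> = \<nu> k s2 - \<nu> k s1"
      have "\<bar>\<mu> k (a s1) - a s1\<bar> < \<eta>" "\<bar>\<mu> k (a s2) - a s2\<bar> < \<eta>"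
        using elim(2) a_nonneg a_le[of s1] a_le[of s2] s12 by auto
      then have "\<bar>\<Delta>\<mu> - \<Delta>a\<bar> \<le> 2 * \<eta>"
        unfolding \<Delta>\<mu>_def \<Delta>a_def by linarith
      then have mu_a: "\<bar>\<Delta>\<mu> - \<Delta>a\<bar> \<le> (1 - 1 / q) * \<Delta>a"
        by (simp add: \<eta>_def \<Delta>a_def)
      have pos: "0 < \<Delta>a" "0 < \<Delta>\<nu>" "0 < s2 - s1"
        using \<open>a s1 < a s2\<close> nu12 s12(2) by (auto simp: \<Delta>a_def \<Delta>\<nu>_def)
      \<comment> \<open>The tolerance was dictated by the lower bound \<open>\<Delta>a / q\<close>;
        this inequality shows that it suffices for the upper bound as well.\<close>
      have "1 - 1 / q \<le> q - 1"
      proof -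
        have "0 \<le> (q - 1) * (q - 1) / q"
          using q by simp
        also have "\<dots> = (q - 1) - (1 - 1 / q)"
          using q by (simp add: field_simps)
        finally show ?thesis
          by simp
      qed
      then have "(1 - 1 / q) * \<Delta>a \<le> (q - 1) * \<Delta>a"
        using pos by (intro mult_right_mono) auto
      then have b1: "\<Delta>\<mu> \<le> q * \<Delta>a" "\<Delta>a / q \<le> \<Delta>\<mu>"
        using mu_a by (auto simp: left_diff_distrib abs_le_iff)
      have "a s2 - a s1 \<le> (s2 - s1) / (G / q)"
        unfolding a_def
        by (rule X.real_clock_upper[OF T(2) m(1) m_le]) (use s12 gU \<open>0 < G\<close> q in auto)
      moreover have "(s2 - s1) / (q * G) \<le> a s2 - a s1"
        unfolding a_def
        by (rule X.real_clock_lower[OF T(2) m(1) m_le]) (use s12 gU \<open>0 < G\<close> q in auto)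
      ultimately have b2: "\<Delta>a \<le> q * (s2 - s1) / G" "(s2 - s1) / (q * G) \<le> \<Delta>a"
        by (simp_all add: \<Delta>a_def mult.commute)
      have mq: "0 < m / q"
        using m q by simp
      have gY: "G / q ^ 2 \<le> g (the (xs k v)) \<and> g (the (xs k v)) \<le> q ^ 2 * G"
        if v: "\<nu> k s1 \<le> v" "v < \<nu> k s2" for v
      proof -
        obtain r where r: "s1 \<le> r" "r < s2" "near g e q (the (x r)) (the (xs k v))"
          using near_between[OF k s12 v] by blast
        have "g (the (x r)) \<le> q * g (the (xs k v))" "g (the (xs k v)) \<le> q * g (the (x r))"
          using r(3) by (simp_all add: near_def)
        moreover have "g (the (x r)) \<le> q * G" "G \<le> q * g (the (x r))"
          using gU[OF r(1,2)] q by (auto simp: pos_divide_le_eq mult.commute)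
        moreover have "q * g (the (x r)) \<le> q * (q * g (the (xs k v)))" "q * g (the (x r)) \<le> q * (q * G)"
          using calculation q by (auto intro!: mult_left_mono)
        ultimately have "G \<le> q * (q * g (the (xs k v)))" "g (the (xs k v)) \<le> q * (q * G)"
          by linarith+
        then have "G \<le> q ^ 2 * g (the (xs k v))" "g (the (xs k v)) \<le> q ^ 2 * G"
          by (simp_all add: power2_eq_square)
        then show ?thesis
          using q by (simp add: pos_divide_le_eq mult.commute)
      qed
      have real_P: "enn2real (clock g (xs k) (\<nu> k s1)) = \<mu> k (a s1)" "enn2real (clock g (xs k) (\<nu> k s2)) = \<mu> k (a s2)"
        using P1 P2 mu_nonneg[OF a_nonneg] by (simp_all add: P_def)
      have ex2: "ereal (\<nu> k s2) \<le> explosion_time (xs k)" and le2: "\<And>u. 0 \<le> u \<Longrightarrow> u < \<nu> k s2 \<Longrightarrow> m / q \<le> g (the (xs k u))"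
        and ge1: "0 \<le> \<nu> k s1"
        using P1 P2 by (auto simp: P_def)
      have Gq: "0 < G / q ^ 2" "0 < q ^ 2 * G"
        using \<open>0 < G\<close> q by simp_all
      have "enn2real (clock g (xs k) (\<nu> k s2)) - enn2real (clock g (xs k) (\<nu> k s1)) \<le> (\<nu> k s2 - \<nu> k s1) / (G / q ^ 2)"
        by (rule Yk.real_clock_upper[OF ex2 mq le2]) (use ge1 nu12 gY Gq in auto)
      moreover have "(\<nu> k s2 - \<nu> k s1) / (q ^ 2 * G) \<le> enn2real (clock g (xs k) (\<nu> k s2)) - enn2real (clock g (xs k) (\<nu> k s1))"
        by (rule Yk.real_clock_lower[OF ex2 mq le2]) (use ge1 nu12 gY Gq in auto)
      ultimately have b3: "\<Delta>\<mu> \<le> q ^ 2 * \<Delta>\<nu> / G" "\<Delta>\<nu> / (q ^ 2 * G) \<le> \<Delta>\<mu>"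
        by (simp_all add: real_P \<Delta>\<mu>_def \<Delta>\<nu>_def mult.commute)
      define slope where "slope = \<Delta>\<nu> / (s2 - s1)"
      \<comment> \<open>Two of the four factors come from the speed along \<open>xs k\<close>, one
        from \<open>\<mu> k\<close> and one from the speed along \<open>x\<close>.\<close>
      have "\<Delta>\<nu> \<le> q ^ 2 * G * \<Delta>\<mu>"
        using b3(2) Gq by (simp add: pos_divide_le_eq mult.commute)
      also have "\<dots> \<le> q ^ 2 * G * (q * \<Delta>a)"
        using b1 Gq by (intro mult_left_mono) auto
      also have "\<dots> \<le> q ^ 2 * G * (q * (q * (s2 - s1) / G))"
        using b2 Gq q by (intro mult_left_mono) auto
      also have "\<dots> = q ^ 4 * (s2 - s1)"
        using \<open>0 < G\<close> by (simp add: power2_eq_square power4_eq_xxxx)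
      finally have slope1: "slope \<le> q ^ 4"
        using pos by (simp add: slope_def pos_divide_le_eq)
      have "(s2 - s1) / (q * G) \<le> q * \<Delta>\<mu>"
      proof (rule order_trans[OF b2(2)])
        show "\<Delta>a \<le> q * \<Delta>\<mu>"
          using b1(2) q by (simp add: pos_divide_le_eq mult.commute)
      qed
      also have "\<dots> \<le> q * (q ^ 2 * \<Delta>\<nu> / G)"
        using b3 q by (intro mult_left_mono) auto
      finally have "(q * G) * ((s2 - s1) / (q * G)) \<le> (q * G) * (q * (q ^ 2 * \<Delta>\<nu> / G))"
        using \<open>0 < G\<close> q by (intro mult_left_mono) auto
      then have "s2 - s1 \<le> q ^ 4 * \<Delta>\<nu>"
        using \<open>0 < G\<close> q by (simp add: power2_eq_square power4_eq_xxxx mult.assoc)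
      then have slope2: "1 / q ^ 4 \<le> slope"
        using pos q by (simp add: slope_def field_simps)
      have slope_pos: "0 < slope"
        using pos by (simp add: slope_def)
      define l where "l v = \<nu> k s1 + slope * (v - s1)" for v
      have l2: "l s2 = \<nu> k s2"
        using pos by (simp add: l_def slope_def \<Delta>\<nu>_def)
      \<comment> \<open>\<open>l v\<close> need not equal \<open>\<nu> k v\<close>, but it lies
        between the same end values, so \<open>xs k\<close> is there near \<open>x r\<close> for
        some \<open>r\<close> in the interval. The small oscillation of \<open>x\<close> leads from
        \<open>r\<close> back to \<open>v\<close>, whence \<open>2 * e\<close>.\<close>
      have "mdist d (the (x v)) (the (xs k (l v))) \<le> 2 * e" if v: "s1 \<le> v" "v < s2" for v
      proof -
        have "\<nu> k s1 \<le> l v"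
          using v slope_pos by (simp add: l_def)
        moreover have "l v < l s2"
          using v slope_pos by (simp add: l_def)
        ultimately obtain r where r: "s1 \<le> r" "r < s2" "the (xs k (l v)) \<in> topspace S"
          "near g e q (the (x r)) (the (xs k (l v)))"
          using near_between[OF k s12, of "l v"] l2 by auto
        have "near g e q (the (x v)) (the (x r))"
          by (intro near_U range_U v r(1,2))
        moreover have "the (x v) \<in> mspace d" "the (x r) \<in> mspace d" "the (xs k (l v)) \<in> mspace d"
          using r(1,2,3) v s12(1,3) K_topspace[OF K(2)] by (auto simp flip: topspace_eq)
        then have "mdist d (the (x v)) (the (xs k (l v))) \<le>
            mdist d (the (x v)) (the (x r)) + mdist d (the (x r)) (the (xs k (l v)))"
          by (rule D.triangle)
        ultimately show ?thesis
          using r(4) by (simp add: near_def)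
      qed
      moreover have "slopes_within (q ^ 4) s1 s2 l"
        unfolding l_def by (rule slopes_within_linear[OF slope2 slope1])
      ultimately have "piece k s1 s2 l"
        using l2 by (simp add: piece_def l_def)
      then show ?case
        by blast
    qed
    then show ?case
      by blast
  next
    case (trans s1 s2 s3)
    show ?case
    proof (cases "s1 < s2 \<and> s2 < s3")
      case False
      then have "s1 = s2 \<or> s2 = s3"
        using trans by auto
      then show ?thesis
        using trans by auto
    next
      case True
      with trans have "\<forall>\<^sub>F k in sequentially. \<exists>l. piece k s1 s2 l" "\<forall>\<^sub>F k in sequentially. \<exists>l. piece k s2 s3 l"
        by auto
      then have "\<forall>\<^sub>F k in sequentially. \<exists>l. piece k s1 s3 l"
      proof eventually_elim
        case (elim k)
        then obtain l1 l2 where l1: "piece k s1 s2 l1" and l2: "piece k s2 s3 l2"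
          by blast
        define l where "l s = (if s \<le> s2 then l1 s else l2 s)" for s
        have "slopes_within (q ^ 4) s1 s3 l"
          unfolding l_def using l1 l2 by (intro slopes_within_glue) (auto simp: piece_def)
        moreover have "mdist d (the (x v)) (the (xs k (l v))) \<le> 2 * e" if "s1 \<le> v" "v < s3" for v
        proof -
          consider "v < s2" | "v = s2" | "s2 < v"
            by linarith
          then show ?thesis
          proof cases
            \<comment> \<open>The left piece controls distances only before its end. Both pieces
              take the value \<open>\<nu> k s2\<close> at the seam, so the bound of the right piece
              applies.\<close>
            case 2
            then have "l v = l2 v"
              using l1 l2 by (simp add: l_def piece_def)
            moreover have "mdist d (the (x v)) (the (xs k (l2 v))) \<le> 2 * e"
              using l2 2 that by (auto simp: piece_def)
            ultimately show ?thesis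
              by (simp only:)
          qed (use l1 l2 that in \<open>auto simp: l_def piece_def\<close>)
        qed
        ultimately have "piece k s1 s3 l"
          using l1 l2 True by (simp add: piece_def l_def)
        then show ?case
          by blast
      qed
      then show ?thesis
        by blast
    qed
  qed simp
  \<comment> \<open>The induction concerns nondegenerate intervals only; for \<open>T = 0\<close>
    the identity serves as a piece.\<close>
  then have "\<forall>\<^sub>F k in sequentially. \<exists>l. piece k 0 T l"
  proof (cases "T = 0")
    case True
    show ?thesis
      using good_ev
    proof (rule eventually_mono)
      fix k assume k: "good k"
      have "slopes_within (q ^ 4) 0 0 (\<lambda>s. 0 + 1 * (s - 0))"
        using q by (intro slopes_within_linear) (auto simp: one_le_power)
      then have "piece k 0 T (\<lambda>s. 0 + 1 * (s - 0))"
        using nu_0[OF k] True by (simp add: piece_def)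
      then show "\<exists>l. piece k 0 T l"
        by blast
    qed
  qed (use T in simp)
  with good_ev
  show "\<forall>\<^sub>F k in sequentially. \<exists>l\<in>bilipschitz_changes. 0 \<le> l T \<and> ereal (l T) \<le> explosion_time (xs k) \<and>
      xs k (l T) = time_change g (xs k) (\<mu> k A) \<and> log_slope_norm l T \<le> ennreal (ln (q ^ 4)) \<and>
      (\<forall>s\<in>{0..<T}. mdist d (the (x s)) (the (xs k (l s))) \<le> 2 * e)"
  proof eventually_elim
    case (elim k)
    note k = elim(1)
    obtain l where l: "piece k 0 T l"
      using elim(2) by blast
    have "slopes_within (q ^ 4) 0 T l" "l 0 = 0" "1 \<le> q ^ 4"
      using l nu_0[OF k] q by (auto simp: piece_def one_le_power)
    then obtain l' where l': "l' \<in> bilipschitz_changes" "\<And>s. 0 \<le> s \<Longrightarrow> s \<le> T \<Longrightarrow> l' s = l s"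
      "log_slope_norm l' T \<le> ennreal (ln (q ^ 4))"
      by (rule slopes_within_extend[OF _ _ _ T(1)]) (assumption | rule that)+
    have "l' T = \<nu> k T"
      using l'(2)[of T] T l by (simp add: piece_def)
    moreover have PT: "P k T (\<nu> k T)"
      using nu[OF k] T by simp
    moreover have "time_change g (xs k) (\<mu> k A) = xs k (\<nu> k T)"
      using PT by (intro path_clock.time_change_at_clock[OF Y]) (auto simp: P_def aT)
    ultimately show ?case
      using l' l by (intro bexI[of _ l']) (auto simp: P_def piece_def)
  qed
qed


text \<open>If \<open>x\<close> explodes inside a compact set, a single window ends at the
  explosion, where \<open>D_loc\<close> provides the left limit that the interval induction needs.
  Otherwise windows exhaust the lifetime from inside.\<close>

lemma global_imp_local:
  assumes x: "x \<in> D_loc S" and xs: "\<And>k. xs k \<in> D_loc S"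
    and g: "continuous_map S (top_of_set {0<..}) g"
    and global: "global_skorokhod_converges d\<^sub>\<Delta> (\<lambda>k. time_change g (xs k)) (time_change g x)"
  shows "local_skorokhod_converges S d xs x"
proof -
  note x' = D_loc_imp_D_exp[OF x] and xs' = D_loc_imp_D_exp[OF xs]
  interpret X: path_clock S g x
    by (rule path_clockI[OF x' g])
  interpret E: Metric_space "mspace d\<^sub>\<Delta>" "mdist d\<^sub>\<Delta>"
    by simp
  have Y: "path_clock S g (xs k)" for k
    by (rule path_clockI[OF xs' g])
  obtain \<mu> where \<mu>: "\<And>k. \<mu> k \<in> increasing_homeomorphisms"
    and conv: "\<And>t e. 0 \<le> t \<Longrightarrow> 0 < e \<Longrightarrow> \<forall>\<^sub>F k in sequentially. \<forall>u\<in>{0..t}.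
      mdist d\<^sub>\<Delta> (time_change g x u) (time_change g (xs k) (\<mu> k u)) < e \<and> \<bar>\<mu> k u - u\<bar> < e"
    by (rule global_skorokhod_convergesD[OF global]) (rule that)
  \<comment> \<open>These values make both tolerances of \<open>backward_window\<close>,
    \<open>2 * e j\<close> and \<open>ln (q j ^ 4)\<close>, equal to
    \<open>1 / Suc j\<close>.\<close>
  define e where "e j = 1 / (2 * real (Suc j))" for j
  define q where "q j = exp (1 / (4 * real (Suc j)))" for j
  have e: "0 < e j" "2 * e j = 1 / real (Suc j)" and q: "1 < q j" "ln (q j ^ 4) = 1 / real (Suc j)" for j
    by (simp_all add: e_def q_def ln_realpow del: of_nat_Suc)
  have Suc_le: "1 / real (Suc (Suc j)) \<le> 1 / real (Suc j)" for j
    by (simp add: frac_le)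
  have small: "\<exists>j. 1 / real (Suc j) < \<epsilon>" if "0 < \<epsilon>" for \<epsilon> :: real
    using that nat_approx_posE by blast
  have id: "(\<lambda>s. s) \<in> bilipschitz_changes"
    by (rule bilipschitz_changesI[of 1]) auto
  \<comment> \<open>The bound is asked only from some level \<open>j0\<close> on, since with growing
    windows the earlier ones may end before \<open>t\<close>.\<close>
  have slope_tendsto: "(\<lambda>k. log_slope_norm (l k) t) \<longlonglongrightarrow> 0"
    if "\<And>j. j0 \<le> j \<Longrightarrow> \<forall>\<^sub>F k in sequentially. log_slope_norm (l k) t \<le> ennreal (1 / real (Suc j))" for l t and j0 :: nat
  proof (rule order_tendstoI)
    fix b :: ennreal assume "0 < b"
    then obtain c where c: "0 < c" "c < b"
      using dense by blast
    then obtain r where r: "c = ennreal r" "0 < r"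
      by (cases c) (auto simp: ennreal_less_zero_iff)
    obtain j1 where j1: "1 / real (Suc j1) < r"
      using small[OF r(2)] by blast
    define j where "j = max j0 j1"
    have "1 / real (Suc j) \<le> 1 / real (Suc j1)"
      by (simp add: j_def frac_le)
    then have "ennreal (1 / real (Suc j)) \<le> c"
      unfolding r(1) using j1 by (intro ennreal_leI) simp
    then have "ennreal (1 / real (Suc j)) < b"
      using c(2) by (rule le_less_trans)
    note less = this
    have "\<forall>\<^sub>F k in sequentially. log_slope_norm (l k) t \<le> ennreal (1 / real (Suc j))"
      by (rule that) (simp add: j_def)
    then show "\<forall>\<^sub>F k in sequentially. log_slope_norm (l k) t < b"
      by (rule eventually_mono) (rule le_less_trans[OF _ less])
  qed simp
  show ?thesis
  proof (cases "explosion_time x < \<infinity> \<and> relatively_compact_in S (visited x)")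
    case True
    define T where "T = real_of_ereal (explosion_time x)"
    have Tx: "explosion_time x = ereal T" "0 \<le> T"
      using True X.explosion_time_nonneg by (cases "explosion_time x"; auto simp: T_def)+
    then have Tx': "ereal T \<le> explosion_time x"
      by simp
    obtain K where K: "compactin S K" "visited x \<subseteq> K"
      using True by (auto simp: relatively_compact_in_def)
    have K': "the (x s) \<in> K" if "0 \<le> s" "s < T" for s
      using K(2) that Tx(1) by (auto simp: visited_def)
    have left: "\<exists>p. limitin S (\<lambda>s. the (x s)) p (at_left t)" if t: "0 < t" "t \<le> T" for t
    proof (cases "t = T")
      case True
      then show ?thesis
        using x t Tx(1) \<open>explosion_time x < \<infinity> \<and> relatively_compact_in S (visited x)\<close>
        by (auto simp: D_loc_def)
    next
      case False
      then show ?thesis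
        using t Tx(1) by (intro X.left_limit) auto
    qed
    define A where "A = enn2real (clock g x T)"
    have A: "clock g x T = ennreal A"
      unfolding A_def by (rule backward_window(1)[OF x' xs' g \<mu> Tx(2) Tx' left K(1) K' conv e(1) q(1)])
    \<comment> \<open>The time-changed \<open>x\<close> is in the cemetery from \<open>A\<close> on,
      so closeness at the single time \<open>A\<close> drives \<open>xs k (l T)\<close> to the
      cemetery.\<close>
    have yA: "time_change g x A = None"
      by (rule X.time_change_after_explosion[OF Tx(1) A order_refl])
    define Q where "Q j k l \<longleftrightarrow> ereal (l T) \<le> explosion_time (xs k) \<and>
        (\<forall>s\<in>{0..<T}. mdist d (the (x s)) (the (xs k (l s))) \<le> 1 / real (Suc j)) \<and>
        mdist d\<^sub>\<Delta> None (xs k (l T)) < 1 / real (Suc j) \<and> log_slope_norm l T \<le> ennreal (1 / real (Suc j))" for j k l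
    have ex: "\<forall>\<^sub>F k in sequentially. \<exists>l\<in>bilipschitz_changes. Q j k l" for j
    proof -
      have "\<forall>\<^sub>F k in sequentially. \<forall>u\<in>{0..A}. mdist d\<^sub>\<Delta> (time_change g x u) (time_change g (xs k) (\<mu> k u)) < 1 / real (Suc j) \<and>
          \<bar>\<mu> k u - u\<bar> < 1 / real (Suc j)"
        by (rule conv) (simp_all add: A_def)
      moreover
      have "\<forall>\<^sub>F k in sequentially. \<exists>l\<in>bilipschitz_changes. 0 \<le> l T \<and>
          ereal (l T) \<le> explosion_time (xs k) \<and> xs k (l T) = time_change g (xs k) (\<mu> k A) \<and>
          log_slope_norm l T \<le> ennreal (ln (q j ^ 4)) \<and>
          (\<forall>s\<in>{0..<T}. mdist d (the (x s)) (the (xs k (l s))) \<le> 2 * e j)"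
        unfolding A_def
        by (rule backward_window(2)[OF x' xs' g \<mu> Tx(2) Tx' left K(1) K' conv e(1) q(1)])
      ultimately
      show ?thesis
      proof eventually_elim
        case (elim k)
        from elim(2) obtain l where l: "l \<in> bilipschitz_changes" "0 \<le> l T" "ereal (l T) \<le> explosion_time (xs k)"
          "xs k (l T) = time_change g (xs k) (\<mu> k A)" "log_slope_norm l T \<le> ennreal (1 / real (Suc j))"
          "\<forall>s\<in>{0..<T}. mdist d (the (x s)) (the (xs k (l s))) \<le> 1 / real (Suc j)"
          unfolding e(2) q(2) by blast
        have "mdist d\<^sub>\<Delta> (time_change g x A) (time_change g (xs k) (\<mu> k A)) < 1 / real (Suc j)"
          using elim(1) by (auto simp: A_def)
        then have "mdist d\<^sub>\<Delta> None (xs k (l T)) < 1 / real (Suc j)"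
          by (simp only: yA l(4))
        then have "Q j k l"
          unfolding Q_def using l by blast
        then show ?case
          using l(1) by blast
      qed
    qed
    have anti: "Q j k l" if "Q (Suc j) k l" for j k l
    proof -
      have Q: "ereal (l T) \<le> explosion_time (xs k)"
        "\<forall>s\<in>{0..<T}. mdist d (the (x s)) (the (xs k (l s))) \<le> 1 / real (Suc (Suc j))"
        "mdist d\<^sub>\<Delta> None (xs k (l T)) < 1 / real (Suc (Suc j))"
        "log_slope_norm l T \<le> ennreal (1 / real (Suc (Suc j)))"
        using that unfolding Q_def by blast+
      have "\<forall>s\<in>{0..<T}. mdist d (the (x s)) (the (xs k (l s))) \<le> 1 / real (Suc j)"
        using Q(2) order_trans[OF _ Suc_le[of j]] by blast
      moreover have "mdist d\<^sub>\<Delta> None (xs k (l T)) < 1 / real (Suc j)"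
        using Q(3) Suc_le[of j] by (rule less_le_trans)
      moreover have "log_slope_norm l T \<le> ennreal (1 / real (Suc j))"
        using Q(4) ennreal_leI[OF Suc_le[of j]] by (rule order_trans)
      ultimately show ?thesis
        unfolding Q_def using Q(1) by blast
    qed
    obtain l where l: "\<And>k. l k \<in> bilipschitz_changes" "\<And>j. \<forall>\<^sub>F k in sequentially. Q j k (l k)"
      by (rule diagonal_sequence[where Q = Q, OF ex anti id]) (assumption | rule that)+
    have 1: "\<forall>\<^sub>F k in sequentially. ereal (l k T) \<le> explosion_time (xs k)"
      using l(2)[of 0] by (rule eventually_mono) (simp add: Q_def)
    have 2: "(\<lambda>k. SUP s\<in>{0..<T}. ennreal (mdist d (the (x s)) (the (xs k (l k s))))) \<longlonglongrightarrow> 0"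
    proof (rule SUP_ennreal_tendsto_0I)
      fix \<epsilon> :: real assume "0 < \<epsilon>"
      then obtain j where j: "1 / real (Suc j) < \<epsilon>"
        using small by blast
      show "\<forall>\<^sub>F k in sequentially. \<forall>s\<in>{0..<T}. mdist d (the (x s)) (the (xs k (l k s))) \<le> \<epsilon>"
        using l(2)[of j]
      proof (rule eventually_mono)
        fix k assume "Q j k (l k)"
        then have "\<forall>s\<in>{0..<T}. mdist d (the (x s)) (the (xs k (l k s))) \<le> 1 / real (Suc j)"
          by (simp add: Q_def)
        then show "\<forall>s\<in>{0..<T}. mdist d (the (x s)) (the (xs k (l k s))) \<le> \<epsilon>"
          using order_trans[OF _ less_imp_le[OF j]] by blast
      qed
    qed
    have 3: "limitin (Alexandroff_compactification S) (\<lambda>k. xs k (l k T)) None sequentially"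
    proof -
      have in_mspace: "xs k (l k T) \<in> mspace d\<^sub>\<Delta>" for k
        using path_clock.path_at[OF Y, of "l k T" k] bilipschitz_change_nonneg[OF l(1) Tx(2), of k]
        by (auto simp: mspace_d\<^sub>\<Delta> split: if_splits)
      have "limitin E.mtopology (\<lambda>k. xs k (l k T)) None sequentially"
        unfolding E.limitin_metric
      proof (intro conjI allI impI)
        fix \<epsilon> :: real assume "0 < \<epsilon>"
        then obtain j where j: "1 / real (Suc j) < \<epsilon>"
          using small by blast
        show "\<forall>\<^sub>F k in sequentially. xs k (l k T) \<in> mspace d\<^sub>\<Delta> \<and> mdist d\<^sub>\<Delta> (xs k (l k T)) None < \<epsilon>"
          using l(2)[of j]
        proof (rule eventually_mono)
          fix k assume "Q j k (l k)"
          then have "mdist d\<^sub>\<Delta> None (xs k (l k T)) < 1 / real (Suc j)"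
            by (simp add: Q_def)
          then have "mdist d\<^sub>\<Delta> (xs k (l k T)) None < \<epsilon>"
            using j by (subst E.commute) linarith
          then show "xs k (l k T) \<in> mspace d\<^sub>\<Delta> \<and> mdist d\<^sub>\<Delta> (xs k (l k T)) None < \<epsilon>"
            using in_mspace by blast
        qed
      qed (simp add: mspace_d\<^sub>\<Delta>)
      then show ?thesis
        using d\<^sub>\<Delta> by (simp add: mtopology_of_def)
    qed
    have 4: "(\<lambda>k. log_slope_norm (l k) T) \<longlonglongrightarrow> 0"
    proof (rule slope_tendsto[of 0])
      show "\<forall>\<^sub>F k in sequentially. log_slope_norm (l k) T \<le> ennreal (1 / real (Suc j))" for j
        using l(2)[of j] by (rule eventually_mono) (simp add: Q_def)
    qed
    show ?thesis
      unfolding local_skorokhod_converges_def Let_def T_def[symmetric]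
      using True l(1) 1 2 3 4 by (intro exI[of _ l]) simp
  next
    case False
    \<comment> \<open>The windows end strictly before the explosion, because \<open>x\<close> may
      leave every compact set on approaching it, and their ends are cofinal in the lifetime.\<close>
    define t where "t j = (if explosion_time x = \<infinity> then real j
        else real_of_ereal (explosion_time x) * (1 - 1 / real (Suc j)))" for j
    \<comment> \<open>A path dead from the start visits nothing, so it belongs to the previous
      case.\<close>
    have "0 < explosion_time x"
    proof (rule ccontr)
      assume "\<not> 0 < explosion_time x"
      then have "explosion_time x = 0"
        using X.explosion_time_nonneg by simp
      moreover from this have "visited x = {}"
        by (auto simp: visited_def zero_ereal_def)
      ultimately show False
        using False by (auto simp: relatively_compact_in_def intro: exI[of _ "{}"])
    qed
    have t: "0 \<le> t j" "ereal (t j) < explosion_time x" "t j \<le> t (Suc j)" for j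
    proof -
      show "0 \<le> t j" "t j \<le> t (Suc j)"
        using \<open>0 < explosion_time x\<close> Suc_le[of j]
        by (auto simp: t_def real_of_ereal_pos intro!: mult_left_mono mult_nonneg_nonneg)
      show "ereal (t j) < explosion_time x"
      proof (cases "explosion_time x")
        case (real r)
        then have "0 < r"
          using \<open>0 < explosion_time x\<close> by simp
        then have "r * (1 - 1 / real (Suc j)) < r * 1"
          by (intro mult_strict_left_mono) auto
        then show ?thesis
          using real by (simp add: t_def)
      qed (use \<open>0 < explosion_time x\<close> in \<open>auto simp: t_def\<close>)
    qed
    have t_mono: "t i \<le> t j" if "i \<le> j" for i j
      using that by (rule lift_Suc_mono_le[of t, OF t(3)])
    have t_cofinal: "\<exists>j. s \<le> t j" if s: "0 \<le> s" "ereal s < explosion_time x" for s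
    proof (cases "explosion_time x")
      case (real r)
      then have "s < r" "0 < r"
        using s \<open>0 < explosion_time x\<close> by auto
      then have "0 < (r - s) / r"
        by simp
      then obtain j where "1 / real (Suc j) < (r - s) / r"
        using small by blast
      then have "r * (1 / real (Suc j)) \<le> r * ((r - s) / r)"
        using \<open>0 < r\<close> by (intro mult_left_mono) auto
      also have "\<dots> = r - s"
        using \<open>0 < r\<close> by simp
      finally have "s \<le> r * (1 - 1 / real (Suc j))"
        by (simp add: right_diff_distrib)
      then show ?thesis
        using real by (intro exI[of _ j]) (simp add: t_def)
    next
      case PInf
      then show ?thesis
        using real_arch_simple[of s] by (simp add: t_def)
    qed (use \<open>0 < explosion_time x\<close> in simp)
    define Q where "Q j k l \<longleftrightarrow> l \<in> bilipschitz_changes \<and> ereal (l (t j)) < explosion_time (xs k) \<and>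
        (\<forall>s\<in>{0..t j}. mdist d (the (x s)) (the (xs k (l s))) \<le> 1 / real (Suc j)) \<and>
        log_slope_norm l (t j) \<le> ennreal (1 / real (Suc j))" for j k l
    have ex: "\<forall>\<^sub>F k in sequentially. \<exists>l\<in>bilipschitz_changes. Q j k l" for j
    proof -
      obtain K where K: "compactin S K" "\<And>s. 0 \<le> s \<Longrightarrow> s \<le> t j \<Longrightarrow> the (x s) \<in> K"
        by (rule X.compact_range[OF t(1,2)]) (rule that)
      have K': "the (x s) \<in> K" if "0 \<le> s" "s < t j" for s
        using K(2) that by simp
      have left: "\<exists>p. limitin S (\<lambda>s. the (x s)) p (at_left s)" if s: "0 < s" "s \<le> t j" for s
      proof (rule X.left_limit[OF s(1)])
        have "ereal s \<le> ereal (t j)"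
          using s(2) by simp
        then show "ereal s < explosion_time x"
          using t(2) by (rule le_less_trans)
      qed
      define A where "A = enn2real (clock g x (t j))"
      have A: "clock g x (t j) = ennreal A"
        unfolding A_def
        by (rule backward_window(1)[OF x' xs' g \<mu> t(1) less_imp_le[OF t(2)] left K(1) K' conv e(1) q(1)])
      have yA: "time_change g x A = Some (the (x (t j)))"
        using X.time_change_at_clock[OF t(1) less_imp_le[OF t(2)] A] X.alive(2)[OF t(1,2)] by (rule trans)
      \<comment> \<open>The distance estimate of the window omits its end \<open>t j\<close>. As
        \<open>x\<close> is alive there, closeness in the compactification gives both the survival
        of \<open>xs k\<close> at \<open>l (t j)\<close> and the missing distance bound.\<close>
      obtain \<delta> where \<delta>: "0 < \<delta>"
        "\<And>p z. p \<in> K \<Longrightarrow> z \<in> topspace (Alexandroff_compactification S) \<Longrightarrow> mdist d\<^sub>\<Delta> (Some p) z < \<delta> \<Longrightarrow>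
          \<exists>p'\<in>topspace S. z = Some p' \<and> near g (e j) (q j) p p'"
        by (rule near_of_dist_Some[OF g e(1) q(1) K(1)]) (rule that)
      have "\<forall>\<^sub>F k in sequentially. \<forall>u\<in>{0..A}. mdist d\<^sub>\<Delta> (time_change g x u) (time_change g (xs k) (\<mu> k u)) < \<delta> \<and>
          \<bar>\<mu> k u - u\<bar> < \<delta>"
        by (rule conv[OF _ \<delta>(1)]) (simp add: A_def)
      moreover
      have "\<forall>\<^sub>F k in sequentially. \<exists>l\<in>bilipschitz_changes. 0 \<le> l (t j) \<and>
          ereal (l (t j)) \<le> explosion_time (xs k) \<and> xs k (l (t j)) = time_change g (xs k) (\<mu> k A) \<and>
          log_slope_norm l (t j) \<le> ennreal (ln (q j ^ 4)) \<and>
          (\<forall>s\<in>{0..<t j}. mdist d (the (x s)) (the (xs k (l s))) \<le> 2 * e j)"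
        unfolding A_def
        by (rule backward_window(2)[OF x' xs' g \<mu> t(1) less_imp_le[OF t(2)] left K(1) K' conv e(1) q(1)])
      ultimately
      show ?thesis
      proof eventually_elim
        case (elim k)
        from elim(2) obtain l where l: "l \<in> bilipschitz_changes" "0 \<le> l (t j)" "ereal (l (t j)) \<le> explosion_time (xs k)"
          "xs k (l (t j)) = time_change g (xs k) (\<mu> k A)" "log_slope_norm l (t j) \<le> ennreal (1 / real (Suc j))"
          "\<forall>s\<in>{0..<t j}. mdist d (the (x s)) (the (xs k (l s))) \<le> 1 / real (Suc j)"
          unfolding e(2) q(2) by blast
        have "mdist d\<^sub>\<Delta> (time_change g x A) (time_change g (xs k) (\<mu> k A)) < \<delta>"
          using elim(1) by (auto simp: A_def)
        then have "mdist d\<^sub>\<Delta> (Some (the (x (t j)))) (xs k (l (t j))) < \<delta>"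
          by (simp only: yA l(4))
        moreover have "xs k (l (t j)) \<in> topspace (Alexandroff_compactification S)"
          using path_clock.path_at[OF Y l(2), of k] by (auto simp: topspace_Alexandroff_compactification split: if_splits)
        ultimately obtain p' where p': "p' \<in> topspace S" "xs k (l (t j)) = Some p'"
          "near g (e j) (q j) (the (x (t j))) p'"
          using \<delta>(2)[OF K(2)[OF t(1) order_refl]] by blast
        have alive: "ereal (l (t j)) < explosion_time (xs k)"
          using path_clock.alive_iff[OF Y l(2)] p'(2) by simp
        have "mdist d (the (x (t j))) (the (xs k (l (t j)))) \<le> 1 / real (Suc j)"
          using p'(2,3) e(1)[of j] e(2)[of j] by (simp add: near_def del: of_nat_Suc)
        moreover have "s \<in> {0..<t j} \<or> s = t j" if "s \<in> {0..t j}" for s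
          using that by auto
        ultimately have "\<forall>s\<in>{0..t j}. mdist d (the (x s)) (the (xs k (l s))) \<le> 1 / real (Suc j)"
          using l(6) by blast
        then have "Q j k l"
          unfolding Q_def using l alive by blast
        then show ?case
          using l(1) by blast
      qed
    qed
    have below: "ereal (l s) < explosion_time (xs k)"
      if l: "l \<in> bilipschitz_changes" "ereal (l r) < explosion_time (xs k)" and s: "0 \<le> s" "s \<le> r" for k l r s
    proof -
      have "strict_mono_on {0..} l"
        using l(1) by (simp add: bilipschitz_changes_def)
      then have "ereal (l s) \<le> ereal (l r)"
        using strict_mono_on_leD[of "{0..}" l s r] s by simp
      then show ?thesis
        using l(2) by (rule le_less_trans)
    qed
    have anti: "Q j k l" if "Q (Suc j) k l" for j k l
    proof -
      have Q: "l \<in> bilipschitz_changes" "ereal (l (t (Suc j))) < explosion_time (xs k)"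
        "\<forall>s\<in>{0..t (Suc j)}. mdist d (the (x s)) (the (xs k (l s))) \<le> 1 / real (Suc (Suc j))"
        "log_slope_norm l (t (Suc j)) \<le> ennreal (1 / real (Suc (Suc j)))"
        using that unfolding Q_def by blast+
      have "mdist d (the (x s)) (the (xs k (l s))) \<le> 1 / real (Suc j)" if "s \<in> {0..t j}" for s
      proof -
        have "s \<in> {0..t (Suc j)}"
          using that t(3)[of j] by simp
        then show ?thesis
          using Q(3) order_trans[OF _ Suc_le[of j]] by blast
      qed
      moreover have "log_slope_norm l (t j) \<le> ennreal (1 / real (Suc j))"
        by (rule order_trans[OF log_slope_norm_mono[OF t(3)] order_trans[OF Q(4) ennreal_leI[OF Suc_le]]])
      ultimately show ?thesis
        unfolding Q_def using Q(1) below[OF Q(1,2) t(1) t(3)] by blast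
    qed
    obtain l where l: "\<And>k. l k \<in> bilipschitz_changes" "\<And>j. \<forall>\<^sub>F k in sequentially. Q j k (l k)"
      by (rule diagonal_sequence[where Q = Q, OF ex anti id]) (assumption | rule that)+
    have "(\<forall>\<^sub>F k in sequentially. ereal (l k s) < explosion_time (xs k)) \<and>
        (\<lambda>k. SUP r\<in>{0..s}. ennreal (mdist d (the (x r)) (the (xs k (l k r))))) \<longlonglongrightarrow> 0 \<and>
        (\<lambda>k. log_slope_norm (l k) s) \<longlonglongrightarrow> 0"
      if s: "0 \<le> s" "ereal s < explosion_time x" for s
    proof (intro conjI)
      obtain j0 where j0: "s \<le> t j0"
        using t_cofinal[OF s] by blast
      have j0_le: "s \<le> t j" if "j0 \<le> j" for j
        using j0 t_mono[OF that] by simp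
      show "\<forall>\<^sub>F k in sequentially. ereal (l k s) < explosion_time (xs k)"
        using l(2)[of j0]
      proof (rule eventually_mono)
        fix k assume "Q j0 k (l k)"
        then show "ereal (l k s) < explosion_time (xs k)"
          unfolding Q_def by (intro below[OF l(1) _ s(1) j0]) blast
      qed
      show "(\<lambda>k. SUP r\<in>{0..s}. ennreal (mdist d (the (x r)) (the (xs k (l k r))))) \<longlonglongrightarrow> 0"
      proof (rule SUP_ennreal_tendsto_0I)
        fix \<epsilon> :: real assume "0 < \<epsilon>"
        then obtain j1 where j1: "1 / real (Suc j1) < \<epsilon>"
          using small by blast
        define j where "j = max j0 j1"
        have "1 / real (Suc j) \<le> 1 / real (Suc j1)"
          by (simp add: j_def frac_le)
        then have j: "1 / real (Suc j) \<le> \<epsilon>" "s \<le> t j"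
          using j1 j0_le[of j] by (simp_all add: j_def)
        show "\<forall>\<^sub>F k in sequentially. \<forall>r\<in>{0..s}. mdist d (the (x r)) (the (xs k (l k r))) \<le> \<epsilon>"
          using l(2)[of j]
        proof (rule eventually_mono, intro ballI)
          fix k r assume "Q j k (l k)" "r \<in> {0..s}"
          then have "mdist d (the (x r)) (the (xs k (l k r))) \<le> 1 / real (Suc j)"
            using j(2) unfolding Q_def by simp
          then show "mdist d (the (x r)) (the (xs k (l k r))) \<le> \<epsilon>"
            using j(1) by (rule order_trans)
        qed
      qed
      show "(\<lambda>k. log_slope_norm (l k) s) \<longlonglongrightarrow> 0"
      proof (rule slope_tendsto[of j0])
        fix j assume "j0 \<le> j"
        show "\<forall>\<^sub>F k in sequentially. log_slope_norm (l k) s \<le> ennreal (1 / real (Suc j))"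
          using l(2)[of j]
        proof (rule eventually_mono)
          fix k assume "Q j k (l k)"
          then have "log_slope_norm (l k) (t j) \<le> ennreal (1 / real (Suc j))"
            unfolding Q_def by blast
          then show "log_slope_norm (l k) s \<le> ennreal (1 / real (Suc j))"
            by (rule order_trans[OF log_slope_norm_mono[OF j0_le[OF \<open>j0 \<le> j\<close>]]])
        qed
      qed
    qed
    note main = this
    show ?thesis
      unfolding local_skorokhod_converges_def if_not_P[OF False]
    proof (rule exI[of _ l], rule conjI, intro allI)
      show "l k \<in> bilipschitz_changes" for k
        by (rule l(1))
    qed (intro allI impI, rule main)
  qed
qed

end

theorem corollary3p9:
  fixes S :: "'a topology"
    and d :: "'a metric"
    and d\<^sub>\<Delta> :: "'a option metric"
    and x :: "'a trajectory"
    and xs :: "nat \<Rightarrow> 'a trajectory"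
  assumes "locally_compact_space S" and "Hausdorff_space S" and "second_countable S"
    and "mtopology_of d = S"
    and "mtopology_of d\<^sub>\<Delta> = Alexandroff_compactification S"
    and "x \<in> D_loc S" and "\<And>k. xs k \<in> D_loc S"
  shows "local_skorokhod_converges S d xs x \<longleftrightarrow>
    (\<exists>g. continuous_map S (top_of_set {0<..}) g \<and>
      time_change g x \<in> D_cadlag (Alexandroff_compactification S) \<and>
      (\<forall>k. time_change g (xs k) \<in> D_cadlag (Alexandroff_compactification S)) \<and>
      global_skorokhod_converges d\<^sub>\<Delta> (\<lambda>k. time_change g (xs k)) (time_change g x))"
proof -
  interpret skorokhod_metrics S d d\<^sub>\<Delta>
    using assms(1,4,5) by (rule skorokhod_metrics.intro)
  show ?thesis
  proof
    assume local: "local_skorokhod_converges S d xs x"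
    obtain g where "continuous_map S (top_of_set {0<..}) g"
      "time_change g x \<in> D_cadlag (Alexandroff_compactification S)"
      "\<And>k. time_change g (xs k) \<in> D_cadlag (Alexandroff_compactification S)"
      "global_skorokhod_converges d\<^sub>\<Delta> (\<lambda>k. time_change g (xs k)) (time_change g x)"
      by (rule local_imp_global[OF assms(6,7) local]) (rule that)
    then show "\<exists>g. continuous_map S (top_of_set {0<..}) g \<and>
      time_change g x \<in> D_cadlag (Alexandroff_compactification S) \<and>
      (\<forall>k. time_change g (xs k) \<in> D_cadlag (Alexandroff_compactification S)) \<and>
      global_skorokhod_converges d\<^sub>\<Delta> (\<lambda>k. time_change g (xs k)) (time_change g x)"
      by (intro exI[of _ g] conjI allI)
  next
    assume "\<exists>g. continuous_map S (top_of_set {0<..}) g \<and>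
      time_change g x \<in> D_cadlag (Alexandroff_compactification S) \<and>
      (\<forall>k. time_change g (xs k) \<in> D_cadlag (Alexandroff_compactification S)) \<and>
      global_skorokhod_converges d\<^sub>\<Delta> (\<lambda>k. time_change g (xs k)) (time_change g x)"
    then show "local_skorokhod_converges S d xs x"
      by (elim exE conjE) (rule global_imp_local[OF assms(6,7)])
  qed
qed

end
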